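(* Let $P$ be a law on environments on $\mathbb{Z}^d$ that is uniformly elliptic, i.i.d., and non-nestling. Let $H$ be the annealed large deviation rate function of $X_n/n$ and let $\mathrm{v}_P$ be the limiting velocity of the walk. Then there is a neighborhood $\mathcal{A}'$ of $\mathrm{v}_P$ on which $H$ is analytic and strictly convex.
   Context: Random walk in random environment (RWRE). Let $d\ge 1$, let $\|\cdot\|$ be the Euclidean norm, $\mathcal{E}_d=\{x\in\mathbb{Z}^d:\|x\|=1\}$, let $\mathcal{M}(\mathcal{E}_d)$ be the set of probability measures on $\mathcal{E}_d$, and $\Omega=(\mathcal{M}(\mathcal{E}_d))^{\mathbb{Z}^d}$ with the $\sigma$-field $\mathcal{F}$ generated by cylinder sets. $P$ is a probability measure on $(\Omega,\mathcal{F})$; an environment $\omega=\{\omega(x,\cdot)\}_{x\in\mathbb{Z}^d}$ is sampled from $P$. Given $\omega$, the quenched law $P_\omega$ is the law of the Markov chain $(X_n)_{n\ge0}$ on $\mathbb{Z}^d$ with $P_\omega(X_0=\mathbf{0})=1$ and $P_\omega(X_{n+1}=x+y\mid X_n=x)=\omega(x,y)$ for $y\in\mathcal{E}_d$, with expectation $E_\omega$. The annealed law is $\mathbb{P}(\cdot)=\int P_\omega(\cdot)\,P(d\omega)$. Uniformly elliptic: there is $\varepsilon>0$ with $P(\omega(\mathbf{0},x)\ge\varepsilon\ \forall x\in\mathcal{E}_d)=1$. I.i.d.: $\{\omega(x,\cdot)\}_{x\in\mathbb{Z}^d}$ are i.i.d. under $P$. Nestling: let $d(\omega)=E_\omega X_1$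 be the drift at the origin, and let $\mathcal{K}$ be the closure of the convex hull of the support under $P$ of $d(\omega)$. $P$ is nestling if $\mathbf{0}\in\mathcal{K}$ and non-nestling if $\mathbf{0}\notin\mathcal{K}$. Known facts defining the objects: (Varadhan) if $P$ is uniformly elliptic and i.i.d., then $X_n/n$ satisfies under $\mathbb{P}$ a large deviation principle (with speed $n$) with a convex good rate function $H:\mathbb{R}^d\to[0,\infty]$, called the annealed rate function; i.e. for every Borel $\Gamma\subset\mathbb{R}^d$, $$-\inf_{v\in\Gamma^\circ}H(v)\le\liminf_{n\to\infty}\tfrac1n\log\mathbb{P}(X_n/n\in\Gamma)\le\limsup_{n\to\infty}\tfrac1n\log\mathbb{P}(X_n/n\in\Gamma)\le-\inf_{v\in\overline\Gamma}H(v).$$ If moreover $P$ is non-nestling, there is a deterministic $\mathrm{v}_P\in\mathbb{R}^d\setminus\{\mathbf{0}\}$ (the limiting velocity) with $X_n/n\to\mathrm{v}_P$, $\mathbb{P}$-a.s. *)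

theory Defs
  imports "HOL-Probability.Probability"
begin

section \<open>Environments\<close>

definition real_vec :: "int ^ 'd \<Rightarrow> real ^ 'd" where
  "real_vec x = (\<chi> i. real_of_int (x $ i))"

definition unit_steps :: "(int ^ 'd::finite) set" where
  "unit_steps = {x. norm (real_vec x) = 1}"

text \<open>A point of the space below is a probability measure on \<open>unit_steps\<close>, so the transition
  probability written \<open>\<omega>(x, y)\<close> in the literature is \<open>measure (\<omega> x) {y}\<close>.\<close>

definition site_space :: "(int ^ 'd::finite) measure measure" where
  "site_space = prob_algebra (count_space unit_steps)"

type_synonym 'd env = "int ^ 'd \<Rightarrow> (int ^ 'd) measure"

definition env_space :: "'d::finite env measure" where
  "env_space = PiM UNIV (\<lambda>_. site_space)"

section \<open>Quenched and annealed laws\<close>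

type_synonym 'd path = "nat \<Rightarrow> int ^ 'd"

definition path_space :: "'d::finite path measure" where
  "path_space = PiM UNIV (\<lambda>_. count_space UNIV)"

definition next_law :: "'d::finite env \<Rightarrow> nat \<Rightarrow> 'd path \<Rightarrow> (int ^ 'd) measure" where
  "next_law \<omega> n X =
     (case n of 0 \<Rightarrow> return (count_space UNIV) 0
      | Suc m \<Rightarrow> distr (\<omega> (X m)) (count_space UNIV) (\<lambda>y. X m + y))"

text \<open>The law of the chain is the Ionescu-Tulcea extension of the kernels \<open>next_law \<omega>\<close>; lemma
  \<open>quenched_law_cylinder\<close> below says that this is the Markov chain with start \<open>0\<close> and transition
  probabilities \<open>\<omega>\<close>.\<close>

definition quenched_law :: "'d::finite env \<Rightarrow> 'd path measure" where
  "quenched_law \<omega> =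
     projective_family.lim UNIV
       (Ionescu_Tulcea.CI (next_law \<omega>) (\<lambda>_. count_space UNIV)) (\<lambda>_. count_space UNIV)"

definition annealed_law :: "'d::finite env measure \<Rightarrow> 'd path measure" where
  "annealed_law P = P \<bind> quenched_law"

section \<open>Assumptions on the law of the environment\<close>

definition uniformly_elliptic :: "'d::finite env measure \<Rightarrow> bool" where
  "uniformly_elliptic P \<longleftrightarrow>
     (\<exists>\<epsilon>>0. AE \<omega> in P. \<forall>x\<in>unit_steps. \<epsilon> \<le> measure (\<omega> 0) {x})"

definition iid_env :: "'d::finite env measure \<Rightarrow> bool" where
  "iid_env P \<longleftrightarrow>
     prob_space.indep_vars P (\<lambda>_. site_space) (\<lambda>x \<omega>. \<omega> x) UNIV \<and>
     (\<forall>x. distr P site_space (\<lambda>\<omega>. \<omega> x) = distr P site_space (\<lambda>\<omega>. \<omega> 0))"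

definition drift :: "'d::finite env \<Rightarrow> real ^ 'd" where
  "drift \<omega> = (\<integral>X. real_vec (X 1) \<partial>quenched_law \<omega>)"

definition measure_support :: "'a::topological_space measure \<Rightarrow> 'a set" where
  "measure_support \<mu> = {x. \<forall>U. open U \<longrightarrow> x \<in> U \<longrightarrow> emeasure \<mu> U > 0}"

definition drift_hull :: "'d::finite env measure \<Rightarrow> (real ^ 'd) set" where
  "drift_hull P = closure (convex hull (measure_support (distr P borel drift)))"

definition non_nestling :: "'d::finite env measure \<Rightarrow> bool" where
  "non_nestling P \<longleftrightarrow> 0 \<notin> drift_hull P"

section \<open>Rate function and velocity\<close>

text \<open>Needed because \<open>ln 0 = 0\<close> on the reals.\<close>

definition ereal_ln :: "real \<Rightarrow> ereal" where
  "ereal_ln p = (if p \<le> 0 then -\<infinity> else ereal (ln p))"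

definition large_deviation_principle ::
    "(nat \<Rightarrow> 'a::topological_space measure) \<Rightarrow> ('a \<Rightarrow> ereal) \<Rightarrow> bool" where
  "large_deviation_principle \<mu> H \<longleftrightarrow>
     (\<forall>\<Gamma>\<in>sets borel.
        - (INF v\<in>interior \<Gamma>. H v) \<le> liminf (\<lambda>n. ereal (1 / real n) * ereal_ln (measure (\<mu> n) \<Gamma>)) \<and>
        limsup (\<lambda>n. ereal (1 / real n) * ereal_ln (measure (\<mu> n) \<Gamma>)) \<le> - (INF v\<in>closure \<Gamma>. H v))"

definition good_rate_function :: "('a::topological_space \<Rightarrow> ereal) \<Rightarrow> bool" where
  "good_rate_function H \<longleftrightarrow> (\<forall>v. 0 \<le> H v) \<and> (\<forall>c::real. compact {v. H v \<le> ereal c})"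

definition convex_ereal :: "('a::real_vector \<Rightarrow> ereal) \<Rightarrow> bool" where
  "convex_ereal H \<longleftrightarrow>
     (\<forall>x y. \<forall>t\<in>{0..1}. H ((1 - t) *\<^sub>R x + t *\<^sub>R y) \<le> ereal (1 - t) * H x + ereal t * H y)"

definition annealed_rate_function :: "'d::finite env measure \<Rightarrow> (real ^ 'd \<Rightarrow> ereal) \<Rightarrow> bool" where
  "annealed_rate_function P H \<longleftrightarrow>
     good_rate_function H \<and> convex_ereal H \<and>
     large_deviation_principle
       (\<lambda>n. distr (annealed_law P) borel (\<lambda>X. (1 / real n) *\<^sub>R real_vec (X n))) H"

definition limiting_velocity :: "'d::finite env measure \<Rightarrow> real ^ 'd \<Rightarrow> bool" where
  "limiting_velocity P v \<longleftrightarrow>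
     v \<noteq> 0 \<and>
     (AE X in annealed_law P. (\<lambda>n. (1 / real n) *\<^sub>R real_vec (X n)) \<longlonglongrightarrow> v)"

section \<open>Analyticity and strict convexity\<close>

text \<open>The indices \<open>\<alpha>\<close> are multi-indices; an unconditionally convergent series of reals is the same
  as an absolutely convergent one.\<close>

definition real_analytic_on :: "(real ^ 'd::finite) set \<Rightarrow> (real ^ 'd \<Rightarrow> real) \<Rightarrow> bool" where
  "real_analytic_on S f \<longleftrightarrow>
     (\<forall>x\<in>S. \<exists>r>0. \<exists>c :: ('d \<Rightarrow> nat) \<Rightarrow> real. \<forall>y\<in>ball x r.
        ((\<lambda>\<alpha>. c \<alpha> * (\<Prod>i\<in>UNIV. (y $ i - x $ i) ^ \<alpha> i)) has_sum f y) UNIV)"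

definition strictly_convex_on :: "'a::real_vector set \<Rightarrow> ('a \<Rightarrow> real) \<Rightarrow> bool" where
  "strictly_convex_on S f \<longleftrightarrow>
     convex S \<and>
     (\<forall>x\<in>S. \<forall>y\<in>S. \<forall>t. x \<noteq> y \<longrightarrow> 0 < t \<longrightarrow> t < 1 \<longrightarrow>
        f ((1 - t) *\<^sub>R x + t *\<^sub>R y) < (1 - t) * f x + t * f y)"

section \<open>The chain is well defined\<close>

lemma sets_env_site:
  assumes "\<omega> \<in> space env_space"
  shows "sets (\<omega> x) = Pow unit_steps" "space (\<omega> x) = unit_steps" "prob_space (\<omega> x)"
proof -
  have "\<omega> x \<in> space site_space"
    using assms by (auto simp: env_space_def space_PiM)
  then show "sets (\<omega> x) = Pow unit_steps" "prob_space (\<omega> x)"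
    by (auto simp: site_space_def space_prob_algebra)
  then show "space (\<omega> x) = unit_steps"
    by (metis sets_count_space sets_eq_imp_space_eq space_count_space)
qed

lemma prob_space_next_law:
  assumes "\<omega> \<in> space env_space"
  shows "prob_space (next_law \<omega> n X)"
  using sets_env_site[OF assms]
  by (auto simp: next_law_def measurable_def prob_space_return
        intro!: prob_space.prob_space_distr split: nat.split)

lemma emeasure_next_law:
  assumes "\<omega> \<in> space env_space"
  shows "emeasure (next_law \<omega> 0 X) {x} = (if x = 0 then 1 else 0)"
    and "emeasure (next_law \<omega> (Suc m) X) {x} = emeasure (\<omega> (X m)) {x - X m}"
proof -
  show "emeasure (next_law \<omega> 0 X) {x} = (if x = 0 then 1 else 0)"
    by (auto simp: next_law_def)
  have *: "(\<lambda>y. X m + y) -` {x} \<inter> unit_steps = {x - X m} \<inter> unit_steps"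
    by (auto simp: algebra_simps)
  have "emeasure (\<omega> (X m)) ({x - X m} \<inter> unit_steps) = emeasure (\<omega> (X m)) {x - X m}"
    using sets_env_site(1)[OF assms]
    by (cases "x - X m \<in> unit_steps") (auto simp: emeasure_notin_sets)
  then show "emeasure (next_law \<omega> (Suc m) X) {x} = emeasure (\<omega> (X m)) {x - X m}"
    unfolding next_law_def nat.case using sets_env_site[OF assms]
    by (subst emeasure_distr) (auto simp: measurable_def *)
qed

lemma Ionescu_Tulcea_next_law:
  assumes "\<omega> \<in> space env_space"
  shows "Ionescu_Tulcea (next_law \<omega>) (\<lambda>_. count_space UNIV)"
proof (rule Ionescu_Tulcea.intro)
  show "prob_space (next_law \<omega> i X)" for i X
    by (rule prob_space_next_law[OF assms])
  show "next_law \<omega> i \<in> PiM {0..<i} (\<lambda>_. count_space UNIV) \<rightarrow>\<^sub>M subprob_algebra (count_space UNIV)" for i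
  proof (cases i)
    case 0
    then have "next_law \<omega> i = (\<lambda>_. return (count_space UNIV) 0)"
      by (auto simp: next_law_def)
    then show ?thesis
      by (auto intro!: measurable_const
            simp: space_subprob_algebra prob_space_return prob_space_imp_subprob_space)
  next
    case (Suc m)
    have "(\<lambda>z. distr (\<omega> z) (count_space UNIV) (\<lambda>y. z + y))
        \<in> count_space UNIV \<rightarrow>\<^sub>M subprob_algebra (count_space UNIV)"
      using sets_env_site[OF assms]
      by (auto simp: space_subprob_algebra measurable_def
            intro!: prob_space_imp_subprob_space prob_space.prob_space_distr)
    moreover have "(\<lambda>X. X m) \<in> PiM {0..<i} (\<lambda>_. count_space UNIV) \<rightarrow>\<^sub>M count_space UNIV"
      using Suc by (intro measurable_component_singleton) auto
    ultimately have "(\<lambda>X. distr (\<omega> (X m)) (count_space UNIV) (\<lambda>y. X m + y))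
        \<in> PiM {0..<i} (\<lambda>_. count_space UNIV) \<rightarrow>\<^sub>M subprob_algebra (count_space UNIV)"
      by (rule measurable_compose[rotated])
    then show ?thesis unfolding Suc next_law_def[abs_def] by simp
  qed
qed

lemma quenched_law_prob:
  assumes "\<omega> \<in> space env_space"
  shows "prob_space (quenched_law \<omega>)" "sets (quenched_law \<omega>) = sets path_space"
proof -
  interpret IT: Ionescu_Tulcea "next_law \<omega>" "\<lambda>_. count_space UNIV"
    by (rule Ionescu_Tulcea_next_law[OF assms])
  show "sets (quenched_law \<omega>) = sets path_space"
    by (simp add: quenched_law_def path_space_def IT.PF.sets_lim)
  have "emeasure (quenched_law \<omega>) (IT.PF.emb UNIV {} {\<lambda>_. undefined}) =
      emeasure (IT.CI {}) {\<lambda>_. undefined}"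
    unfolding quenched_law_def by (rule IT.lim) (simp_all add: sets_PiM_empty)
  also have "\<dots> = emeasure (IT.CI {}) (space (IT.CI {}))"
    by (simp add: IT.PF.space_P space_PiM_empty)
  also have "\<dots> = 1"
    by (rule prob_space.emeasure_space_1) (rule IT.PF.prob_space_P, simp_all)
  also have "IT.PF.emb UNIV {} {\<lambda>_. undefined} = space (quenched_law \<omega>)"
    by (auto simp: prod_emb_def space_PiM quenched_law_def)
  finally show "prob_space (quenched_law \<omega>)"
    by (rule prob_spaceI)
qed

theorem quenched_law_cylinder:
  fixes x :: "'d::finite path"
  assumes "\<omega> \<in> space env_space"
  shows "emeasure (quenched_law \<omega>) {X. \<forall>i\<le>n. X i = x i} =
    (if x 0 = 0 then \<Prod>i<n. emeasure (\<omega> (x i)) {x (Suc i) - x i} else 0)"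
proof -
  let ?M = "\<lambda>_::nat. count_space (UNIV :: (int ^ 'd) set)"
  interpret IT: Ionescu_Tulcea "next_law \<omega>" ?M
    by (rule Ionescu_Tulcea_next_law[OF assms])
  let ?A = "\<lambda>n. {restrict x {0..<n}}"
  have A: "?A n \<in> sets (PiM {0..<n} ?M)" for n
  proof -
    have "?A n = (\<Pi>\<^sub>E i\<in>{0..<n}. {x i})"
      by (auto simp: PiE_iff extensional_def fun_eq_iff)
    then show ?thesis by (simp add: sets_PiM_I_finite)
  qed
  have C_Suc: "emeasure (IT.C 0 (Suc n) (\<lambda>_. undefined)) (?A (Suc n)) =
      emeasure (IT.C 0 n (\<lambda>_. undefined)) (?A n) * emeasure (next_law \<omega> n x) {x n}" for n
  proof -
    have eP: "emeasure (IT.eP n X) (?A (Suc n)) =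
        emeasure (next_law \<omega> n x) {x n} * indicator (?A n) X"
      if "X \<in> space (PiM {0..<n} ?M)" for X
    proof -
      have ext: "X \<in> extensional {0..<n}" using that by (auto simp: space_PiM PiE_def)
      have "emeasure (IT.eP n X) (?A (Suc n)) =
          emeasure (next_law \<omega> n X) ((\<lambda>z. X(n := z)) -` ?A (Suc n) \<inter> space (?M n))"
        by (rule IT.emeasure_eP[OF that A])
      also have "(\<lambda>z. X(n := z)) -` ?A (Suc n) \<inter> space (?M n) =
          (if X = restrict x {0..<n} then {x n} else {})"
      proof -
        have "X(n := z) = restrict x {0..<Suc n} \<longleftrightarrow> X = restrict x {0..<n} \<and> z = x n" for z
        proof
          assume eq: "X(n := z) = restrict x {0..<Suc n}"
          have "X i = restrict x {0..<n} i" for i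
            using fun_cong[OF eq, of i] ext by (cases "i < n"; cases "i = n") (auto simp: extensional_def)
          then show "X = restrict x {0..<n} \<and> z = x n"
            using fun_cong[OF eq, of n] by auto
        qed (auto simp: fun_eq_iff)
        then show ?thesis by auto
      qed
      also have "emeasure (next_law \<omega> n X) (if X = restrict x {0..<n} then {x n} else {}) =
          emeasure (next_law \<omega> n x) {x n} * indicator (?A n) X"
      proof (cases "X = restrict x {0..<n}")
        case True
        then have "next_law \<omega> n X = next_law \<omega> n x"
          by (auto simp: next_law_def split: nat.split)
        then show ?thesis using True by simp
      qed auto
      finally show ?thesis .
    qed
    have und: "(\<lambda>_. undefined) \<in> space (PiM {0..<0} ?M)" by (simp add: space_PiM)
    have "emeasure (IT.C 0 (Suc n) (\<lambda>_. undefined)) (?A (Suc n)) =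
        (\<integral>\<^sup>+X. emeasure (IT.eP n X) (?A (Suc n)) \<partial>IT.C 0 n (\<lambda>_. undefined))"
      using A[of "Suc n"] IT.space_C[OF und, of n]
      by (auto intro!: emeasure_bind[where N="PiM {0..<Suc n} ?M"]
            simp: space_PiM PiE_eq_empty_iff IT.sets_C[OF und] cong: measurable_cong_sets)
    also have "\<dots> = (\<integral>\<^sup>+X. emeasure (next_law \<omega> n x) {x n} * indicator (?A n) X \<partial>IT.C 0 n (\<lambda>_. undefined))"
      by (intro nn_integral_cong eP) (use IT.space_C[OF und, of n] in simp)
    also have "\<dots> = emeasure (next_law \<omega> n x) {x n} * emeasure (IT.C 0 n (\<lambda>_. undefined)) (?A n)"
      using A[of n] by (intro nn_integral_cmult_indicator) (simp add: IT.sets_C[OF und])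
    finally show ?thesis by (simp add: mult.commute)
  qed
  have C: "emeasure (IT.C 0 (Suc n) (\<lambda>_. undefined)) (?A (Suc n)) =
      (if x 0 = 0 then \<Prod>i<n. emeasure (\<omega> (x i)) {x (Suc i) - x i} else 0)" for n
  proof (induction n)
    case 0
    have "emeasure (IT.C 0 0 (\<lambda>_. undefined)) (?A 0) = 1"
      using A[of 0] by (simp add: restrict_def)
    then show ?case
      unfolding C_Suc[of 0] emeasure_next_law(1)[OF assms] by simp
  next
    case (Suc n)
    show ?case
      unfolding C_Suc[of "Suc n"] Suc.IH emeasure_next_law(2)[OF assms] by simp
  qed
  have "{X. \<forall>i\<le>n. X i = x i} = IT.PF.emb UNIV {0..<Suc n} (?A (Suc n))"
  proof -
    have "restrict X {0..<Suc n} = restrict x {0..<Suc n} \<longleftrightarrow> (\<forall>i\<le>n. X i = x i)" for X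
      by (auto simp: fun_eq_iff restrict_def less_Suc_eq_le)
    then show ?thesis by (auto simp: prod_emb_def space_PiM)
  qed
  then have "emeasure (quenched_law \<omega>) {X. \<forall>i\<le>n. X i = x i} = emeasure (IT.CI {0..<Suc n}) (?A (Suc n))"
    unfolding quenched_law_def by (simp add: IT.lim A)
  also have "\<dots> = emeasure (IT.C 0 (Suc n) (\<lambda>_. undefined)) (IT.PF.emb {0..<Suc n} {0..<Suc n} (?A (Suc n)))"
    by (rule IT.emeasure_CI[OF order_refl A])
  also have "IT.PF.emb {0..<Suc n} {0..<Suc n} (?A (Suc n)) = ?A (Suc n)"
    using sets.sets_into_space[OF A[of "Suc n"]] by (intro prod_emb_id) (auto simp: space_PiM)
  finally show ?thesis using C by simp
qed

theorem measurable_quenched_law: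
  "quenched_law \<in> env_space \<rightarrow>\<^sub>M prob_algebra (path_space :: 'd::finite path measure)"
proof -
  let ?cyl = "\<lambda>(n::nat) (x::'d path). {X. \<forall>i\<le>n. X i = x i}"
  let ?G = "insert {} {?cyl n x | n x. True}"
  have sp: "space path_space = (UNIV :: 'd path set)"
    by (auto simp: path_space_def space_PiM)
  have cyl: "?cyl n x \<in> sets path_space" for n x
  proof -
    have "?cyl n x = (\<Pi>\<^sub>E i\<in>UNIV. if i \<le> n then {x i} else UNIV)"
      by (auto simp: PiE_def Pi_def split: if_splits)
    also have "\<dots> = prod_emb UNIV (\<lambda>_. count_space UNIV) {..n} (\<Pi>\<^sub>E i\<in>{..n}. {x i})"
      by (subst prod_emb_PiE) (auto simp: PiE_def Pi_def split: if_splits)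
    also have "\<dots> \<in> sets path_space"
      unfolding path_space_def by (rule sets_PiM_I) auto
    finally show ?thesis .
  qed
  have Int: "Int_stable ?G"
  proof (rule Int_stableI)
    fix a b assume ab: "a \<in> ?G" "b \<in> ?G"
    have *: "?cyl n x \<inter> ?cyl m y \<in> ?G" for n x m y
    proof (cases "\<forall>i\<le>min n m. x i = y i")
      case False
      then obtain i where "i \<le> n" "i \<le> m" "x i \<noteq> y i" by auto
      then have "?cyl n x \<inter> ?cyl m y = {}" by auto
      then show ?thesis by (simp only: insertI1)
    next
      case True
      have eq: "x i = y i" if "i \<le> n" "i \<le> m" for i
        using True that by simp
      have "?cyl n x \<inter> ?cyl m y = (if n \<le> m then ?cyl m y else ?cyl n x)"
      proof (cases "n \<le> m")
        case True
        then have "?cyl m y \<subseteq> ?cyl n x"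
          using eq by (intro Collect_mono) (metis order_trans)
        then show ?thesis using True by auto
      next
        case False
        then have "?cyl n x \<subseteq> ?cyl m y"
          using eq by (intro Collect_mono) (metis order_trans nat_le_linear)
        then show ?thesis using False by auto
      qed
      moreover have "(if n \<le> m then ?cyl m y else ?cyl n x) \<in> ?G" by auto
      ultimately show ?thesis by (simp only:)
    qed
    show "a \<inter> b \<in> ?G"
    proof (cases "a = {} \<or> b = {}")
      case True
      then have "a \<inter> b = {}" by blast
      then show ?thesis by (simp only: insertI1)
    next
      case False
      then obtain n x m y where "a = ?cyl n x" "b = ?cyl m y"
        using ab unfolding insert_iff mem_Collect_eq by blast
      then show ?thesis using *[of n x m y] by (simp only:)
    qed
  qed
  have gen: "sets path_space = sigma_sets UNIV ?G"
  proof
    show "sigma_sets UNIV ?G \<subseteq> sets path_space"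
    proof -
      have "?G \<subseteq> sets path_space" using cyl by auto
      then show ?thesis using sets.sigma_sets_subset[of ?G path_space] unfolding sp by blast
    qed
    have sa: "sigma_algebra UNIV (sigma_sets UNIV ?G)"
      by (rule sigma_algebra_sigma_sets) auto
    have comp: "{X::'d path. X i \<in> A} \<in> sigma_sets UNIV ?G" for i A
    proof -
      let ?L = "{xs :: (int ^ 'd) list. length xs = Suc i \<and> xs ! i \<in> A}"
      have "{X. X i \<in> A} = (\<Union>xs\<in>?L. ?cyl i ((!) xs))"
      proof (intro equalityI subsetI)
        fix X :: "'d path" assume "X \<in> {X. X i \<in> A}"
        then have "map X [0..<Suc i] \<in> ?L" "X \<in> ?cyl i ((!) (map X [0..<Suc i]))"
          by (auto simp del: upt_Suc simp: less_Suc_eq_le)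
        then show "X \<in> (\<Union>xs\<in>?L. ?cyl i ((!) xs))" by blast
      qed auto
      also have "\<dots> \<in> sigma_sets UNIV ?G"
        by (intro sigma_algebra.countable_UN'[OF sa]) (auto intro!: sigma_sets.Basic)
      finally show ?thesis .
    qed
    show "sets path_space \<subseteq> sigma_sets UNIV ?G"
      unfolding path_space_def sets_PiM_single
      by (rule sigma_algebra.sigma_sets_subset) (use comp sa in \<open>auto simp: PiE_def Pi_def\<close>)
  qed
  show ?thesis
  proof (rule measurable_prob_algebra_generated[OF gen Int])
    fix \<omega> :: "'d env" assume \<omega>: "\<omega> \<in> space env_space"
    show "prob_space (quenched_law \<omega>)" "sets (quenched_law \<omega>) = sets path_space"
      using quenched_law_prob[OF \<omega>] .
  next
    fix A :: "'d path set" assume A: "A \<in> ?G"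
    have *: "(\<lambda>\<omega>. emeasure (quenched_law \<omega>) (?cyl n x)) \<in> borel_measurable env_space" for n x
    proof -
      have site: "(\<lambda>\<omega>. emeasure (\<omega> z) {y}) \<in> borel_measurable env_space" for z y :: "int ^ 'd"
      proof (cases "y \<in> unit_steps")
        case True
        have "(\<lambda>\<omega>. \<omega> z) \<in> env_space \<rightarrow>\<^sub>M subprob_algebra (count_space unit_steps)"
          unfolding env_space_def site_space_def
          by (rule measurable_compose[OF measurable_component_singleton measurable_prob_algebraD])
            (auto simp: measurable_ident)
        then show ?thesis
          by (rule measurable_compose) (use True in \<open>auto intro!: measurable_emeasure_subprob_algebra\<close>)
      next
        case False
        then have "emeasure (\<omega> z) {y} = 0" if "\<omega> \<in> space env_space" for \<omega>
          using sets_env_site(1)[OF that] by (auto intro!: emeasure_notin_sets)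
        then show ?thesis by (subst measurable_cong[where g="\<lambda>_. 0"]) auto
      qed
      show ?thesis
        by (subst measurable_cong[OF quenched_law_cylinder])
          (cases "x 0 = 0"; auto intro!: borel_measurable_prod_ennreal site)+
    qed
    show "(\<lambda>\<omega>. emeasure (quenched_law \<omega>) A) \<in> borel_measurable env_space"
    proof (cases "A = {}")
      case False
      then obtain n x where "A = ?cyl n x"
        using A unfolding insert_iff mem_Collect_eq by blast
      then show ?thesis using *[of n x] by (simp only:)
    qed simp
  qed simp
qed

lemma measurable_drift: "drift \<in> borel_measurable (env_space :: 'd::finite env measure)"
proof -
  have "(\<lambda>X. real_vec (X 1)) \<in> borel_measurable (path_space :: 'd path measure)"
    unfolding path_space_def by (rule measurable_compose[OF measurable_component_singleton]) auto
  then have "(\<lambda>\<mu>. \<integral>X. real_vec (X 1) \<partial>\<mu>)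
      \<in> borel_measurable (subprob_algebra (path_space :: 'd path measure))"
    by (rule integral_measurable_subprob_algebra)
  then show ?thesis
    unfolding drift_def[abs_def]
    by (rule measurable_compose[OF measurable_prob_algebraD[OF measurable_quenched_law]])
qed

end

theory Submission
  imports Defs "HOL-Complex_Analysis.Cauchy_Integral_Formula"
begin

text \<open>
Because the environment is non-nestling, there is an integer linear function \<open>h\<close> (the height) along
which the walk has, almost surely and at every site, a local drift of at least \<open>1\<close> (lemma
\<open>non_nestling_direction\<close>). A positive time at which the height is a strict record and below which the path never
falls afterwards is a break point. The sites left before a break point and those left after it are
disjoint, so the annealed weight of a path is the product of the weights of the two parts
(\<open>aweight_break\<close>). Cutting a path at its first break point gives exact renewal equations
(\<open>pathsum_renewal\<close>) for the partition functions \<open>Z\<^sub>n(\<beta>) = E exp(\<beta> \<bullet> X\<^sub>n)\<close>; the renewal weights are those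
of the pieces, the paths between two successive break points. A Lyapunov function for an
automaton that tracks the first break point shows that a path without break point has exponentially
small probability, uniformly in the environment (\<open>exponential_tail\<close>). Hence the generating function
\<open>G(\<beta>, \<mu>)\<close> of the pieces, \<open>\<beta>\<close> being dual to the displacement and \<open>\<mu>\<close> to the number of steps, is
analytic near \<open>0\<close>, and \<open>Z\<^sub>n(\<beta>) = exp(-\<mu> n + o(n))\<close> as soon as \<open>G(\<beta>, \<mu>) = 1\<close>. Moreover \<open>G(0, 0) = 1\<close>.

The large deviation principle turns this into statements on the rate function. If \<open>G(\<beta>, \<mu>) = 1\<close>, the
affine function \<open>y \<mapsto> \<beta> \<bullet> y + \<mu>\<close> lies below \<open>H\<close> (\<open>rate_function_above_tangent\<close>) and meets it in some
point \<open>x\<close> (\<open>rate_function_touches_tangent\<close>). Since all these affine functions are minorants of \<open>H\<close>, the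
vector \<open>(x, 1)\<close> is normal to the level set \<open>G = 1\<close> at \<open>(\<beta>, \<mu>)\<close>. So \<open>x\<close> is the quotient of the
\<open>\<beta>\<close>-gradient and the \<open>\<mu>\<close>-derivative of \<open>G\<close>, it is the only point of contact, and
\<open>H x = \<beta> \<bullet> x + \<mu>\<close>. At \<open>(0, 0)\<close> the point of contact is the velocity, because \<open>H\<close> vanishes there.

It remains to solve for \<open>(\<beta>, \<mu>)\<close> in terms of \<open>x\<close>. The map \<open>\<Phi>\<close> that sends \<open>(\<beta>, \<mu>)\<close> to that quotient and to
\<open>G(\<beta>, \<mu>)\<close> extends holomorphically to complex arguments, and its derivative at \<open>0\<close> is injective,
because the pairs (displacement, length) of the pieces span the whole space. The inverse function
theorem gives a local inverse whose derivative is complex linear, that is, a holomorphic one; it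
commutes with complex conjugation and so maps real points to real points. Therefore \<open>H\<close> is, near the
velocity, the restriction of a holomorphic function, and Cauchy's formula on a torus yields its power
series in several variables. Strict convexity follows since every \<open>x\<close> near the velocity is the only
point of contact of its affine minorant.
\<close>

section \<open>Power series of functions that are holomorphic in each variable\<close>

text \<open>The parameter space of the circle, with its uniform law. Integrals over a torus are integrals over a
finite product of copies of it.\<close>

definition unit_interval :: "real measure" where
  "unit_interval = restrict_space lborel {0..1}"

lemma prob_space_unit_interval: "prob_space unit_interval"
  unfolding unit_interval_def
  by (intro prob_spaceI) (simp add: emeasure_restrict_space space_restrict_space)

text \<open>Cauchy's formula on a circle, read as an average over the angle. In this form it can be iterated over
several variables by Fubini's theorem.\<close>

lemma Cauchy_integral_average:
  assumes contf: "continuous_on (cball a r) f" and holf: "f holomorphic_on ball a r"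
    and r: "0 < r" and \<zeta>: "cmod \<zeta> < 1"
  shows "f (a + of_real r * \<zeta>) =
    (\<integral>t. f (a + of_real r * cis (2 * pi * t)) / (1 - \<zeta> * cis (- (2 * pi * t))) \<partial>unit_interval)"
proof -
  let ?w = "a + of_real r * \<zeta>"
  let ?F = "\<lambda>t. f (a + of_real r * cis (2 * pi * t)) / (1 - \<zeta> * cis (- (2 * pi * t)))"
  have "((\<lambda>u. f u / (u - ?w)) has_contour_integral (2 * of_real pi * \<i> * f ?w)) (circlepath a r)"
    using r \<zeta> by (intro Cauchy_integral_circlepath contf holf) (simp add: norm_mult)
  then have "((\<lambda>t. f (circlepath a r t) / (circlepath a r t - ?w) *
      vector_derivative (circlepath a r) (at t within {0..1})) has_integral (2 * of_real pi * \<i> * f ?w)) {0..1}"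
    by (simp add: has_contour_integral_def)
  also have "?this \<longleftrightarrow> ((\<lambda>t. (2 * of_real pi * \<i>) * ?F t) has_integral (2 * of_real pi * \<i> * f ?w)) {0..1}"
  proof (intro has_integral_cong)
    fix t :: real assume t: "t \<in> {0..1}"
    have e: "exp (2 * complex_of_real pi * \<i> * complex_of_real t) = cis (2 * pi * t)"
      by (simp add: cis_conv_exp mult_ac)
    have c: "circlepath a r t = a + of_real r * cis (2 * pi * t)"
      by (simp add: circlepath e)
    have inv: "cis (- (2 * pi * t)) = inverse (cis (2 * pi * t))" by simp
    have "cis (2 * pi * t) \<noteq> \<zeta>" using \<zeta> by (metis less_irrefl norm_cis)
    then show "f (circlepath a r t) / (circlepath a r t - ?w) *
      vector_derivative (circlepath a r) (at t within {0..1}) = (2 * of_real pi * \<i>) * ?F t"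
      unfolding vector_derivative_circlepath01[OF atLeastAtMost_iff[THEN iffD1, OF t, THEN conjunct1] atLeastAtMost_iff[THEN iffD1, OF t, THEN conjunct2]] c e inv
      using r by (simp add: field_simps)
  qed
  finally have "(?F has_integral f ?w) {0..1}"
    by (subst (asm) has_integral_mult_right_iff) (auto)
  have nz: "1 - \<zeta> * cis (- (2 * pi * t)) \<noteq> 0" for t
  proof
    assume "1 - \<zeta> * cis (- (2 * pi * t)) = 0"
    then have "cmod (\<zeta> * cis (- (2 * pi * t))) = 1" by (metis eq_iff_diff_eq_0 norm_one)
    then show False using \<zeta> by (simp add: norm_mult)
  qed
  have "continuous_on {0..1} ?F"
    using nz r
    by (intro continuous_intros continuous_on_compose2[OF contf]) (auto simp: dist_norm norm_mult)
  then have "set_integrable lborel {0..1} ?F"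
    by (rule borel_integrable_atLeastAtMost')
  then have "(LINT t:{0..1}|lborel. ?F t) = integral {0..1} ?F"
    by (rule set_borel_integral_eq_integral)
  also have "\<dots> = f ?w" using \<open>(?F has_integral f ?w) {0..1}\<close> by blast
  finally show ?thesis
    unfolding unit_interval_def by (subst integral_restrict_space) (auto simp: set_lebesgue_integral_def)
qed

lemma compact_polydisc:
  fixes a :: "complex ^ 'n::finite"
  shows "compact {z. \<forall>i. cmod (z $ i - a $ i) \<le> r}" (is "compact ?K")
proof -
  have "closed ?K"
    by (intro closed_Collect_all closed_Collect_le continuous_intros)
  moreover have "bounded ?K"
  proof (rule boundedI)
    fix z assume "z \<in> ?K"
    then have "norm (z - a) \<le> (\<Sum>i\<in>(UNIV::'n set). r)"
      unfolding norm_vec_def by (intro order_trans[OF L2_set_le_sum] sum_mono) auto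
    then show "norm z \<le> norm a + (\<Sum>i\<in>(UNIV::'n set). r)"
      using norm_triangle_sub[of z a] by simp
  qed
  ultimately show ?thesis by (simp add: compact_eq_bounded_closed)
qed

lemma measurable_unit_interval_component:
  assumes "i \<in> S"
  shows "(\<lambda>\<theta>. \<theta> i) \<in> borel_measurable (PiM S (\<lambda>_. unit_interval))"
proof -
  have "(\<lambda>\<theta>. \<theta> i) \<in> PiM S (\<lambda>_. unit_interval) \<rightarrow>\<^sub>M unit_interval"
    using assms by (rule measurable_component_singleton)
  moreover have "(\<lambda>x. x) \<in> borel_measurable unit_interval"
    unfolding unit_interval_def by (intro measurable_restrict_space1) auto
  ultimately show ?thesis by (rule measurable_compose)
qed

lemma measurable_cis: "cis \<in> borel_measurable borel"
  by (intro borel_measurable_continuous_onI continuous_intros)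

lemma measurable_torus_function:
  fixes f :: "complex ^ 'n::finite \<Rightarrow> complex"
  assumes contf: "continuous_on {z. \<forall>i. cmod (z $ i - a $ i) \<le> r} f"
    and r: "0 < r" and z: "\<And>i. cmod (z $ i - a $ i) \<le> r"
  shows "(\<lambda>\<theta>. f (\<chi> i. if i \<in> S then a $ i + of_real r * cis (2 * pi * \<theta> i) else z $ i))
    \<in> borel_measurable (PiM S (\<lambda>_. unit_interval))"
proof -
  let ?K = "{z. \<forall>i. cmod (z $ i - a $ i) \<le> r}"
  let ?w = "\<lambda>\<theta>. (\<chi> i. if i \<in> S then a $ i + of_real r * cis (2 * pi * \<theta> i) else z $ i)"
  have wK: "?w \<theta> \<in> ?K" for \<theta>
    using z r by (auto simp: norm_mult)
  have mw: "(\<lambda>\<theta>. ?w \<theta>) \<in> borel_measurable (PiM S (\<lambda>_. unit_interval))"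
  proof (subst borel_measurable_euclidean_space, intro ballI)
    fix b :: "complex ^ 'n" assume "b \<in> Basis"
    then obtain i u where b: "b = axis i u" by (auto simp: Basis_vec_def)
    show "(\<lambda>\<theta>. ?w \<theta> \<bullet> b) \<in> borel_measurable (PiM S (\<lambda>_. unit_interval))"
      unfolding b inner_axis
      by (cases "i \<in> S") (auto intro!: borel_measurable_inner borel_measurable_add borel_measurable_times
            measurable_compose[OF _ measurable_cis] measurable_unit_interval_component)
  qed
  have "(\<lambda>x. indicator ?K x *\<^sub>R f x) \<in> borel_measurable borel"
    using compact_imp_closed[OF compact_polydisc]
    by (intro borel_measurable_continuous_on_indicator contf) (rule borel_closed)
  from measurable_compose[OF mw this] show ?thesis
    using wK by (simp only: indicator_simps(1) scaleR_one)
qed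

text \<open>Induction on the set \<open>S\<close> of variables that have already been moved to the torus: Fubini's theorem
isolates the integral over one further angle, and the formula in one variable evaluates it.\<close>

lemma torus_Cauchy_integral:
  fixes f :: "complex ^ 'n::finite \<Rightarrow> complex"
  assumes r: "0 < r"
    and contf: "continuous_on {z. \<forall>i. cmod (z $ i - a $ i) \<le> r} f"
    and holf: "\<And>z j. \<forall>i. cmod (z $ i - a $ i) \<le> r \<Longrightarrow>
        (\<lambda>u. f (\<chi> i. if i = j then u else z $ i)) holomorphic_on ball (a $ j) r"
    and z: "\<And>i. cmod (z $ i - a $ i) < r"
  shows "f z = (\<integral>\<theta>. f (\<chi> i. if i \<in> S then a $ i + of_real r * cis (2 * pi * \<theta> i) else z $ i) /
       (\<Prod>i\<in>S. 1 - (z $ i - a $ i) / of_real r * cis (- (2 * pi * \<theta> i))) \<partial>PiM S (\<lambda>_. unit_interval))"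
proof -
  let ?K = "{z. \<forall>i. cmod (z $ i - a $ i) \<le> r}"
  let ?w = "\<lambda>S \<theta>. (\<chi> i. if i \<in> S then a $ i + of_real r * cis (2 * pi * \<theta> i) else z $ i)"
  define \<zeta> where "\<zeta> i = (z $ i - a $ i) / of_real r" for i
  let ?q = "\<lambda>S \<theta>. (\<Prod>i\<in>S. 1 - \<zeta> i * cis (- (2 * pi * \<theta> i)))"
  interpret P: product_prob_space "\<lambda>_::'n. unit_interval" UNIV
    by (simp add: product_prob_space_def product_prob_space_axioms_def product_sigma_finite_def
        prob_space_unit_interval prob_space_imp_sigma_finite)
  have \<zeta>: "cmod (\<zeta> i) < 1" for i
    using z[of i] r by (simp add: norm_divide \<zeta>_def)
  have wK: "?w S \<theta> \<in> ?K" for S \<theta>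
    using z r by (auto simp: norm_mult less_imp_le)
  have K: "compact ?K" by (rule compact_polydisc)
  have "bounded (f ` ?K)" using compact_continuous_image[OF contf K] compact_imp_bounded by blast
  then obtain B where B: "\<And>x. x \<in> ?K \<Longrightarrow> cmod (f x) \<le> B"
    unfolding bounded_iff by blast
  have mq: "(\<lambda>\<theta>. ?q S \<theta>) \<in> borel_measurable (PiM S (\<lambda>_. unit_interval))" for S
    by (intro borel_measurable_prod borel_measurable_diff borel_measurable_times borel_measurable_const
        measurable_compose[OF _ measurable_cis] borel_measurable_uminus
        measurable_unit_interval_component)
  have mf: "(\<lambda>\<theta>. f (?w S \<theta>)) \<in> borel_measurable (PiM S (\<lambda>_. unit_interval))" for S
    using z by (intro measurable_torus_function contf r) (simp add: less_imp_le)
  have q_ge: "(\<Prod>i\<in>S. 1 - cmod (\<zeta> i)) \<le> cmod (?q S \<theta>)" for S \<theta>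
    unfolding prod_norm[symmetric]
  proof (intro prod_mono conjI)
    fix i
    show "0 \<le> 1 - cmod (\<zeta> i)" using \<zeta>[of i] by simp
    have "cmod 1 - cmod (\<zeta> i * cis (- (2 * pi * \<theta> i))) \<le> cmod (1 - \<zeta> i * cis (- (2 * pi * \<theta> i)))"
      by (rule norm_triangle_ineq2)
    then show "1 - cmod (\<zeta> i) \<le> cmod (1 - \<zeta> i * cis (- (2 * pi * \<theta> i)))"
      by (simp add: norm_mult)
  qed
  have q_pos: "0 < (\<Prod>i\<in>S. 1 - cmod (\<zeta> i))" for S
    using \<zeta> by (intro prod_pos) (auto simp: algebra_simps)
  have int: "integrable (PiM S (\<lambda>_. unit_interval)) (\<lambda>\<theta>. f (?w S \<theta>) / ?q S \<theta>)" for S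
  proof -
    interpret S: product_prob_space "\<lambda>_::'n. unit_interval" S
      by (simp add: product_prob_space_def product_prob_space_axioms_def product_sigma_finite_def
        prob_space_unit_interval prob_space_imp_sigma_finite)
    have "finite_measure (PiM S (\<lambda>_. unit_interval))"
      using S.P.finite_measure_axioms by simp 
    then show ?thesis
    proof (rule finite_measure.integrable_const_bound[where B="B / (\<Prod>i\<in>S. 1 - cmod (\<zeta> i))"])
      show "AE \<theta> in PiM S (\<lambda>_. unit_interval). norm (f (?w S \<theta>) / ?q S \<theta>) \<le> B / (\<Prod>i\<in>S. 1 - cmod (\<zeta> i))"
      proof (intro AE_I2)
        fix \<theta>
        show "norm (f (?w S \<theta>) / ?q S \<theta>) \<le> B / (\<Prod>i\<in>S. 1 - cmod (\<zeta> i))"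
          unfolding norm_divide
          using B[OF wK[of S \<theta>]] q_ge[of S \<theta>] q_pos[of S] order_trans[OF norm_ge_zero B[OF wK[of S \<theta>]]]
          by (intro frac_le)
      qed
    qed (intro borel_measurable_divide mf mq)
  qed
  have "finite S" by simp
  then have "f z = (\<integral>\<theta>. f (?w S \<theta>) / ?q S \<theta> \<partial>PiM S (\<lambda>_. unit_interval))"
  proof (induction S)
    case empty
    then show ?case by (simp add: vec_nth_inverse PiM_empty lebesgue_integral_count_space_finite)
  next
    case (insert j S)
    have "(\<integral>\<theta>. f (?w (insert j S) \<theta>) / ?q (insert j S) \<theta> \<partial>PiM (insert j S) (\<lambda>_. unit_interval)) =
      (\<integral>x. (\<integral>y. f (?w (insert j S) (x(j := y))) / ?q (insert j S) (x(j := y)) \<partial>unit_interval) \<partial>PiM S (\<lambda>_. unit_interval))"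
      by (rule P.product_integral_insert[OF insert.hyps int])
    also have "\<dots> = (\<integral>x. f (?w S x) / ?q S x \<partial>PiM S (\<lambda>_. unit_interval))"
    proof (intro Bochner_Integration.integral_cong refl)
      fix x
      let ?g = "\<lambda>u. f (\<chi> i. if i = j then u else ?w S x $ i)"
      have c: "continuous_on (cball (a $ j) r) ?g"
      proof (rule continuous_on_compose2[OF contf])
        show "continuous_on (cball (a $ j) r) (\<lambda>u. \<chi> i. if i = j then u else ?w S x $ i)"
        proof (rule continuous_on_vec_lambda)
          fix i show "continuous_on (cball (a $ j) r) (\<lambda>u. if i = j then u else ?w S x $ i)"
            by (cases "i = j") (auto intro: continuous_on_id)
        qed
      qed (use wK[of S x] in \<open>auto simp: dist_norm norm_minus_commute\<close>)
      have h: "?g holomorphic_on ball (a $ j) r" using wK[of S x] by (intro holf) simp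
      have "f (?w (insert j S) (x(j := y))) / ?q (insert j S) (x(j := y)) =
         (?g (a $ j + of_real r * cis (2 * pi * y)) / (1 - \<zeta> j * cis (- (2 * pi * y)))) / ?q S x" for y
      proof -
        have "?w (insert j S) (x(j := y)) = (\<chi> i. if i = j then a $ j + of_real r * cis (2 * pi * y) else ?w S x $ i)"
          using insert.hyps(2) by (auto simp: vec_eq_iff)
        moreover have "?q (insert j S) (x(j := y)) = (1 - \<zeta> j * cis (- (2 * pi * y))) * ?q S x"
        proof -
          have "?q S (x(j:=y)) = ?q S x" using insert.hyps(2) by (intro prod.cong) auto
          then show ?thesis using insert.hyps by simp
        qed
        ultimately show ?thesis by simp
      qed
      then have "(\<integral>y. f (?w (insert j S) (x(j := y))) / ?q (insert j S) (x(j := y)) \<partial>unit_interval) =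
        (\<integral>y. (?g (a $ j + of_real r * cis (2 * pi * y)) / (1 - \<zeta> j * cis (- (2 * pi * y)))) / ?q S x \<partial>unit_interval)"
        by simp
      also have "\<dots> = ?g (a $ j + of_real r * \<zeta> j) / ?q S x"
        unfolding Cauchy_integral_average[OF c h r \<zeta>] by (rule integral_divide_zero)
      also have "a $ j + of_real r * \<zeta> j = z $ j" using r by (simp add: \<zeta>_def)
      also have "(\<chi> i. if i = j then z $ j else ?w S x $ i) = ?w S x"
        using insert.hyps(2) by (auto simp: vec_eq_iff)
      finally show "(\<integral>y. f (?w (insert j S) (x(j := y))) / ?q (insert j S) (x(j := y)) \<partial>unit_interval) = f (?w S x) / ?q S x" .
    qed
    also have "\<dots> = f z" using insert.IH by (rule sym)
    finally show ?case by (rule sym)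
  qed
  then show ?thesis unfolding \<zeta>_def .
qed

lemma geometric_has_sum_multiindex:
  fixes u :: "'n::finite \<Rightarrow> 'c :: {banach, real_normed_field}"
  assumes u: "\<And>i. norm (u i) < 1"
  shows "((\<lambda>\<alpha>. \<Prod>i\<in>UNIV. u i ^ \<alpha> i) has_sum (\<Prod>i\<in>UNIV. 1 / (1 - u i))) (UNIV :: ('n \<Rightarrow> nat) set)"
    and "(\<lambda>\<alpha>. \<Prod>i\<in>UNIV. u i ^ \<alpha> i) abs_summable_on (UNIV :: ('n \<Rightarrow> nat) set)"
proof -
  have abs1: "(\<lambda>k. u i ^ k) abs_summable_on UNIV" for i
  proof -
    have "summable (\<lambda>k. norm (norm (u i ^ k)))" using u[of i] by (simp add: norm_power summable_geometric)
    then show ?thesis by (rule norm_summable_imp_summable_on)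
  qed
  have inf1: "infsum (\<lambda>k. u i ^ k) UNIV = 1 / (1 - u i)" for i
  proof (rule infsumI, rule norm_summable_imp_has_sum)
    show "summable (\<lambda>k. norm (u i ^ k))" using u[of i] by (simp add: norm_power summable_geometric)
    show "(\<lambda>k. u i ^ k) sums (1 / (1 - u i))" using u[of i] by (rule geometric_sums)
  qed
  show abs: "(\<lambda>\<alpha>. \<Prod>i\<in>UNIV. u i ^ \<alpha> i) abs_summable_on (UNIV :: ('n \<Rightarrow> nat) set)"
  proof (rule nonneg_bounded_partial_sums_imp_summable_on[where C="\<Prod>i\<in>UNIV. 1 / (1 - norm (u i))"])
    show "\<forall>\<^sub>F F in finite_subsets_at_top UNIV. (\<Sum>\<alpha>\<in>F. norm (\<Prod>i\<in>UNIV. u i ^ \<alpha> i)) \<le> (\<Prod>i\<in>UNIV. 1 / (1 - norm (u i)))"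
    proof (rule eventually_finite_subsets_at_top_weakI)
      fix F :: "('n \<Rightarrow> nat) set" assume F: "finite F"
      define N where "N = Max (insert 0 (\<Union>\<alpha>\<in>F. range \<alpha>))"
      have N: "\<alpha> i \<le> N" if "\<alpha> \<in> F" for \<alpha> i
        unfolding N_def using F that by (intro Max_ge) auto
      have "(\<Sum>\<alpha>\<in>F. norm (\<Prod>i\<in>UNIV. u i ^ \<alpha> i)) \<le> (\<Sum>\<alpha>\<in>PiE UNIV (\<lambda>_. {..N}). norm (\<Prod>i\<in>UNIV. u i ^ \<alpha> i))"
        using N by (intro sum_mono2 finite_PiE) auto
      also have "\<dots> = (\<Sum>\<alpha>\<in>PiE UNIV (\<lambda>_. {..N}). \<Prod>i\<in>UNIV. norm (u i) ^ \<alpha> i)"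
        by (simp add: prod_norm[symmetric] norm_power)
      also have "\<dots> = (\<Prod>i\<in>UNIV. \<Sum>k\<in>{..N}. norm (u i) ^ k)"
        by (rule prod_sum_PiE[symmetric]) auto
      also have "\<dots> \<le> (\<Prod>i\<in>UNIV. 1 / (1 - norm (u i)))"
      proof (intro prod_mono conjI sum_nonneg zero_le_power norm_ge_zero)
        fix i
        have "(\<Sum>k\<in>{..N}. norm (u i) ^ k) \<le> suminf (\<lambda>k. norm (u i) ^ k)"
          using u[of i] by (intro sum_le_suminf summable_geometric) auto
        then show "(\<Sum>k\<in>{..N}. norm (u i) ^ k) \<le> 1 / (1 - norm (u i))"
          using u[of i] by (simp add: suminf_geometric)
      qed
      finally show "(\<Sum>\<alpha>\<in>F. norm (\<Prod>i\<in>UNIV. u i ^ \<alpha> i)) \<le> (\<Prod>i\<in>UNIV. 1 / (1 - norm (u i)))" .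
    qed
  qed auto
  have "infsum (\<lambda>\<alpha>. \<Prod>i\<in>UNIV. u i ^ \<alpha> i) (PiE (UNIV::'n set) (\<lambda>_. UNIV)) = (\<Prod>i\<in>UNIV. infsum (\<lambda>k. u i ^ k) UNIV)"
    by (rule infsum_prod_PiE_abs) (use abs1 in auto)
  then have "infsum (\<lambda>\<alpha>. \<Prod>i\<in>UNIV. u i ^ \<alpha> i) (UNIV :: ('n \<Rightarrow> nat) set) = (\<Prod>i\<in>UNIV. 1 / (1 - u i))"
    by (simp add: inf1 PiE_UNIV_domain)
  then show "((\<lambda>\<alpha>. \<Prod>i\<in>UNIV. u i ^ \<alpha> i) has_sum (\<Prod>i\<in>UNIV. 1 / (1 - u i))) (UNIV :: ('n \<Rightarrow> nat) set)"
    using abs abs_summable_summable has_sum_infsum by metis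
qed

text \<open>The remainder is the sum over the multi-indices outside \<open>F\<close>, so it is bounded termwise. The bound depends
only on the absolute values of the \<open>u i\<close>; on the torus it is therefore uniform in the angles.\<close>

lemma geometric_multiindex_remainder:
  fixes u :: "'n::finite \<Rightarrow> complex"
  assumes u: "\<And>i. cmod (u i) < 1" and F: "finite F"
  shows "cmod ((\<Prod>i\<in>UNIV. 1 / (1 - u i)) - (\<Sum>\<alpha>\<in>F. \<Prod>i\<in>UNIV. u i ^ \<alpha> i))
    \<le> (\<Prod>i\<in>UNIV. 1 / (1 - cmod (u i))) - (\<Sum>\<alpha>\<in>F. \<Prod>i\<in>UNIV. cmod (u i) ^ \<alpha> i)"
proof -
  have 1: "((\<lambda>\<alpha>. \<Prod>i\<in>UNIV. u i ^ \<alpha> i) has_sum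
      ((\<Prod>i\<in>UNIV. 1 / (1 - u i)) - (\<Sum>\<alpha>\<in>F. \<Prod>i\<in>UNIV. u i ^ \<alpha> i))) (UNIV - F)"
    by (rule has_sum_Diff[OF geometric_has_sum_multiindex(1)[OF u] has_sum_finite[OF F]]) auto
  have 2: "((\<lambda>\<alpha>. \<Prod>i\<in>UNIV. cmod (u i) ^ \<alpha> i) has_sum
      ((\<Prod>i\<in>UNIV. 1 / (1 - cmod (u i))) - (\<Sum>\<alpha>\<in>F. \<Prod>i\<in>UNIV. cmod (u i) ^ \<alpha> i))) (UNIV - F)"
    by (rule has_sum_Diff[OF geometric_has_sum_multiindex(1) has_sum_finite[OF F]]) (use u in auto)
  show ?thesis
    by (rule norm_infsum_le[OF 1 2]) (simp add: prod_norm[symmetric] norm_power)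
qed

text \<open>Expand the Cauchy kernel on the torus into a multiple geometric series and integrate term by term. The
preceding lemma bounds the error of every finite partial sum uniformly on the torus, so this is
legitimate and the convergence is unconditional.\<close>

theorem separately_holomorphic_power_series:
  fixes f :: "complex ^ 'n::finite \<Rightarrow> complex"
  assumes r: "0 < r"
    and contf: "continuous_on {z. \<forall>i. cmod (z $ i - a $ i) \<le> r} f"
    and holf: "\<And>z j. \<forall>i. cmod (z $ i - a $ i) \<le> r \<Longrightarrow>
        (\<lambda>u. f (\<chi> i. if i = j then u else z $ i)) holomorphic_on ball (a $ j) r"
  shows "\<exists>c. \<forall>z. (\<forall>i. cmod (z $ i - a $ i) < r) \<longrightarrow>
           ((\<lambda>\<alpha>. c \<alpha> * (\<Prod>i\<in>UNIV. (z $ i - a $ i) ^ \<alpha> i)) has_sum f z) UNIV"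
proof -
  let ?K = "{z. \<forall>i. cmod (z $ i - a $ i) \<le> r}"
  let ?M = "PiM (UNIV::'n set) (\<lambda>_. unit_interval)"
  define w where "w \<theta> = (\<chi> i. a $ i + of_real r * cis (2 * pi * \<theta> i))" for \<theta> :: "'n \<Rightarrow> real"
  define c where "c \<alpha> = (\<integral>\<theta>. f (w \<theta>) * (\<Prod>i\<in>UNIV. (cis (- (2 * pi * \<theta> i)) / of_real r) ^ \<alpha> i) \<partial>?M)" for \<alpha>
  interpret P: product_prob_space "\<lambda>_::'n. unit_interval" UNIV
    by (simp add: product_prob_space_def product_prob_space_axioms_def product_sigma_finite_def
        prob_space_unit_interval prob_space_imp_sigma_finite)
  have wK: "w \<theta> \<in> ?K" for \<theta>
    using r by (auto simp: norm_mult w_def)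
  have "bounded (f ` ?K)"
    using compact_continuous_image[OF contf compact_polydisc] compact_imp_bounded by blast
  then obtain B where B: "\<And>x. x \<in> ?K \<Longrightarrow> cmod (f x) \<le> B"
    unfolding bounded_iff by blast
  then have Bw: "cmod (f (w \<theta>)) \<le> B" for \<theta> using wK by blast
  have B0: "0 \<le> B" using order_trans[OF norm_ge_zero Bw] .
  have mf: "(\<lambda>\<theta>. f (w \<theta>)) \<in> borel_measurable ?M"
    using measurable_torus_function[OF contf r, of a UNIV] r by (simp add: w_def)
  have mcis: "(\<lambda>\<theta>. cis (- (2 * pi * \<theta> i))) \<in> borel_measurable ?M" for i
    by (intro measurable_compose[OF _ measurable_cis] borel_measurable_uminus borel_measurable_times
        borel_measurable_const measurable_unit_interval_component) auto
  have "((\<lambda>\<alpha>. c \<alpha> * (\<Prod>i\<in>UNIV. (z $ i - a $ i) ^ \<alpha> i)) has_sum f z) UNIV"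
    if z: "\<forall>i. cmod (z $ i - a $ i) < r" for z
  proof -
    define \<zeta> where "\<zeta> i = (z $ i - a $ i) / of_real r" for i
    define u where "u \<theta> i = \<zeta> i * cis (- (2 * pi * \<theta> i))" for \<theta> i
    have \<zeta>: "cmod (\<zeta> i) < 1" for i
      using z r by (simp add: norm_divide \<zeta>_def)
    have u: "cmod (u \<theta> i) = cmod (\<zeta> i)" for \<theta> i
      by (simp add: u_def norm_mult)
    have mu: "(\<lambda>\<theta>. u \<theta> i) \<in> borel_measurable ?M" for i
      unfolding u_def by (intro borel_measurable_times borel_measurable_const mcis)
    define g where "g F = (\<Prod>i\<in>UNIV. 1 / (1 - cmod (\<zeta> i))) - (\<Sum>\<alpha>\<in>F. \<Prod>i\<in>UNIV. cmod (\<zeta> i) ^ \<alpha> i)" for F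
    have rem: "cmod ((\<Prod>i\<in>UNIV. 1 / (1 - u \<theta> i)) - (\<Sum>\<alpha>\<in>F. \<Prod>i\<in>UNIV. u \<theta> i ^ \<alpha> i)) \<le> g F" if "finite F" for F \<theta>
      using geometric_multiindex_remainder[of "u \<theta>" F] that \<zeta> by (simp add: u g_def)
    have int: "integrable ?M (\<lambda>\<theta>. f (w \<theta>) * h \<theta>)"
      if "h \<in> borel_measurable ?M" "\<And>\<theta>. cmod (h \<theta>) \<le> C" for h C
    proof (rule P.P.integrable_const_bound[where B="B * C"])
      show "AE \<theta> in ?M. cmod (f (w \<theta>) * h \<theta>) \<le> B * C"
        using Bw that(2) B0 by (intro AE_I2) (auto simp: norm_mult intro!: mult_mono)
    qed (intro borel_measurable_times mf that)
    have fz: "f z = (\<integral>\<theta>. f (w \<theta>) * (\<Prod>i\<in>UNIV. 1 / (1 - u \<theta> i)) \<partial>?M)"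
      using torus_Cauchy_integral[OF r contf holf, of z UNIV] z
      by (simp add: w_def u_def \<zeta>_def prod_dividef)
    have coeff: "c \<alpha> * (\<Prod>i\<in>UNIV. (z $ i - a $ i) ^ \<alpha> i) = (\<integral>\<theta>. f (w \<theta>) * (\<Prod>i\<in>UNIV. u \<theta> i ^ \<alpha> i) \<partial>?M)" for \<alpha>
      unfolding c_def integral_mult_left_zero[symmetric] mult.assoc prod.distrib[symmetric]
      by (simp add: u_def \<zeta>_def power_mult_distrib[symmetric] mult_ac)
    have intu: "integrable ?M (\<lambda>\<theta>. f (w \<theta>) * (\<Prod>i\<in>UNIV. u \<theta> i ^ \<alpha> i))" for \<alpha>
    proof (rule int)
      show "cmod (\<Prod>i\<in>UNIV. u \<theta> i ^ \<alpha> i) \<le> (\<Prod>i\<in>UNIV. cmod (\<zeta> i) ^ \<alpha> i)" for \<theta>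
        by (simp add: prod_norm[symmetric] norm_power u)
    qed (intro borel_measurable_prod borel_measurable_power mu)
    have intq: "integrable ?M (\<lambda>\<theta>. f (w \<theta>) * (\<Prod>i\<in>UNIV. 1 / (1 - u \<theta> i)))"
    proof (rule int)
      show "cmod (\<Prod>i\<in>UNIV. 1 / (1 - u \<theta> i)) \<le> g {}" for \<theta>
        using rem[of "{}"] by simp
    qed (intro borel_measurable_prod borel_measurable_divide borel_measurable_diff mu borel_measurable_const)
    have bound: "cmod ((\<Sum>\<alpha>\<in>F. c \<alpha> * (\<Prod>i\<in>UNIV. (z $ i - a $ i) ^ \<alpha> i)) - f z) \<le> B * g F" if F: "finite F" for F
    proof -
      have "f z - (\<Sum>\<alpha>\<in>F. c \<alpha> * (\<Prod>i\<in>UNIV. (z $ i - a $ i) ^ \<alpha> i)) =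
        (\<integral>\<theta>. f (w \<theta>) * ((\<Prod>i\<in>UNIV. 1 / (1 - u \<theta> i)) - (\<Sum>\<alpha>\<in>F. \<Prod>i\<in>UNIV. u \<theta> i ^ \<alpha> i)) \<partial>?M)"
        unfolding coeff fz right_diff_distrib sum_distrib_left
        using intu intq by (simp add: Bochner_Integration.integral_diff Bochner_Integration.integrable_sum)
      also have "cmod \<dots> \<le> (\<integral>\<theta>. B * g F \<partial>?M)"
      proof (rule order_trans[OF integral_norm_bound], rule integral_mono)
        show "integrable ?M (\<lambda>\<theta>. cmod (f (w \<theta>) * ((\<Prod>i\<in>UNIV. 1 / (1 - u \<theta> i)) - (\<Sum>\<alpha>\<in>F. \<Prod>i\<in>UNIV. u \<theta> i ^ \<alpha> i))))"
          unfolding right_diff_distrib sum_distrib_left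
          by (intro integrable_norm Bochner_Integration.integrable_diff Bochner_Integration.integrable_sum intu intq)
        show "cmod (f (w \<theta>) * ((\<Prod>i\<in>UNIV. 1 / (1 - u \<theta> i)) - (\<Sum>\<alpha>\<in>F. \<Prod>i\<in>UNIV. u \<theta> i ^ \<alpha> i))) \<le> B * g F" for \<theta>
          unfolding norm_mult using Bw rem[OF F] B0 by (intro mult_mono) auto
      qed simp
      also have "\<dots> = B * g F" by (simp add: P.P.prob_space)
      finally show ?thesis by (simp add: norm_minus_commute)
    qed
    have "(g \<longlongrightarrow> 0) (finite_subsets_at_top UNIV)"
    proof -
      have "((\<lambda>\<alpha>. \<Prod>i\<in>UNIV. cmod (\<zeta> i) ^ \<alpha> i) has_sum (\<Prod>i\<in>UNIV. 1 / (1 - cmod (\<zeta> i)))) (UNIV :: ('n \<Rightarrow> nat) set)"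
        by (rule geometric_has_sum_multiindex(1)) (use \<zeta> in auto)
      then have "((\<lambda>F. (\<Prod>i\<in>UNIV. 1 / (1 - cmod (\<zeta> i))) - (\<Sum>\<alpha>\<in>F. \<Prod>i\<in>UNIV. cmod (\<zeta> i) ^ \<alpha> i)) \<longlongrightarrow>
         (\<Prod>i\<in>UNIV. 1 / (1 - cmod (\<zeta> i))) - (\<Prod>i\<in>UNIV. 1 / (1 - cmod (\<zeta> i)))) (finite_subsets_at_top (UNIV :: ('n \<Rightarrow> nat) set))"
        unfolding has_sum_def by (intro tendsto_diff tendsto_const)
      then show ?thesis unfolding g_def[abs_def] by simp
    qed
    then have "((\<lambda>F. B * g F) \<longlongrightarrow> 0) (finite_subsets_at_top UNIV)"
      by (rule tendsto_mult_right_zero)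
    then have "((\<lambda>F. (\<Sum>\<alpha>\<in>F. c \<alpha> * (\<Prod>i\<in>UNIV. (z $ i - a $ i) ^ \<alpha> i)) - f z) \<longlongrightarrow> 0) (finite_subsets_at_top UNIV)"
      by (rule Lim_null_comparison[rotated]) (intro eventually_finite_subsets_at_top_weakI bound)
    then show ?thesis
      unfolding has_sum_def by (subst (asm) Lim_null[symmetric])
  qed
  then show ?thesis by blast
qed

section \<open>Exponential series in several complex variables\<close>

text \<open>Series \<open>\<Sum>n. \<Sum>\<gamma>\<in>J n. c \<gamma> * exp (L \<gamma> z)\<close> whose exponents are linear and grow at most like \<open>n\<close>. They converge
on a ball when the coefficients decay geometrically, and there they can be differentiated term by term.
Differentiating multiplies the coefficients by a value of \<open>L\<close>, which preserves the decay; so one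
theorem covers the derivatives of all orders.\<close>

locale exponential_series =
  fixes J :: "nat \<Rightarrow> 'i set" and L :: "'i \<Rightarrow> 'a::euclidean_space \<Rightarrow> complex" and B \<delta> :: real
  assumes finite_J: "finite (J n)"
    and L_linear: "bounded_linear (L \<gamma>)"
    and L_bound: "\<gamma> \<in> J n \<Longrightarrow> cmod (L \<gamma> z) \<le> B * real n * norm z"
    and B_pos: "0 \<le> B" and \<delta>_pos: "0 < \<delta>"
begin

text \<open>Geometric decay that survives multiplication by the largest value of the exponentials on the ball of
radius \<open>\<delta>\<close>.\<close>

definition decays :: "('i \<Rightarrow> complex) \<Rightarrow> bool" where
  "decays c \<longleftrightarrow> (\<exists>A s. 0 \<le> A \<and> 0 \<le> s \<and> s < 1 \<and> (\<forall>n. (\<Sum>\<gamma>\<in>J n. cmod (c \<gamma>)) * exp (B * \<delta>) ^ n \<le> A * s ^ n))"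

definition moment :: "('i \<Rightarrow> complex) \<Rightarrow> 'a \<Rightarrow> complex" where
  "moment c z = (\<Sum>n. \<Sum>\<gamma>\<in>J n. c \<gamma> * exp (L \<gamma> z))"

lemma cmod_exp_L:
  assumes "\<gamma> \<in> J n" "norm z < \<delta>"
  shows "cmod (exp (L \<gamma> z)) \<le> exp (B * \<delta>) ^ n"
proof -
  have "cmod (exp (L \<gamma> z)) \<le> exp (cmod (L \<gamma> z))" by (rule norm_exp)
  also have "cmod (L \<gamma> z) \<le> B * real n * \<delta>"
    by (rule order_trans[OF L_bound[OF assms(1)]], rule mult_left_mono) (use assms(2) B_pos in auto)
  also have "exp (B * real n * \<delta>) = exp (B * \<delta>) ^ n"
    by (simp add: exp_of_nat_mult[symmetric] mult_ac)
  finally show ?thesis by simp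
qed

text \<open>The factor \<open>n\<close> that comes from \<open>L\<close> is absorbed by a slightly larger ratio, by Bernoulli's inequality.\<close>

lemma decays_mult_L:
  assumes "decays c"
  shows "decays (\<lambda>\<gamma>. c \<gamma> * L \<gamma> h)"
proof -
  obtain A s where A: "0 \<le> A" "0 \<le> s" "s < 1"
    "\<And>n. (\<Sum>\<gamma>\<in>J n. cmod (c \<gamma>)) * exp (B * \<delta>) ^ n \<le> A * s ^ n"
    using assms unfolding decays_def by blast
  \<comment> \<open>small enough to keep the ratio \<open>(1 + \<eta>) * s\<close> below \<open>1\<close>\<close>
  define \<eta> where "\<eta> = (1 - s) / 2"
  have \<eta>: "0 < \<eta>" "(1 + \<eta>) * s < 1"
  proof -
    show "0 < \<eta>" using A by (simp add: \<eta>_def)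
    have "\<eta> * s \<le> \<eta> * 1" using A by (intro mult_left_mono) (auto simp: \<eta>_def)
    then show "(1 + \<eta>) * s < 1" using A by (simp add: \<eta>_def field_simps)
  qed
  have n_le: "real n \<le> (1 + \<eta>) ^ n / \<eta>" for n
    using Bernoulli_inequality[of \<eta> n] \<eta>(1) by (simp add: field_simps)
  have "(\<Sum>\<gamma>\<in>J n. cmod (c \<gamma> * L \<gamma> h)) * exp (B * \<delta>) ^ n \<le> (A * B * norm h / \<eta>) * ((1 + \<eta>) * s) ^ n" for n
  proof -
    have "(\<Sum>\<gamma>\<in>J n. cmod (c \<gamma> * L \<gamma> h)) \<le> (\<Sum>\<gamma>\<in>J n. cmod (c \<gamma>) * (B * real n * norm h))"
      unfolding norm_mult by (intro sum_mono mult_left_mono L_bound) auto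
    then have "(\<Sum>\<gamma>\<in>J n. cmod (c \<gamma> * L \<gamma> h)) * exp (B * \<delta>) ^ n \<le>
       ((\<Sum>\<gamma>\<in>J n. cmod (c \<gamma>)) * (B * real n * norm h)) * exp (B * \<delta>) ^ n"
      unfolding sum_distrib_right[symmetric] by (rule mult_right_mono) simp
    also have "\<dots> = ((\<Sum>\<gamma>\<in>J n. cmod (c \<gamma>)) * exp (B * \<delta>) ^ n) * (B * norm h * real n)"
      by (simp add: mult_ac)
    also have "\<dots> \<le> (A * s ^ n) * (B * norm h * ((1 + \<eta>) ^ n / \<eta>))"
    proof (rule mult_mono[OF A(4)])
      show "B * norm h * real n \<le> B * norm h * ((1 + \<eta>) ^ n / \<eta>)"
        by (rule mult_left_mono[OF n_le]) (use B_pos in auto)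
    qed (use A B_pos in auto)
    also have "\<dots> = (A * B * norm h / \<eta>) * ((1 + \<eta>) * s) ^ n"
      by (simp add: power_mult_distrib mult_ac)
    finally show ?thesis .
  qed
  moreover have "0 \<le> A * B * norm h / \<eta>" "0 \<le> (1 + \<eta>) * s"
    using A B_pos \<eta>(1) by auto
  ultimately show ?thesis unfolding decays_def using \<eta>(2) by blast
qed

lemma decays_summable_bound:
  assumes "decays c" "norm z < \<delta>"
  shows "cmod (\<Sum>\<gamma>\<in>J n. c \<gamma> * exp (L \<gamma> z)) \<le> (\<Sum>\<gamma>\<in>J n. cmod (c \<gamma>)) * exp (B * \<delta>) ^ n"
proof -
  have "cmod (\<Sum>\<gamma>\<in>J n. c \<gamma> * exp (L \<gamma> z)) \<le> (\<Sum>\<gamma>\<in>J n. cmod (c \<gamma>) * exp (B * \<delta>) ^ n)"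
    by (rule order_trans[OF norm_sum], rule sum_mono, unfold norm_mult,
        rule mult_left_mono[OF cmod_exp_L[OF _ assms(2)]]) auto
  then show ?thesis by (simp add: sum_distrib_right)
qed

lemma summable_decays: "decays c \<Longrightarrow> summable (\<lambda>n. (\<Sum>\<gamma>\<in>J n. cmod (c \<gamma>)) * exp (B * \<delta>) ^ n)"
proof -
  assume "decays c"
  then obtain A s where A: "0 \<le> A" "0 \<le> s" "s < 1"
    "\<And>n. (\<Sum>\<gamma>\<in>J n. cmod (c \<gamma>)) * exp (B * \<delta>) ^ n \<le> A * s ^ n"
    unfolding decays_def by blast
  show ?thesis
  proof (rule summable_comparison_test'[where g="\<lambda>n. A * s ^ n" and N=0])
    show "norm ((\<Sum>\<gamma>\<in>J n. cmod (c \<gamma>)) * exp (B * \<delta>) ^ n) \<le> A * s ^ n" for n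
      using A(4)[of n] by (simp add: abs_mult abs_of_nonneg sum_nonneg)
  qed (use A in \<open>auto intro!: summable_mult summable_geometric\<close>)
qed

lemma moment_summable:
  assumes "decays c" "norm z < \<delta>"
  shows "summable (\<lambda>n. \<Sum>\<gamma>\<in>J n. c \<gamma> * exp (L \<gamma> z))"
  by (rule summable_comparison_test'[OF summable_decays[OF assms(1)] decays_summable_bound[OF assms]])

theorem moment_has_derivative:
  assumes c: "decays c" and z: "norm z < \<delta>"
  shows "(moment c has_derivative (\<lambda>h. moment (\<lambda>\<gamma>. c \<gamma> * L \<gamma> h) z)) (at z)"
proof -
  let ?S = "ball 0 \<delta> :: 'a set"
  let ?f = "\<lambda>n z. \<Sum>\<gamma>\<in>J n. c \<gamma> * exp (L \<gamma> z)"
  let ?f' = "\<lambda>n z h. \<Sum>\<gamma>\<in>J n. (c \<gamma> * L \<gamma> h) * exp (L \<gamma> z)"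
  have "\<exists>g. \<forall>x\<in>?S. (\<lambda>n. ?f n x) sums g x \<and>
      (g has_derivative (\<lambda>h. moment (\<lambda>\<gamma>. c \<gamma> * L \<gamma> h) x)) (at x within ?S)"
  proof (rule has_derivative_series[where f'="?f'" and x=z])
    show "convex ?S" by simp
    show "z \<in> ?S" using z by simp
    show "(\<lambda>n. ?f n z) sums moment c z"
      unfolding moment_def by (intro summable_sums moment_summable c z)
    show "(?f n has_derivative ?f' n x) (at x within ?S)" for n x
    proof (rule has_derivative_eq_rhs, rule has_derivative_sum)
      fix \<gamma>
      show "((\<lambda>z. c \<gamma> * exp (L \<gamma> z)) has_derivative (\<lambda>h. c \<gamma> * (exp (L \<gamma> x) * L \<gamma> h))) (at x within ?S)"
      proof -
        have "(L \<gamma> has_derivative L \<gamma>) (at x within ?S)"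
          by (rule bounded_linear_imp_has_derivative[OF L_linear])
        from has_derivative_compose[OF this, of exp "\<lambda>h. exp (L \<gamma> x) * h"]
        have "((\<lambda>z. exp (L \<gamma> z)) has_derivative (\<lambda>h. exp (L \<gamma> x) * L \<gamma> h)) (at x within ?S)"
          using DERIV_exp[of "L \<gamma> x"] by (simp add: has_field_derivative_def)
        then show ?thesis by (rule has_derivative_mult_right)
      qed
    qed (simp add: mult_ac)
    fix e :: real assume e: "0 < e"
    obtain s where s: "\<And>n x h. x \<in> ?S \<Longrightarrow> cmod (?f' n x h) \<le> s n * norm h" "summable s" "\<And>n. 0 \<le> s n"
    proof -
      obtain A q where A: "0 \<le> A" "0 \<le> q" "q < 1"
        "\<And>n. (\<Sum>\<gamma>\<in>J n. cmod (c \<gamma>)) * exp (B * \<delta>) ^ n \<le> A * q ^ n"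
        using c unfolding decays_def by blast
      let ?s = "\<lambda>n. A * B * (real n * q ^ n)"
      have "cmod (?f' n x h) \<le> ?s n * norm h" if x: "x \<in> ?S" for n x h
      proof -
        have "cmod (?f' n x h) \<le> (\<Sum>\<gamma>\<in>J n. (cmod (c \<gamma>) * (B * real n * norm h)) * exp (B * \<delta>) ^ n)"
        proof (rule order_trans[OF norm_sum], rule sum_mono)
          fix \<gamma> assume \<gamma>: "\<gamma> \<in> J n"
          have "cmod (exp (L \<gamma> x)) \<le> exp (B * \<delta>) ^ n" using x by (intro cmod_exp_L \<gamma>) simp
          moreover have "cmod (c \<gamma> * L \<gamma> h) \<le> cmod (c \<gamma>) * (B * real n * norm h)"
            unfolding norm_mult by (rule mult_left_mono[OF L_bound[OF \<gamma>]]) simp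
          ultimately show "cmod (c \<gamma> * L \<gamma> h * exp (L \<gamma> x)) \<le> (cmod (c \<gamma>) * (B * real n * norm h)) * exp (B * \<delta>) ^ n"
            unfolding norm_mult[of "c \<gamma> * L \<gamma> h"] using B_pos by (intro mult_mono) auto
        qed
        also have "\<dots> = ((\<Sum>\<gamma>\<in>J n. cmod (c \<gamma>)) * exp (B * \<delta>) ^ n) * (B * real n * norm h)"
          by (simp add: sum_distrib_right sum_distrib_left mult_ac)
        also have "\<dots> \<le> (A * q ^ n) * (B * real n * norm h)"
          using A(4)[of n] B_pos by (intro mult_right_mono) auto
        finally show ?thesis by (simp add: mult_ac)
      qed
      moreover have "summable ?s"
      proof (intro summable_mult)
        have "summable (\<lambda>n. of_nat (Suc n) * q ^ n)"
          using A by (intro sums_summable[OF geometric_deriv_sums]) auto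
        then show "summable (\<lambda>n. real n * q ^ n)"
          by (rule summable_comparison_test') (use A in \<open>auto intro!: mult_right_mono\<close>)
      qed
      moreover have "0 \<le> ?s n" for n using A B_pos by simp
      ultimately show ?thesis by (rule that)
    qed
    have tail: "(\<lambda>n. \<Sum>i. s (i + n)) \<longlonglongrightarrow> 0"
      using suminf_exist_split2[OF s(2)] .
    from order_tendstoD(2)[OF this e]
    show "\<forall>\<^sub>F n in sequentially. \<forall>x\<in>?S. \<forall>h. norm ((\<Sum>i<n. ?f' i x h) - moment (\<lambda>\<gamma>. c \<gamma> * L \<gamma> h) x) \<le> e * norm h"
    proof eventually_elim
      case (elim n)
      show ?case
      proof (intro ballI allI)
        fix x h assume x: "x \<in> ?S"
        have sm: "summable (\<lambda>i. ?f' i x h)"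
          using x by (intro moment_summable decays_mult_L c) simp
        have "moment (\<lambda>\<gamma>. c \<gamma> * L \<gamma> h) x = (\<Sum>i. ?f' (i + n) x h) + (\<Sum>i<n. ?f' i x h)"
          unfolding moment_def by (rule suminf_split_initial_segment[OF sm])
        then have "norm ((\<Sum>i<n. ?f' i x h) - moment (\<lambda>\<gamma>. c \<gamma> * L \<gamma> h) x) = norm (\<Sum>i. ?f' (i + n) x h)"
          by (simp add: norm_minus_commute)
        also have "\<dots> \<le> (\<Sum>i. s (i + n) * norm h)"
          by (rule norm_suminf_le)
            (use s(1)[OF x] summable_ignore_initial_segment[OF s(2)] in \<open>auto intro: summable_mult2\<close>)
        also have "\<dots> = (\<Sum>i. s (i + n)) * norm h"
          using summable_ignore_initial_segment[OF s(2)] by (rule suminf_mult2[symmetric])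
        also have "\<dots> \<le> e * norm h" using elim by (intro mult_right_mono) auto
        finally show "norm ((\<Sum>i<n. ?f' i x h) - moment (\<lambda>\<gamma>. c \<gamma> * L \<gamma> h) x) \<le> e * norm h" .
      qed
    qed
  qed
  then obtain g where g: "\<And>x. x \<in> ?S \<Longrightarrow> (\<lambda>n. ?f n x) sums g x"
    "\<And>x. x \<in> ?S \<Longrightarrow> (g has_derivative (\<lambda>h. moment (\<lambda>\<gamma>. c \<gamma> * L \<gamma> h) x)) (at x within ?S)" by blast
  have geq: "g x = moment c x" if "x \<in> ?S" for x
    using sums_unique[OF g(1)[OF that]] by (simp add: moment_def)
  have "(g has_derivative (\<lambda>h. moment (\<lambda>\<gamma>. c \<gamma> * L \<gamma> h) z)) (at z)"
    using g(2)[of z] z by (simp add: at_within_open[of z ?S])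
  then show ?thesis
    by (rule has_derivative_transform_within_open[of _ _ _ UNIV ?S]) (use z geq in auto)
qed

lemma moment_continuous: "decays c \<Longrightarrow> continuous_on (ball 0 \<delta>) (moment c)"
  by (intro has_derivative_continuous_on[OF has_derivative_at_withinI[OF moment_has_derivative]]) auto

end

section \<open>Real analyticity and the holomorphic inverse of the gradient map\<close>

definition complexify :: "real ^ 'n \<Rightarrow> complex ^ 'n" where
  "complexify x = (\<chi> i. of_real (x $ i))"

lemma norm_complexify: "norm (complexify x) = norm x"
  by (simp add: complexify_def norm_vec_def L2_set_def)

lemma complexify_diff: "complexify x - complexify y = complexify (x - y)"
  by (simp add: complexify_def vec_eq_iff)

lemma dist_complexify: "dist (complexify x) (complexify y) = dist x y"
  by (simp add: dist_norm complexify_diff norm_complexify)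

text \<open>A derivative that is complex linear makes the function holomorphic in each variable, so it has a power
series around each real point; the real parts of its coefficients represent the real part of the function
at real arguments.\<close>

lemma holomorphic_imp_real_analytic:
  fixes f :: "complex ^ 'n::finite \<Rightarrow> complex"
  assumes S: "open S"
    and der: "\<And>z. z \<in> S \<Longrightarrow> (f has_derivative f' z) (at z)"
    and clin: "\<And>z c h. z \<in> S \<Longrightarrow> f' z (c *s h) = c * f' z h"
    and T: "\<And>x. x \<in> T \<Longrightarrow> complexify x \<in> S"
  shows "real_analytic_on T (\<lambda>x. Re (f (complexify x)))"
  unfolding real_analytic_on_def
proof
  fix x assume "x \<in> T"
  then have "complexify x \<in> S" by (rule T)
  then obtain \<epsilon> where \<epsilon>: "0 < \<epsilon>" "ball (complexify x) \<epsilon> \<subseteq> S"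
    using openE[OF S] by blast
  define a where "a = complexify x"
  \<comment> \<open>the closed polydisc of this radius lies in the ball of radius \<open>\<epsilon>\<close>\<close>
  define r where "r = \<epsilon> / (2 * real CARD('n))"
  have r: "0 < r" using \<epsilon>(1) by (simp add: r_def)
  let ?K = "{z. \<forall>i. cmod (z $ i - a $ i) \<le> r}"
  have KS: "?K \<subseteq> S"
  proof
    fix z assume "z \<in> ?K"
    then have "norm (z - a) \<le> (\<Sum>i\<in>(UNIV::'n set). r)"
      unfolding norm_vec_def by (intro order_trans[OF L2_set_le_sum] sum_mono) auto
    also have "\<dots> < \<epsilon>" using \<epsilon>(1) by (simp add: r_def)
    finally show "z \<in> S" using \<epsilon>(2) by (auto simp: a_def dist_norm norm_minus_commute)
  qed
  have cont: "continuous_on ?K f"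
    by (rule has_derivative_continuous_on, rule has_derivative_at_withinI, rule der, rule subsetD[OF KS])
  have hol: "(\<lambda>u. f (\<chi> i. if i = j then u else z $ i)) holomorphic_on ball (a $ j) r"
    if z: "\<forall>i. cmod (z $ i - a $ i) \<le> r" for z j
  proof -
    have deriv: "((\<lambda>u. f (\<chi> i. if i = j then u else z $ i)) has_field_derivative
        f' (\<chi> i. if i = j then u else z $ i) (axis j 1)) (at u)"
      if u: "u \<in> ball (a $ j) r" for u
    proof -
      let ?w = "\<lambda>u. \<chi> i. if i = j then u else z $ i"
      have wS: "?w u \<in> S" by (rule subsetD[OF KS]) (use z u in \<open>auto simp: dist_norm norm_minus_commute\<close>)
      have "?w = (\<lambda>u. axis j u + ?w 0)" by (auto simp: fun_eq_iff vec_eq_iff axis_def)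
      moreover have "((\<lambda>u. axis j u + ?w 0) has_derivative (\<lambda>h. axis j h)) (at u)"
      proof -
        have "bounded_linear (axis j :: complex \<Rightarrow> complex ^ 'n)"
          by (intro linear_conv_bounded_linear[THEN iffD1] linearI) (auto simp: axis_def vec_eq_iff)
        then show ?thesis by (auto intro!: derivative_eq_intros bounded_linear_imp_has_derivative)
      qed
      ultimately have "(?w has_derivative (\<lambda>h. axis j h)) (at u)" by simp
      from has_derivative_compose[OF this der[OF wS]]
      have "((\<lambda>u. f (?w u)) has_derivative (\<lambda>h. f' (?w u) (axis j h))) (at u)" .
      also have "(\<lambda>h. f' (?w u) (axis j h)) = (*) (f' (?w u) (axis j 1))"
      proof
        fix h
        have "axis j h = h *s (axis j 1 :: complex ^ 'n)" by (simp add: vec_eq_iff axis_def)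
        then show "f' (?w u) (axis j h) = f' (?w u) (axis j 1) * h"
          using clin[OF wS, of h "axis j 1"] by (simp only: mult.commute)
      qed
      finally show ?thesis unfolding has_field_derivative_def .
    qed
    show ?thesis
    proof (rule holomorphic_onI, rule field_differentiable_at_within)
      fix u assume "u \<in> ball (a $ j) r"
      from deriv[OF this] show "(\<lambda>u. f (\<chi> i. if i = j then u else z $ i)) field_differentiable at u"
        unfolding field_differentiable_def by (rule exI)
    qed
  qed
  from separately_holomorphic_power_series[OF r cont hol]
  obtain c where c: "\<forall>z. (\<forall>i. cmod (z $ i - a $ i) < r) \<longrightarrow>
      ((\<lambda>\<alpha>. c \<alpha> * (\<Prod>i\<in>UNIV. (z $ i - a $ i) ^ \<alpha> i)) has_sum f z) UNIV" ..
  show "\<exists>r>0. \<exists>c. \<forall>y\<in>ball x r. ((\<lambda>\<alpha>. c \<alpha> * (\<Prod>i\<in>UNIV. (y $ i - x $ i) ^ \<alpha> i)) has_sum Re (f (complexify y))) UNIV"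
  proof (intro exI[of _ r] conjI r exI[of _ "\<lambda>\<alpha>. Re (c \<alpha>)"] ballI)
    fix y assume y: "y \<in> ball x r"
    have coord: "complexify y $ i - a $ i = of_real (y $ i - x $ i)" for i
      by (simp add: a_def complexify_def)
    have "\<forall>i. cmod (complexify y $ i - a $ i) < r"
    proof
      fix i
      have "\<bar>(y - x) $ i\<bar> \<le> norm (y - x)" by (rule component_le_norm_cart)
      moreover have "norm (y - x) < r" using y by (simp add: dist_norm norm_minus_commute)
      ultimately show "cmod (complexify y $ i - a $ i) < r"
        unfolding coord norm_of_real by simp
    qed
    then have "((\<lambda>\<alpha>. c \<alpha> * (\<Prod>i\<in>UNIV. (complexify y $ i - a $ i) ^ \<alpha> i)) has_sum f (complexify y)) UNIV"
      by (rule mp[OF spec[OF c]])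
    then have "((\<lambda>\<alpha>. Re (c \<alpha> * (\<Prod>i\<in>UNIV. (complexify y $ i - a $ i) ^ \<alpha> i))) has_sum Re (f (complexify y))) UNIV"
      by (rule has_sum_Re)
    moreover have "Re (c \<alpha> * (\<Prod>i\<in>UNIV. (complexify y $ i - a $ i) ^ \<alpha> i)) =
        Re (c \<alpha>) * (\<Prod>i\<in>UNIV. (y $ i - x $ i) ^ \<alpha> i)" for \<alpha>
      unfolding coord of_real_power[symmetric] of_real_prod[symmetric]
      by (simp del: of_real_prod of_real_power of_real_diff)
    ultimately show "((\<lambda>\<alpha>. Re (c \<alpha>) * (\<Prod>i\<in>UNIV. (y $ i - x $ i) ^ \<alpha> i)) has_sum Re (f (complexify y))) UNIV"
      by simp
  qed
qed

lemma has_derivative_vec_lambda: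
  fixes f :: "'a::real_normed_vector \<Rightarrow> 'n::finite \<Rightarrow> complex"
  assumes "\<And>i. ((\<lambda>z. f z i) has_derivative (\<lambda>h. f' h i)) (at z)"
  shows "((\<lambda>z. \<chi> i. f z i) has_derivative (\<lambda>h. \<chi> i. f' h i)) (at z)"
  unfolding has_derivative_componentwise_within[where f="\<lambda>z. \<chi> i. f z i"]
proof
  fix b :: "complex ^ 'n" assume "b \<in> Basis"
  then obtain i u where b: "b = axis i u" by (auto simp: Basis_vec_def)
  show "((\<lambda>x. (\<chi> i. f x i) \<bullet> b) has_derivative (\<lambda>x. (\<chi> i. f' x i) \<bullet> b)) (at z)"
    unfolding b inner_axis vec_lambda_beta by (rule has_derivative_inner_left[OF assms])
qed

text \<open>Multiplication by a complex scalar on a product space; it serves to say that a real derivative is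
complex linear.\<close>

definition cscale :: "complex \<Rightarrow> (complex ^ 'n) \<times> complex \<Rightarrow> (complex ^ 'n) \<times> complex" where
  "cscale c z = (c *s fst z, c * snd z)"

definition conjg :: "(complex ^ 'n) \<times> complex \<Rightarrow> (complex ^ 'n) \<times> complex" where
  "conjg z = ((\<chi> i. cnj (fst z $ i)), cnj (snd z))"

lemma norm_conjg: "norm (conjg z) = norm z"
  by (cases z) (simp add: conjg_def norm_prod_def norm_vec_def L2_set_def)

definition unit_dir :: "'n::finite \<Rightarrow> (complex ^ 'n) \<times> complex" where "unit_dir i = (axis i 1, 0)"
definition last_dir :: "(complex ^ 'n) \<times> complex" where "last_dir = (0, 1)"

lemma conjg_dirs [simp]: "conjg (unit_dir i) = unit_dir i" "conjg last_dir = last_dir"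
  by (auto simp: conjg_def unit_dir_def last_dir_def axis_def vec_eq_iff)

text \<open>The generating function of a positive measure on the exponents, in the variables \<open>(\<beta>, \<mu>)\<close>. The exponents
are complex linear and real at real points, and no nonzero direction annihilates all exponents of
positive weight.\<close>

locale nondegenerate_series = exponential_series J L B \<delta>
  for J :: "nat \<Rightarrow> 'i set" and L :: "'i \<Rightarrow> (complex ^ 'n::finite) \<times> complex \<Rightarrow> complex" and B \<delta> :: real +
  fixes w :: "'i \<Rightarrow> real"
  assumes L_cscale: "L \<gamma> (cscale c z) = c * L \<gamma> z"
    and L_conjg: "L \<gamma> (conjg z) = cnj (L \<gamma> z)"
    and w_nonneg: "0 \<le> w \<gamma>"
    and w_decays: "decays (\<lambda>\<gamma>. of_real (w \<gamma>))"
    and nondegenerate: "(\<And>n \<gamma>. \<gamma> \<in> J n \<Longrightarrow> 0 < w \<gamma> \<Longrightarrow> L \<gamma> h = 0) \<Longrightarrow> h = 0"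
begin

text \<open>\<open>M\<close> is the generating function, \<open>D e\<close> its derivative in the direction \<open>e\<close>, and \<open>D2 e h\<close> its second
derivative in the directions \<open>e\<close> and \<open>h\<close>.\<close>

definition M where "M = moment (\<lambda>\<gamma>. of_real (w \<gamma>))"
definition D where "D e = moment (\<lambda>\<gamma>. of_real (w \<gamma>) * L \<gamma> e)"
definition D2 where "D2 e h = moment (\<lambda>\<gamma>. of_real (w \<gamma>) * L \<gamma> e * L \<gamma> h)"

lemma D_decays: "decays (\<lambda>\<gamma>. of_real (w \<gamma>) * L \<gamma> e)"
  by (rule decays_mult_L[OF w_decays])

lemma D2_decays: "decays (\<lambda>\<gamma>. of_real (w \<gamma>) * L \<gamma> e * L \<gamma> h)"
  by (rule decays_mult_L[OF D_decays])

lemma M_has_derivative: "norm z < \<delta> \<Longrightarrow> (M has_derivative (\<lambda>h. D h z)) (at z)"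
  unfolding M_def D_def by (rule moment_has_derivative[OF w_decays])

lemma D_has_derivative: "norm z < \<delta> \<Longrightarrow> (D e has_derivative (\<lambda>h. D2 e h z)) (at z)"
  unfolding D_def D2_def by (rule moment_has_derivative[OF D_decays])

lemma L_expand: "L \<gamma> z = (\<Sum>i\<in>UNIV. fst z $ i * L \<gamma> (unit_dir i)) + snd z * L \<gamma> last_dir"
proof -
  interpret bounded_linear "L \<gamma>" by (rule L_linear)
  have "z = (\<Sum>i\<in>UNIV. cscale (fst z $ i) (unit_dir i)) + cscale (snd z) last_dir"
    by (cases z) (auto simp: prod_eq_iff fst_sum snd_sum cscale_def unit_dir_def last_dir_def vec_eq_iff
        axis_def if_distrib cong: if_cong)
  then have "L \<gamma> z = L \<gamma> ((\<Sum>i\<in>UNIV. cscale (fst z $ i) (unit_dir i)) + cscale (snd z) last_dir)" by simp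
  then show ?thesis by (simp add: add sum L_cscale)
qed

lemma moment_expand:
  assumes c: "\<And>e. decays (\<lambda>\<gamma>. c \<gamma> * L \<gamma> e)" and z: "norm z < \<delta>"
  shows "moment (\<lambda>\<gamma>. c \<gamma> * L \<gamma> e) z =
    (\<Sum>i\<in>UNIV. fst e $ i * moment (\<lambda>\<gamma>. c \<gamma> * L \<gamma> (unit_dir i)) z) + snd e * moment (\<lambda>\<gamma>. c \<gamma> * L \<gamma> last_dir) z"
proof -
  let ?s = "\<lambda>e n. \<Sum>\<gamma>\<in>J n. c \<gamma> * L \<gamma> e * exp (L \<gamma> z)"
  have "(\<lambda>n. (\<Sum>i\<in>UNIV. fst e $ i * ?s (unit_dir i) n) + snd e * ?s last_dir n) sums
     ((\<Sum>i\<in>UNIV. fst e $ i * moment (\<lambda>\<gamma>. c \<gamma> * L \<gamma> (unit_dir i)) z) + snd e * moment (\<lambda>\<gamma>. c \<gamma> * L \<gamma> last_dir) z)"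
    unfolding moment_def by (intro sums_add sums_sum sums_mult summable_sums moment_summable c z)
  also have "(\<lambda>n. (\<Sum>i\<in>UNIV. fst e $ i * ?s (unit_dir i) n) + snd e * ?s last_dir n) = ?s e"
  proof
    fix n
    have "(\<Sum>i\<in>UNIV. fst e $ i * ?s (unit_dir i) n) = (\<Sum>\<gamma>\<in>J n. \<Sum>i\<in>UNIV. fst e $ i * (c \<gamma> * L \<gamma> (unit_dir i) * exp (L \<gamma> z)))"
      unfolding sum_distrib_left by (rule sum.swap)
    then show "(\<Sum>i\<in>UNIV. fst e $ i * ?s (unit_dir i) n) + snd e * ?s last_dir n = ?s e n"
      unfolding L_expand[of _ e]
      by (simp add: sum_distrib_left sum_distrib_right sum.distrib distrib_left distrib_right mult_ac)
  qed
  finally show ?thesis unfolding moment_def by (rule sums_unique[symmetric])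
qed

lemma D_expand: "norm z < \<delta> \<Longrightarrow> D e z = (\<Sum>i\<in>UNIV. fst e $ i * D (unit_dir i) z) + snd e * D last_dir z"
  unfolding D_def by (rule moment_expand[OF D_decays])

lemma D2_expand: "norm z < \<delta> \<Longrightarrow> D2 e h z = (\<Sum>i\<in>UNIV. fst e $ i * D2 (unit_dir i) h z) + snd e * D2 last_dir h z"
proof -
  assume z: "norm z < \<delta>"
  have sw: "D2 e h z = moment (\<lambda>\<gamma>. (of_real (w \<gamma>) * L \<gamma> h) * L \<gamma> e) z" for e
    unfolding D2_def by (simp add: mult_ac)
  show ?thesis unfolding sw
    by (rule moment_expand[OF _ z]) (rule D2_decays)
qed

lemma moment_cscale:
  assumes "decays (\<lambda>\<gamma>. c \<gamma> * L \<gamma> h)" "norm z < \<delta>"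
  shows "moment (\<lambda>\<gamma>. c \<gamma> * L \<gamma> (cscale a h)) z = a * moment (\<lambda>\<gamma>. c \<gamma> * L \<gamma> h) z"
proof -
  have "(\<lambda>n. a * (\<Sum>\<gamma>\<in>J n. c \<gamma> * L \<gamma> h * exp (L \<gamma> z))) sums (a * moment (\<lambda>\<gamma>. c \<gamma> * L \<gamma> h) z)"
    unfolding moment_def by (intro sums_mult summable_sums moment_summable assms)
  then show ?thesis
    unfolding moment_def by (intro sums_unique[symmetric]) (simp add: sum_distrib_left L_cscale mult_ac)
qed

lemma D_cscale: "norm z < \<delta> \<Longrightarrow> D (cscale a h) z = a * D h z"
  unfolding D_def by (rule moment_cscale[OF D_decays])

lemma D2_cscale: "norm z < \<delta> \<Longrightarrow> D2 e (cscale a h) z = a * D2 e h z"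
  unfolding D2_def by (rule moment_cscale[OF D2_decays])

lemma moment_conjg:
  assumes "decays c" "norm z < \<delta>"
  shows "moment (\<lambda>\<gamma>. cnj (c \<gamma>)) (conjg z) = cnj (moment c z)"
proof -
  have "(\<lambda>n. cnj (\<Sum>\<gamma>\<in>J n. c \<gamma> * exp (L \<gamma> z))) sums cnj (moment c z)"
    unfolding moment_def sums_cnj by (intro summable_sums moment_summable assms)
  then show ?thesis
    unfolding moment_def by (intro sums_unique[symmetric]) (simp add: L_conjg exp_cnj)
qed

lemma M_conjg: "norm z < \<delta> \<Longrightarrow> M (conjg z) = cnj (M z)"
  using moment_conjg[OF w_decays] unfolding M_def by simp

lemma D_conjg: "norm z < \<delta> \<Longrightarrow> D (conjg e) (conjg z) = cnj (D e z)"
  using moment_conjg[OF D_decays[of e]] unfolding D_def by (simp add: L_conjg)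

text \<open>This value is the sum of the terms \<open>w \<gamma> * (cmod (L \<gamma> h))\<^sup>2\<close>, so it vanishes only if each of them does.\<close>

lemma D2_conjg_eq_0:
  assumes "D2 (conjg h) h 0 = 0"
  shows "h = 0"
proof (rule nondegenerate)
  fix n \<gamma> assume \<gamma>: "\<gamma> \<in> J n" "0 < w \<gamma>"
  let ?s = "\<lambda>n. \<Sum>\<gamma>\<in>J n. w \<gamma> * (cmod (L \<gamma> h))^2"
  have eq: "of_real (w \<gamma>) * L \<gamma> (conjg h) * L \<gamma> h * exp (L \<gamma> 0) = of_real (w \<gamma> * (cmod (L \<gamma> h))^2)" for \<gamma>
  proof -
    have "L \<gamma> 0 = 0" using L_linear by (simp add: bounded_linear.linear linear_0)
    moreover have "L \<gamma> (conjg h) * L \<gamma> h = of_real ((cmod (L \<gamma> h))^2)"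
      unfolding L_conjg complex_norm_square by (rule mult.commute)
    ultimately show ?thesis by (simp add: mult.assoc)
  qed
  have "(\<lambda>n. \<Sum>\<gamma>\<in>J n. of_real (w \<gamma>) * L \<gamma> (conjg h) * L \<gamma> h * exp (L \<gamma> 0)) sums D2 (conjg h) h 0"
    unfolding D2_def moment_def using \<delta>_pos by (intro summable_sums moment_summable D2_decays) simp
  then have "(\<lambda>n. complex_of_real (?s n)) sums of_real 0"
    unfolding eq assms of_real_sum of_real_0 .
  then have "?s sums 0" unfolding sums_of_real_iff .
  then have s: "summable ?s" "suminf ?s = 0" by (rule sums_summable, rule sums_unique[symmetric])
  have nonneg: "0 \<le> w \<gamma> * (cmod (L \<gamma> h))^2" for \<gamma>
    by (rule mult_nonneg_nonneg[OF w_nonneg zero_le_power2])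
  have "0 \<le> ?s n" for n by (rule sum_nonneg) (rule nonneg)
  from suminf_eq_zero_iff[OF s(1) this] s(2) have "?s n = 0" by blast
  then have "\<forall>\<gamma>\<in>J n. w \<gamma> * (cmod (L \<gamma> h))^2 = 0"
    using nonneg by (subst (asm) sum_nonneg_eq_0_iff[OF finite_J]) auto
  then have "w \<gamma> * (cmod (L \<gamma> h))^2 = 0" using \<gamma>(1) by blast
  then show "L \<gamma> h = 0" using \<gamma>(2) by simp
qed

text \<open>The first component is the slope: the quotient of the derivatives in the first \<open>n\<close> directions and the
derivative in the last one. Extended by \<open>1\<close>, it is normal to the level sets of \<open>M\<close>.\<close>

definition \<Phi> where "\<Phi> z = ((\<chi> i. D (unit_dir i) z / D last_dir z), M z)"
definition \<Phi>' where "\<Phi>' z h = ((\<chi> i. (D2 (unit_dir i) h z * D last_dir z - D (unit_dir i) z * D2 last_dir h z) / (D last_dir z)^2), D h z)"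

lemma \<Phi>_conjg: "norm z < \<delta> \<Longrightarrow> \<Phi> (conjg z) = conjg (\<Phi> z)"
proof -
  assume z: "norm z < \<delta>"
  have "D (unit_dir i) (conjg z) = cnj (D (unit_dir i) z)" for i
    using D_conjg[OF z, of "unit_dir i"] by simp
  moreover have "D last_dir (conjg z) = cnj (D last_dir z)"
    using D_conjg[OF z, of last_dir] by simp
  ultimately show ?thesis
    unfolding \<Phi>_def M_conjg[OF z] by (simp add: conjg_def)
qed

lemma \<Phi>_has_derivative:
  assumes "norm z < \<delta>" "D last_dir z \<noteq> 0"
  shows "(\<Phi> has_derivative \<Phi>' z) (at z)"
proof -
  have "((\<lambda>z. D (unit_dir i) z / D last_dir z) has_derivative
     (\<lambda>h. (D2 (unit_dir i) h z * D last_dir z - D (unit_dir i) z * D2 last_dir h z) / (D last_dir z)^2)) (at z)" for i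
    by (rule has_derivative_eq_rhs[OF has_derivative_divide'[OF D_has_derivative D_has_derivative]])
      (use assms in \<open>auto simp: power2_eq_square\<close>)
  then have "((\<lambda>z. \<chi> i. D (unit_dir i) z / D last_dir z) has_derivative
     (\<lambda>h. \<chi> i. (D2 (unit_dir i) h z * D last_dir z - D (unit_dir i) z * D2 last_dir h z) / (D last_dir z)^2)) (at z)"
    by (rule has_derivative_vec_lambda)
  from has_derivative_Pair[OF this M_has_derivative[OF assms(1)]]
  show ?thesis unfolding \<Phi>_def[abs_def] \<Phi>'_def[abs_def] .
qed

lemma \<Phi>'_cscale: "norm z < \<delta> \<Longrightarrow> \<Phi>' z (cscale c h) = cscale c (\<Phi>' z h)"
  unfolding \<Phi>'_def by (simp add: D_cscale D2_cscale) (simp add: cscale_def vec_eq_iff right_diff_distrib mult_ac)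

text \<open>Let \<open>v\<close> be the slope at \<open>0\<close>; it is real. If the first component of the derivative vanishes, then
\<open>D2 e h 0\<close> is, for every \<open>e = (p, q)\<close>, a multiple of \<open>p \<bullet> v + q\<close>. This factor vanishes for \<open>e = h\<close> by the second
component, hence also for the conjugate of \<open>h\<close>. Then the positive definite form \<open>D2 (conjg h) h 0\<close> is \<open>0\<close>.\<close>

lemma \<Phi>'_inj:
  assumes nz: "D last_dir 0 \<noteq> 0" and h: "\<Phi>' 0 h = 0"
  shows "h = 0"
proof -
  let ?v = "\<lambda>i. D (unit_dir i) 0 / D last_dir 0"
  have n0: "norm (0 :: (complex ^ 'n) \<times> complex) < \<delta>" using \<delta>_pos by simp
  have c0: "conjg 0 = (0 :: (complex ^ 'n) \<times> complex)" by (simp add: conjg_def zero_prod_def vec_eq_iff)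
  have real: "cnj (?v i) = ?v i" for i
    using D_conjg[OF n0, of "unit_dir i"] D_conjg[OF n0, of last_dir] by (simp add: c0)
  have 1: "D2 (unit_dir i) h 0 = ?v i * D2 last_dir h 0" for i
  proof -
    have "(D2 (unit_dir i) h 0 * D last_dir 0 - D (unit_dir i) 0 * D2 last_dir h 0) / (D last_dir 0)^2 = 0"
      using h by (auto simp: \<Phi>'_def prod_eq_iff vec_eq_iff)
    then show ?thesis using nz by (simp add: field_simps)
  qed
  have "D h 0 = 0" using h by (simp add: \<Phi>'_def prod_eq_iff)
  then have "((\<Sum>i\<in>UNIV. fst h $ i * ?v i) + snd h) * D last_dir 0 = 0"
    using nz by (simp add: D_expand[OF n0, of h] distrib_right sum_distrib_right)
  then have "(\<Sum>i\<in>UNIV. fst h $ i * ?v i) + snd h = 0" using nz by simp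
  from arg_cong[OF this, of cnj]
  have 2: "(\<Sum>i\<in>UNIV. cnj (fst h $ i) * ?v i) + cnj (snd h) = 0"
    by (simp only: complex_cnj_add cnj_sum complex_cnj_mult real complex_cnj_zero)
  have "D2 (conjg h) h 0 = ((\<Sum>i\<in>UNIV. cnj (fst h $ i) * ?v i) + cnj (snd h)) * D2 last_dir h 0"
    unfolding D2_expand[OF n0, of "conjg h"] 1 by (simp add: conjg_def distrib_right sum_distrib_right mult.assoc)
  then have "D2 (conjg h) h 0 = 0" using 2 by simp
  then show ?thesis by (rule D2_conjg_eq_0)
qed

text \<open>The real inverse function theorem applies. The derivative of the inverse is the inverse of a complex
linear map and therefore complex linear.\<close>

theorem holomorphic_local_inverse:
  assumes nz: "D last_dir 0 \<noteq> 0"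
  shows "\<exists>U V g g'. open U \<and> 0 \<in> U \<and> U \<subseteq> ball 0 \<delta> \<inter> {z. D last_dir z \<noteq> 0} \<and> open V \<and> \<Phi> 0 \<in> V \<and>
     (\<forall>z\<in>U. g (\<Phi> z) = z) \<and> (\<forall>y\<in>V. g y \<in> U \<and> \<Phi> (g y) = y) \<and>
     (\<forall>y\<in>V. (g has_derivative g' y) (at y) \<and> (\<forall>c h. g' y (cscale c h) = cscale c (g' y h)))"
proof -
  let ?U = "{z \<in> ball 0 \<delta>. D last_dir z \<in> - {0}}"
  have contD: "continuous_on (ball 0 \<delta>) (D e)" for e
    unfolding D_def by (rule moment_continuous[OF D_decays])
  have contD2: "continuous_on (ball 0 \<delta>) (D2 e h)" for e h
    unfolding D2_def by (rule moment_continuous[OF D2_decays])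
  have U: "open ?U"
    using continuous_open_preimage[OF contD[of last_dir] open_ball open_Compl[OF closed_singleton[of 0]]]
    by (simp add: vimage_def Int_def)
  have der: "(\<Phi> has_derivative \<Phi>' z) (at z)" if "z \<in> ?U" for z
    using that by (intro \<Phi>_has_derivative) auto
  have bl: "bounded_linear (\<Phi>' z)" if "z \<in> ?U" for z
    using der[OF that] by (rule has_derivative_bounded_linear)
  define f' where "f' z = Blinfun (\<Phi>' z)" for z
  have f': "blinfun_apply (f' z) = \<Phi>' z" if "z \<in> ?U" for z
    unfolding f'_def using bl[OF that] by (rule bounded_linear_Blinfun_apply)
  have contf: "continuous_on ?U f'"
  proof (rule continuous_on_blinfun_componentwise)
    fix i :: "(complex ^ 'n) \<times> complex"
    have sub: "?U \<subseteq> ball 0 \<delta>" by auto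
    have "continuous_on ?U (\<lambda>z. \<Phi>' z i)"
      unfolding \<Phi>'_def
      by (intro continuous_intros continuous_on_vec_lambda continuous_on_subset[OF contD sub]
          continuous_on_subset[OF contD2 sub]) auto
    then show "continuous_on ?U (\<lambda>x. blinfun_apply (f' x) i)"
      by (rule continuous_on_eq) (simp add: f')
  qed
  have U0: "0 \<in> ?U" using nz \<delta>_pos by simp
  have lin: "linear (\<Phi>' 0)" using bl[OF U0] by (rule bounded_linear.linear)
  have "inj (\<Phi>' 0)"
    using linear_injective_0[OF lin] \<Phi>'_inj[OF nz] by blast
  then obtain G where G: "linear G" "G \<circ> \<Phi>' 0 = id"
    using linear_injective_left_inverse[OF lin] by blast
  have "Blinfun G o\<^sub>L f' 0 = id_blinfun"
  proof (rule blinfun_eqI)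
    fix i
    show "blinfun_apply (Blinfun G o\<^sub>L f' 0) i = blinfun_apply id_blinfun i"
      using fun_cong[OF G(2), of i] G(1) f'[OF U0]
      by (simp add: bounded_linear_Blinfun_apply linear_conv_bounded_linear)
  qed
  note inv = this
  have derf: "(\<Phi> has_derivative blinfun_apply (f' z)) (at z)" if "z \<in> ?U" for z
    unfolding f'[OF that] by (rule der[OF that])
  show ?thesis
  proof (rule inverse_function_theorem[OF U derf contf U0 inv])
    fix U' V g g'
    assume *: "open U'" "U' \<subseteq> ?U" "0 \<in> U'" "open V" "\<Phi> 0 \<in> V" "homeomorphism U' V \<Phi> g"
    "\<And>y. y \<in> V \<Longrightarrow> (g has_derivative (g' y)) (at y)"
    "\<And>y. y \<in> V \<Longrightarrow> g' y = inv (blinfun_apply (f' (g y)))"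
    "\<And>y. y \<in> V \<Longrightarrow> bij (blinfun_apply (f' (g y)))"
    have hom: "\<forall>z\<in>U'. g (\<Phi> z) = z" "g ` V = U'" "\<forall>y\<in>V. \<Phi> (g y) = y"
      using *(6) by (auto simp: homeomorphism_def)
    have gU: "g y \<in> U'" if "y \<in> V" for y
      using hom(2) that by blast
    have lin: "g' y (cscale c h) = cscale c (g' y h)" if y: "y \<in> V" for y c h
    proof -
      have gy: "g y \<in> ?U" by (rule subsetD[OF *(2) gU[OF y]])
      then have ngy: "norm (g y) < \<delta>" by simp
      have b: "bij (\<Phi>' (g y))" using *(9)[OF y] unfolding f'[OF gy] .
      have g': "g' y = inv (\<Phi>' (g y))" using *(8)[OF y] unfolding f'[OF gy] .
      have "\<Phi>' (g y) (cscale c (g' y h)) = cscale c (\<Phi>' (g y) (g' y h))"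
        by (rule \<Phi>'_cscale[OF ngy])
      also have "\<Phi>' (g y) (g' y h) = h"
        unfolding g' by (rule surj_f_inv_f[OF bij_is_surj[OF b]])
      finally have "cscale c h = \<Phi>' (g y) (cscale c (g' y h))" by (rule sym)
      then have "inv (\<Phi>' (g y)) (cscale c h) = cscale c (g' y h)"
        by (rule inv_f_eq[OF bij_is_inj[OF b], OF sym])
      then show ?thesis unfolding g' .
    qed
    have sub: "U' \<subseteq> ball 0 \<delta> \<inter> {z. D last_dir z \<noteq> 0}" using *(2) by blast
    show ?thesis
    proof (intro exI conjI)
      show "\<forall>y\<in>V. g y \<in> U' \<and> \<Phi> (g y) = y" using gU hom(3) by blast
      show "\<forall>y\<in>V. (g has_derivative g' y) (at y) \<and> (\<forall>c h. g' y (cscale c h) = cscale c (g' y h))"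
        using *(7) lin by blast
    qed (rule * sub hom(1))+
  qed
qed

end

lemma real_analytic_on_cong:
  assumes "real_analytic_on A f" "open A" "\<And>x. x \<in> A \<Longrightarrow> f x = g x"
  shows "real_analytic_on A g"
  unfolding real_analytic_on_def
proof
  fix x assume x: "x \<in> A"
  obtain r c where r: "0 < r" and c: "\<forall>y\<in>ball x r.
      ((\<lambda>\<alpha>. c \<alpha> * (\<Prod>i\<in>UNIV. (y $ i - x $ i) ^ \<alpha> i)) has_sum f y) UNIV"
    using bspec[OF assms(1)[unfolded real_analytic_on_def] x] by auto
  obtain e where e: "0 < e" "ball x e \<subseteq> A" using openE[OF assms(2) x] by blast
  show "\<exists>r>0. \<exists>c. \<forall>y\<in>ball x r. ((\<lambda>\<alpha>. c \<alpha> * (\<Prod>i\<in>UNIV. (y $ i - x $ i) ^ \<alpha> i)) has_sum g y) UNIV"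
  proof (intro exI[of _ "min r e"] conjI exI[of _ c] ballI)
    show "0 < min r e" using r e(1) by simp
    fix y assume y: "y \<in> ball x (min r e)"
    then have "f y = g y" using e(2) by (intro assms(3)) auto
    moreover have "((\<lambda>\<alpha>. c \<alpha> * (\<Prod>i\<in>UNIV. (y $ i - x $ i) ^ \<alpha> i)) has_sum f y) UNIV"
      using c y by simp
    ultimately show "((\<lambda>\<alpha>. c \<alpha> * (\<Prod>i\<in>UNIV. (y $ i - x $ i) ^ \<alpha> i)) has_sum g y) UNIV" by simp
  qed
qed

text \<open>Take the affine minorant at the intermediate point and compare it with \<open>f\<close> at the two end points.\<close>

lemma strictly_convex_on_of_tangents:
  fixes f :: "'a::real_inner \<Rightarrow> real"
  assumes "convex A"
    and tangent: "\<And>x. x \<in> A \<Longrightarrow> \<exists>\<beta>. \<forall>y\<in>A. y \<noteq> x \<longrightarrow> f x + \<beta> \<bullet> (y - x) < f y"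
  shows "strictly_convex_on A f"
  unfolding strictly_convex_on_def
proof (intro conjI ballI allI impI assms(1))
  fix x y and t :: real assume *: "x \<in> A" "y \<in> A" "x \<noteq> y" "0 < t" "t < 1"
  let ?z = "(1 - t) *\<^sub>R x + t *\<^sub>R y"
  have z: "?z \<in> A" using * assms(1) by (intro convexD) auto
  have "x - ?z = t *\<^sub>R (x - y)" "y - ?z = (1 - t) *\<^sub>R (y - x)"
    by (simp_all add: algebra_simps)
  then have d: "x - ?z = t *\<^sub>R (x - y)" "y - ?z = (1 - t) *\<^sub>R (y - x)" "x \<noteq> ?z" "y \<noteq> ?z"
    using * by (metis eq_iff_diff_eq_0 less_irrefl scaleR_eq_0_iff)+
  obtain \<beta> where \<beta>: "\<forall>y\<in>A. y \<noteq> ?z \<longrightarrow> f ?z + \<beta> \<bullet> (y - ?z) < f y" using tangent[OF z] by blast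
  have "f ?z + \<beta> \<bullet> (x - ?z) < f x" "f ?z + \<beta> \<bullet> (y - ?z) < f y" using \<beta> * d by auto
  then have "(1 - t) * (f ?z + \<beta> \<bullet> (x - ?z)) + t * (f ?z + \<beta> \<bullet> (y - ?z)) < (1 - t) * f x + t * f y"
    using * by (intro add_strict_mono mult_strict_left_mono) auto
  also have "(1 - t) * (f ?z + \<beta> \<bullet> (x - ?z)) + t * (f ?z + \<beta> \<bullet> (y - ?z)) = f ?z"
    unfolding d(1,2) by (simp add: inner_diff_right algebra_simps)
  finally show "f ?z < (1 - t) * f x + t * f y" .
qed

section \<open>Paths, surviving break points and a Lyapunov function\<close>

definition step_lists :: "'v set \<Rightarrow> nat \<Rightarrow> 'v list set" where
  "step_lists U n = {ss. set ss \<subseteq> U \<and> length ss = n}"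

lemma finite_step_lists: "finite U \<Longrightarrow> finite (step_lists U n)"
  unfolding step_lists_def by (rule finite_lists_length_eq)

lemma step_lists_0 [simp]: "step_lists U 0 = {[]}"
  by (auto simp: step_lists_def)

lemma sum_step_lists_snoc:
  "(\<Sum>ss\<in>step_lists U (Suc n). F ss) = (\<Sum>ss\<in>step_lists U n. \<Sum>s\<in>U. F (ss @ [s]))"
proof -
  have "(\<Sum>ss\<in>step_lists U n. \<Sum>s\<in>U. F (ss @ [s])) = (\<Sum>(ss, s)\<in>step_lists U n \<times> U. F (ss @ [s]))"
    by (rule sum.cartesian_product)
  also have "\<dots> = (\<Sum>ss\<in>step_lists U (Suc n). F ss)"
  proof (rule sum.reindex_bij_witness[where i="\<lambda>ss. (butlast ss, last ss)" and j="\<lambda>(ss, s). ss @ [s]"])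
    fix ss assume ss: "ss \<in> step_lists U (Suc n)"
    then have "ss \<noteq> []" by (auto simp: step_lists_def)
    then show "(case (butlast ss, last ss) of (ss, s) \<Rightarrow> ss @ [s]) = ss" by simp
    show "(butlast ss, last ss) \<in> step_lists U n \<times> U"
      using ss \<open>ss \<noteq> []\<close> by (auto simp: step_lists_def dest: in_set_butlastD last_in_set)
  qed (auto simp: step_lists_def)
  finally show ?thesis by simp
qed

text \<open>One step of an automaton that reads the height increments \<open>\<xi>\<close> of a path. Its state consists of the
distance \<open>D\<close> of the current height from the maximum so far and, if there is a break point after time \<open>0\<close>,
of the height \<open>y\<close> gained since the first one. A strict record creates a break point when there is none;
falling below the height of the first break point destroys it together with all later ones.\<close>

fun scan_step :: "int \<Rightarrow> int \<times> int option \<Rightarrow> int \<times> int option" where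
  "scan_step \<xi> (D, None) = (if D < \<xi> then (0, Some 0) else (D - \<xi>, None))"
| "scan_step \<xi> (D, Some y) = (if y + \<xi> < 0 then (D - \<xi>, None) else (max 0 (D - \<xi>), Some (y + \<xi>)))"

locale height =
  fixes h :: "'v::ab_group_add \<Rightarrow> int"
  assumes h_add: "h (x + y) = h x + h y"
begin

lemma h_0 [simp]: "h 0 = 0"
  using h_add[of 0 0] by simp

definition scan :: "'v list \<Rightarrow> int \<times> int option" where
  "scan ss = foldl (\<lambda>st s. scan_step (h s) st) (0, None) ss"

definition forward :: "'v list \<Rightarrow> bool" where
  "forward ss \<longleftrightarrow> (\<forall>k\<le>length ss. 0 \<le> h (sum_list (take k ss)))"

text \<open>The end of the path is its first break point: no break point exists one step earlier, and the last
step reaches a strict record.\<close>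

definition breaking :: "'v list \<Rightarrow> bool" where
  "breaking ss \<longleftrightarrow> ss \<noteq> [] \<and> snd (scan (butlast ss)) = None \<and> fst (scan (butlast ss)) < h (last ss)"

lemma scan_Nil [simp]: "scan [] = (0, None)"
  by (simp add: scan_def)

lemma scan_snoc [simp]: "scan (ss @ [s]) = scan_step (h s) (scan ss)"
  by (simp add: scan_def)

lemma scan_invariant:
  "0 \<le> fst (scan ss) \<and> (\<forall>y. snd (scan ss) = Some y \<longrightarrow> 0 \<le> y) \<and>
   (\<forall>k\<le>length ss. h (sum_list (take k ss)) \<le> h (sum_list ss) + fst (scan ss))"
proof (induction ss rule: rev_induct)
  case Nil
  then show ?case by simp
next
  case (snoc s ss)
  obtain D o' where st: "scan ss = (D, o')" by (cases "scan ss")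
  have D: "0 \<le> D" "\<And>k. k \<le> length ss \<Longrightarrow> h (sum_list (take k ss)) \<le> h (sum_list ss) + D"
    "\<And>y. o' = Some y \<Longrightarrow> 0 \<le> y"
    using snoc.IH by (auto simp: st)
  have "0 \<le> fst (scan (ss @ [s])) \<and> (\<forall>y. snd (scan (ss @ [s])) = Some y \<longrightarrow> 0 \<le> y) \<and>
    D - h s \<le> fst (scan (ss @ [s]))"
    using D(1) D(3) by (cases o') (auto simp: st)
  moreover have "h (sum_list (take k (ss @ [s]))) \<le> h (sum_list (ss @ [s])) + f"
    if "k \<le> length (ss @ [s])" "0 \<le> f" "D - h s \<le> f" for k f
  proof (cases "k \<le> length ss")
    case True
    then show ?thesis using D(2)[OF True] that by (simp add: h_add)
  next
    case False
    then show ?thesis using that by simp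
  qed
  ultimately show ?case by blast
qed

lemma forward_Nil [simp]: "forward []"
  by (simp add: forward_def)

lemma forward_appendD: "forward (us @ vs) \<Longrightarrow> forward us"
  unfolding forward_def
proof (intro allI impI)
  fix k assume *: "\<forall>k\<le>length (us @ vs). 0 \<le> h (sum_list (take k (us @ vs)))" "k \<le> length us"
  then have "0 \<le> h (sum_list (take k (us @ vs)))" by (simp del: take_append)
  then show "0 \<le> h (sum_list (take k us))" using *(2) by simp
qed

lemma forward_sum: "forward us \<Longrightarrow> 0 \<le> h (sum_list us)"
  unfolding forward_def by (metis order_refl take_all)

lemma forward_append:
  assumes "forward us" "forward vs"
  shows "forward (us @ vs)"
  unfolding forward_def
proof (intro allI impI)
  fix k assume k: "k \<le> length (us @ vs)"
  show "0 \<le> h (sum_list (take k (us @ vs)))"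
  proof (cases "k \<le> length us")
    case True
    then show ?thesis using assms(1) by (simp add: forward_def)
  next
    case False
    then have "0 \<le> h (sum_list (take (k - length us) vs))"
      using assms(2) k by (simp add: forward_def)
    then show ?thesis using False forward_sum[OF assms(1)] by (simp add: h_add)
  qed
qed

lemma scan_breaking: "breaking us \<Longrightarrow> scan us = (0, Some 0)"
proof -
  assume "breaking us"
  then have *: "us \<noteq> []" "snd (scan (butlast us)) = None" "fst (scan (butlast us)) < h (last us)"
    by (auto simp: breaking_def)
  then have "scan (butlast us @ [last us]) = (0, Some 0)"
    unfolding scan_snoc by (cases "scan (butlast us)") auto
  then show ?thesis using *(1) by simp
qed

lemma scan_breaking_forward:
  assumes "breaking us" "forward vs"
  shows "snd (scan (us @ vs)) = Some (h (sum_list vs))"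
  using assms(2)
proof (induction vs rule: rev_induct)
  case Nil
  then show ?case using scan_breaking[OF assms(1)] by simp
next
  case (snoc v vs)
  have "snd (scan (us @ vs)) = Some (h (sum_list vs))"
    using snoc.IH forward_appendD[OF snoc.prems] by blast
  moreover have "0 \<le> h (sum_list vs) + h v" using forward_sum[OF snoc.prems] by (simp add: h_add)
  ultimately show ?case
    unfolding append_assoc[symmetric] scan_snoc by (cases "scan (us @ vs)") (auto simp: h_add)
qed

lemma breaking_forward_decomposition:
  assumes "snd (scan ss) = Some y"
  shows "\<exists>us vs. ss = us @ vs \<and> breaking us \<and> forward vs \<and> y = h (sum_list vs)"
  using assms
proof (induction ss arbitrary: y rule: rev_induct)
  case Nil
  then show ?case by simp
next
  case (snoc s ss)
  show ?case
  proof (cases "snd (scan ss)")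
    case None
    then have "breaking (ss @ [s])" "y = 0"
      using snoc.prems by (cases "scan ss"; auto simp: breaking_def split: if_splits)+
    then show ?thesis by (intro exI[of _ "ss @ [s]"] exI[of _ "[]"]) auto
  next
    case (Some z)
    from snoc.IH[OF Some] obtain us vs where *: "ss = us @ vs" "breaking us" "forward vs" "z = h (sum_list vs)"
      by blast
    have y: "y = z + h s" "0 \<le> y"
      using snoc.prems Some by (cases "scan ss"; auto split: if_splits)+
    have "forward (vs @ [s])"
      unfolding forward_def
    proof (intro allI impI)
      fix k assume "k \<le> length (vs @ [s])"
      then show "0 \<le> h (sum_list (take k (vs @ [s])))"
        using *(3,4) y by (cases "k \<le> length vs") (auto simp: forward_def h_add)
    qed
    then show ?thesis using * y by (intro exI[of _ us] exI[of _ "vs @ [s]"]) (auto simp: h_add)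
  qed
qed

text \<open>If \<open>us\<close> were shorter, then just before the end of \<open>us'\<close> the automaton would still hold the break point at
the end of \<open>us\<close>, contrary to \<open>breaking us'\<close>.\<close>

lemma breaking_forward_unique_aux:
  assumes "us @ vs = us' @ vs'" "breaking us" "breaking us'" "forward vs"
  shows "length us' \<le> length us"
proof (rule ccontr)
  assume "\<not> length us' \<le> length us"
  then obtain ws where ws: "us' = us @ ws" "vs = ws @ vs'" "ws \<noteq> []"
    using assms(1) by (auto simp: append_eq_append_conv2)
  then have "vs = butlast ws @ (last ws # vs')" by (simp add: ws(2))
  then have "forward (butlast ws)" using forward_appendD assms(4) by metis
  then have "snd (scan (us @ butlast ws)) \<noteq> None"
    using scan_breaking_forward[OF assms(2)] by simp
  moreover have "us @ butlast ws = butlast us'" using ws by (simp add: butlast_append)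
  ultimately show False using assms(3) by (simp add: breaking_def)
qed

lemma breaking_forward_unique:
  assumes "us @ vs = us' @ vs'" "breaking us" "breaking us'" "forward vs" "forward vs'"
  shows "us = us' \<and> vs = vs'"
  using breaking_forward_unique_aux[OF assms(1-4)] breaking_forward_unique_aux[OF assms(1)[symmetric] assms(3,2,5)]
    assms(1) by (simp add: append_eq_append_conv)

text \<open>The distance to the maximum, which the automaton records, is smaller than the last increment.\<close>

lemma breaking_height_less:
  assumes "breaking us" "k < length us"
  shows "h (sum_list (take k us)) < h (sum_list us)"
proof -
  have *: "us \<noteq> []" "fst (scan (butlast us)) < h (last us)"
    using assms(1) by (auto simp: breaking_def)
  have "h (sum_list (take k (butlast us))) \<le> h (sum_list (butlast us)) + fst (scan (butlast us))"
    using scan_invariant[of "butlast us"] assms(2) by auto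
  also have "\<dots> < h (sum_list (butlast us)) + h (last us)" using *(2) by simp
  also have "\<dots> = h (sum_list (butlast us @ [last us]))" by (simp only: sum_list_append h_add) simp
  also have "butlast us @ [last us] = us" using *(1) by simp
  also have "take k (butlast us) = take k us"
    using assms(2) by (simp add: butlast_conv_take)
  finally show ?thesis .
qed

text \<open>Cutting at the first break point is a bijection onto the pairs of a breaking and a forward path. The
predicate \<open>Q\<close> allows the same decomposition for all paths and for the forward ones.\<close>

lemma sum_first_break:
  fixes F :: "'v list \<Rightarrow> 'b::comm_monoid_add"
  assumes U: "finite U" and Q: "\<And>us vs. breaking us \<Longrightarrow> forward vs \<Longrightarrow> Q (us @ vs) \<longleftrightarrow> Q us"
  shows "(\<Sum>ss | ss \<in> step_lists U n \<and> snd (scan ss) \<noteq> None \<and> Q ss. F ss) =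
    (\<Sum>j\<le>n. \<Sum>us | us \<in> step_lists U j \<and> breaking us \<and> Q us.
       \<Sum>vs | vs \<in> step_lists U (n - j) \<and> forward vs. F (us @ vs))"
proof -
  let ?A = "\<lambda>j. {us. us \<in> step_lists U j \<and> breaking us \<and> Q us}"
  let ?B = "\<lambda>j. {vs. vs \<in> step_lists U (n - j) \<and> forward vs}"
  let ?I = "SIGMA j:{..n}. ?A j \<times> ?B j"
  have fin: "finite (?A j)" "finite (?B j)" for j
    using finite_step_lists[OF U] by auto
  have "(\<Sum>j\<le>n. \<Sum>us\<in>?A j. \<Sum>vs\<in>?B j. F (us @ vs)) = (\<Sum>j\<le>n. \<Sum>(us, vs)\<in>?A j \<times> ?B j. F (us @ vs))"
    by (simp only: sum.cartesian_product)
  also have "\<dots> = (\<Sum>(j, us, vs)\<in>?I. F (us @ vs))"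
    by (subst sum.Sigma) (auto simp: fin split_def)
  also have "\<dots> = (\<Sum>ss | ss \<in> step_lists U n \<and> snd (scan ss) \<noteq> None \<and> Q ss. F ss)"
  proof -
    have "bij_betw (\<lambda>x. fst (snd x) @ snd (snd x)) ?I {ss. ss \<in> step_lists U n \<and> snd (scan ss) \<noteq> None \<and> Q ss}"
    proof (rule bij_betw_imageI)
      show "inj_on (\<lambda>x. fst (snd x) @ snd (snd x)) ?I"
      proof (rule inj_onI)
        fix x y assume *: "x \<in> ?I" "y \<in> ?I" "fst (snd x) @ snd (snd x) = fst (snd y) @ snd (snd y)"
        obtain i us vs j us' vs' where xy: "x = (i, us, vs)" "y = (j, us', vs')"
          by (metis prod.exhaust)
        have "us = us' \<and> vs = vs'"
          using * by (intro breaking_forward_unique) (auto simp: xy)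
        then show "x = y" using * by (auto simp: xy step_lists_def)
      qed
      show "(\<lambda>x. fst (snd x) @ snd (snd x)) ` ?I = {ss. ss \<in> step_lists U n \<and> snd (scan ss) \<noteq> None \<and> Q ss}"
      proof (intro equalityI subsetI)
        fix ss assume "ss \<in> (\<lambda>x. fst (snd x) @ snd (snd x)) ` ?I"
        then obtain j us vs where *: "ss = us @ vs" "j \<le> n" "us \<in> ?A j" "vs \<in> ?B j" by auto
        then show "ss \<in> {ss. ss \<in> step_lists U n \<and> snd (scan ss) \<noteq> None \<and> Q ss}"
          using scan_breaking_forward[of us vs] Q[of us vs] by (auto simp: step_lists_def)
      next
        fix ss assume ss: "ss \<in> {ss. ss \<in> step_lists U n \<and> snd (scan ss) \<noteq> None \<and> Q ss}"
        then obtain y where "snd (scan ss) = Some y" by auto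
        from breaking_forward_decomposition[OF this] obtain us vs where
          *: "ss = us @ vs" "breaking us" "forward vs" by blast
        then have "(length us, us, vs) \<in> ?I"
          using ss Q[of us vs] by (auto simp: step_lists_def)
        from imageI[OF this, of "\<lambda>x. fst (snd x) @ snd (snd x)"]
        show "ss \<in> (\<lambda>x. fst (snd x) @ snd (snd x)) ` ?I"
          unfolding *(1) fst_conv snd_conv .
      qed
    qed
    from sum.reindex_bij_betw[OF this, of F] show ?thesis by (simp add: split_def)
  qed
  finally show ?thesis by simp
qed

end

lemma exp_le_quadratic:
  fixes u :: real
  assumes "u \<le> 1/2"
  shows "exp u \<le> 1 + u + 2 * u^2"
proof -
  have "1 - u \<le> exp (- u)" using exp_ge_add_one_self[of "-u"] by simp
  then have "exp u \<le> 1 / (1 - u)"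
    using assms by (simp add: exp_minus field_simps)
  also have "\<dots> \<le> 1 + u + 2 * u^2"
  proof -
    have "(1 + u + 2 * u^2) * (1 - u) = 1 + u^2 * (1 - 2 * u)"
      by (simp add: algebra_simps power2_eq_square)
    then have "1 \<le> (1 + u + 2 * u^2) * (1 - u)" using assms by simp
    then show ?thesis using assms by (simp add: field_simps)
  qed
  finally show ?thesis .
qed

text \<open>The factor \<open>exp (a * D)\<close> penalises the distance from the maximum, which has to be regained before a break
point can be created. In the presence of a break point the factor \<open>exp (- \<theta> * (y + 1))\<close> measures the chance
of losing it. The \<open>+ 1\<close> makes the function consistent across both transitions: losing the break point needs
\<open>y \<le> - 1\<close>, where the factor is at least \<open>1\<close>, while creating one lowers the value from at least \<open>1\<close> to \<open>exp (- \<theta>)\<close>.\<close>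

definition lyapunov :: "real \<Rightarrow> real \<Rightarrow> int \<times> int option \<Rightarrow> real" where
  "lyapunov a \<theta> st = (case snd st of None \<Rightarrow> exp (a * real_of_int (fst st))
     | Some y \<Rightarrow> exp (a * real_of_int (fst st) - \<theta> * (real_of_int y + 1)))"

lemma lyapunov_step:
  assumes "0 \<le> a" "0 \<le> \<theta>" "0 \<le> D"
  shows "lyapunov a \<theta> (scan_step x (D, Some y)) \<le>
    exp (a * max 0 (- real_of_int x) - \<theta> * real_of_int x) * lyapunov a \<theta> (D, Some y)"
proof -
  define M where "M = max 0 (- real_of_int x)"
  have M: "real_of_int D - real_of_int x \<le> M + real_of_int D" "0 \<le> M + real_of_int D"
    "real_of_int (max 0 (D - x)) \<le> M + real_of_int D"
    using assms(3) by (auto simp: M_def)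
  have eq: "exp (a * M - \<theta> * real_of_int x) * lyapunov a \<theta> (D, Some y) =
      exp (a * (M + real_of_int D) - \<theta> * (real_of_int y + real_of_int x + 1))"
    by (simp add: lyapunov_def exp_add[symmetric] algebra_simps)
  have "lyapunov a \<theta> (scan_step x (D, Some y)) \<le> \<dots>"
  proof (cases "y + x < 0")
    case True
    then have "real_of_int y + real_of_int x + 1 \<le> 0" by linarith
    then have "\<theta> * (real_of_int y + real_of_int x + 1) \<le> 0"
      using assms(2) by (simp add: mult_nonneg_nonpos)
    moreover have "a * (real_of_int D - real_of_int x) \<le> a * (M + real_of_int D)"
      using M(1) assms(1) by (rule mult_left_mono)
    moreover have "lyapunov a \<theta> (scan_step x (D, Some y)) = exp (a * (real_of_int D - real_of_int x))"
      using True by (simp add: lyapunov_def)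
    ultimately show ?thesis by simp
  next
    case False
    then have "lyapunov a \<theta> (scan_step x (D, Some y)) =
        exp (a * real_of_int (max 0 (D - x)) - \<theta> * (real_of_int y + real_of_int x + 1))"
      by (simp add: lyapunov_def del: of_int_max)
    moreover have "a * real_of_int (max 0 (D - x)) \<le> a * (M + real_of_int D)"
      using M(3) assms(1) by (rule mult_left_mono)
    ultimately show ?thesis by simp
  qed
  then show ?thesis unfolding M_def[symmetric] eq .
qed

text \<open>Both \<open>exp (- a * \<xi>)\<close> and \<open>exp (a * max 0 (- \<xi>) - \<theta> * \<xi>)\<close> have mean at most \<open>1 - a / 2\<close>, by the quadratic bound on
\<open>exp\<close>: the drift wins against the second order terms since \<open>\<theta> * K\<^sup>2\<close> is small, and against the term in
\<open>a\<close> since \<open>a * K = \<theta> / 2\<close>. The latter choice also makes the creation of a break point by a large jump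
harmless.\<close>

lemma lyapunov_contraction:
  fixes p :: "'s \<Rightarrow> real" and \<xi> :: "'s \<Rightarrow> int" and K :: real
  assumes U: "finite U" and p0: "\<And>s. s \<in> U \<Longrightarrow> 0 \<le> p s" and p1: "(\<Sum>s\<in>U. p s) = 1"
    and drift: "1 \<le> (\<Sum>s\<in>U. p s * real_of_int (\<xi> s))"
    and K: "1 \<le> K" and \<xi>K: "\<And>s. s \<in> U \<Longrightarrow> \<bar>real_of_int (\<xi> s)\<bar> \<le> K"
    and \<theta>: "\<theta> = 1 / (32 * K^2)" and a: "a = \<theta> / (2 * K)"
    and st: "0 \<le> fst st" "\<And>y. snd st = Some y \<Longrightarrow> 0 \<le> y"
  shows "(\<Sum>s\<in>U. p s * lyapunov a \<theta> (scan_step (\<xi> s) st)) \<le> (1 - a / 2) * lyapunov a \<theta> st"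
proof -
  have \<theta>0: "0 < \<theta>" using K by (simp add: \<theta>)
  have a0: "0 < a" using K \<theta>0 by (simp add: a)
  have aK: "a * K = \<theta> / 2" using K by (simp add: a)
  have \<theta>K: "\<theta> * K^2 = 1 / 32" using K by (simp add: \<theta>)
  have a\<theta>: "a \<le> \<theta> / 2" using mult_left_mono[OF K less_imp_le[OF a0]] aK by simp
  have \<theta>K1: "\<theta> * K \<le> 1 / 32"
  proof -
    have "K * 1 \<le> K * K" using K by (intro mult_left_mono) auto
    then have "K \<le> K^2" by (simp add: power2_eq_square)
    then have "\<theta> * K \<le> \<theta> * K^2" using \<theta>0 by (intro mult_left_mono) auto
    then show ?thesis using \<theta>K by simp
  qed
  have mean: "(\<Sum>s\<in>U. p s * exp (u s)) \<le> 1 - a / 2"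
    if u: "\<And>s. s \<in> U \<Longrightarrow> u s \<le> c - b * real_of_int (\<xi> s) \<and> \<bar>u s\<bar> \<le> B * K" and b: "0 \<le> b" "0 \<le> B" "B * K \<le> 1/2"
      and le: "c - b + 2 * (B * K)^2 \<le> - a / 2" for u c b B
  proof -
    have "(\<Sum>s\<in>U. p s * exp (u s)) \<le> (\<Sum>s\<in>U. p s * ((1 + c + 2 * (B * K)^2) - b * real_of_int (\<xi> s)))"
    proof (intro sum_mono mult_left_mono p0)
      fix s assume s: "s \<in> U"
      have "exp (u s) \<le> 1 + u s + 2 * (u s)^2" using u[OF s] b by (intro exp_le_quadratic) auto
      moreover have "(u s)^2 \<le> (B * K)^2" 
        using power_mono[of "\<bar>u s\<bar>" "B * K" 2] u[OF s] by simp
      ultimately show "exp (u s) \<le> (1 + c + 2 * (B * K)^2) - b * real_of_int (\<xi> s)"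
        using u[OF s] by linarith
    qed
    also have "\<dots> = (1 + c + 2 * (B * K)^2) * (\<Sum>s\<in>U. p s) - b * (\<Sum>s\<in>U. p s * real_of_int (\<xi> s))"
      by (simp add: right_diff_distrib sum_subtractf sum_distrib_left sum_distrib_right mult_ac)
    also have "\<dots> \<le> (1 + c + 2 * (B * K)^2) - b"
      using mult_left_mono[OF drift b(1)] by (simp add: p1)
    finally show ?thesis using le by linarith
  qed
  obtain D o' where st_eq: "st = (D, o')" by (cases st)
  have D: "0 \<le> D" using st(1) by (simp add: st_eq)
  show ?thesis
  proof (cases o')
    case None
    have "(\<Sum>s\<in>U. p s * lyapunov a \<theta> (scan_step (\<xi> s) st)) \<le> (\<Sum>s\<in>U. p s * exp (- a * real_of_int (\<xi> s))) * exp (a * real_of_int D)"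
      unfolding sum_distrib_right mult.assoc
    proof (intro sum_mono mult_left_mono p0)
      fix s assume s: "s \<in> U"
      have "a * real_of_int (\<xi> s) - a * real_of_int D \<le> a * K"
        using \<xi>K[OF s] D a0 by (simp add: right_diff_distrib[symmetric])
      then have "a * real_of_int (\<xi> s) - a * real_of_int D \<le> \<theta>" using aK \<theta>0 by linarith
      then show "lyapunov a \<theta> (scan_step (\<xi> s) st) \<le> exp (- a * real_of_int (\<xi> s)) * exp (a * real_of_int D)"
        by (simp add: lyapunov_def st_eq None exp_add[symmetric] right_diff_distrib)
    qed
    also have "\<dots> \<le> (1 - a / 2) * exp (a * real_of_int D)"
    proof (rule mult_right_mono)
      show "(\<Sum>s\<in>U. p s * exp (- a * real_of_int (\<xi> s))) \<le> 1 - a / 2"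
      proof (rule mean[where c=0 and b=a and B=a])
        show "- a * real_of_int (\<xi> s) \<le> 0 - a * real_of_int (\<xi> s) \<and> \<bar>- a * real_of_int (\<xi> s)\<bar> \<le> a * K"
          if s: "s \<in> U" for s
          using \<xi>K[OF s] a0 by (simp add: abs_mult)
        have "(a * K)^2 = a * (\<theta> / 2 * K)" unfolding power2_eq_square using aK by (simp add: mult_ac)
        also have "\<dots> \<le> a * (1/64)" using \<theta>K1 a0 by (intro mult_left_mono) (auto simp: mult.commute)
        finally show "0 - a + 2 * (a * K)^2 \<le> - a / 2" using a0 by simp
        show "a * K \<le> 1/2" using aK \<theta>K1 mult_left_mono[OF K less_imp_le[OF \<theta>0]] by simp
      qed (use a0 in auto)
    qed simp
    also have "exp (a * real_of_int D) = lyapunov a \<theta> st"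
      by (simp add: lyapunov_def st_eq None)
    finally show ?thesis .
  next
    case (Some y)
    have y: "0 \<le> y" using st(2) by (simp add: st_eq Some)
    let ?V = "lyapunov a \<theta> st"
    have "(\<Sum>s\<in>U. p s * lyapunov a \<theta> (scan_step (\<xi> s) st)) \<le>
      (\<Sum>s\<in>U. p s * exp (a * max 0 (- real_of_int (\<xi> s)) - \<theta> * real_of_int (\<xi> s))) * ?V"
      unfolding sum_distrib_right mult.assoc
    proof (rule sum_mono)
      fix s assume s: "s \<in> U"
      have "lyapunov a \<theta> (scan_step (\<xi> s) st) \<le> exp (a * max 0 (- real_of_int (\<xi> s)) - \<theta> * real_of_int (\<xi> s)) * ?V"
        unfolding st_eq Some by (rule lyapunov_step) (use a0 \<theta>0 D in auto)
      then show "p s * lyapunov a \<theta> (scan_step (\<xi> s) st) \<le> p s * (exp (a * max 0 (- real_of_int (\<xi> s)) - \<theta> * real_of_int (\<xi> s)) * ?V)"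
        by (rule mult_left_mono[OF _ p0[OF s]])
    qed
    also have "\<dots> \<le> (1 - a / 2) * ?V"
    proof (rule mult_right_mono)
      show "(\<Sum>s\<in>U. p s * exp (a * max 0 (- real_of_int (\<xi> s)) - \<theta> * real_of_int (\<xi> s))) \<le> 1 - a / 2"
      proof (rule mean[where c="a * K" and b=\<theta> and B="a + \<theta>"])
        fix s assume s: "s \<in> U"
        have x: "\<bar>real_of_int (\<xi> s)\<bar> \<le> K" using \<xi>K[OF s] .
        have 1: "0 \<le> a * max 0 (- real_of_int (\<xi> s))" "a * max 0 (- real_of_int (\<xi> s)) \<le> a * K"
          using a0 x by (auto intro!: mult_left_mono mult_nonneg_nonneg)
        have "\<bar>\<theta> * real_of_int (\<xi> s)\<bar> \<le> \<theta> * K" using x \<theta>0 by (simp add: abs_mult)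
        then show "a * max 0 (- real_of_int (\<xi> s)) - \<theta> * real_of_int (\<xi> s) \<le> a * K - \<theta> * real_of_int (\<xi> s)
         \<and> \<bar>a * max 0 (- real_of_int (\<xi> s)) - \<theta> * real_of_int (\<xi> s)\<bar> \<le> (a + \<theta>) * K"
          using 1 unfolding distrib_right by linarith
      next
        have le: "(a + \<theta>) * K \<le> (2 * \<theta>) * K" using a\<theta> K \<theta>0 by (intro mult_right_mono) auto
        then show "(a + \<theta>) * K \<le> 1 / 2" using \<theta>K1 by linarith
        have "((a + \<theta>) * K)^2 \<le> ((2 * \<theta>) * K)^2" using le a0 \<theta>0 K by (intro power_mono) auto
        also have "\<dots> = 4 * \<theta> * (\<theta> * K^2)" by (simp add: power2_eq_square)
        finally have "((a + \<theta>) * K)^2 \<le> \<theta> / 8" by (simp add: \<theta>K)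
        then show "a * K - \<theta> + 2 * ((a + \<theta>) * K)^2 \<le> - a / 2"
          using aK a\<theta> by linarith
      qed (use a0 \<theta>0 in auto)
      show "0 \<le> ?V" by (simp add: lyapunov_def st_eq Some)
    qed
    finally show ?thesis .
  qed
qed

section \<open>Quenched and annealed path weights\<close>

lemma norm_unit_step_coord:
  fixes x :: "int ^ 'd::finite"
  assumes "x \<in> unit_steps"
  shows "\<bar>x $ i\<bar> \<le> 1"
proof -
  have "\<bar>real_vec x $ i\<bar> \<le> norm (real_vec x)" by (rule component_le_norm_cart)
  then show ?thesis using assms by (simp add: unit_steps_def real_vec_def)
qed

lemma finite_unit_steps: "finite (unit_steps :: (int ^ 'd::finite) set)"
proof (rule finite_subset)
  show "(unit_steps :: (int ^ 'd) set) \<subseteq> vec_lambda ` (PiE UNIV (\<lambda>_. {-1..1}))"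
  proof
    fix x :: "int ^ 'd" assume "x \<in> unit_steps"
    then have "(\<lambda>i. x $ i) \<in> PiE UNIV (\<lambda>_. {-1..1})"
      using norm_unit_step_coord[of x] by (auto simp: abs_le_iff)
    moreover have "x = vec_lambda (\<lambda>i. x $ i)" by simp
    ultimately show "x \<in> vec_lambda ` (PiE UNIV (\<lambda>_. {-1..1}))" by blast
  qed
qed (intro finite_imageI finite_PiE, auto)

lemma real_vec_add: "real_vec (x + y) = real_vec x + real_vec y"
  by (simp add: real_vec_def vec_eq_iff)

lemma real_vec_0 [simp]: "real_vec 0 = 0"
  by (simp add: real_vec_def vec_eq_iff)

lemma norm_real_vec_sum_list:
  "ss \<in> step_lists unit_steps n \<Longrightarrow> norm (real_vec (sum_list ss)) \<le> real n"
proof (induction ss arbitrary: n)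
  case (Cons s ss)
  then obtain m where m: "n = Suc m" "ss \<in> step_lists unit_steps m" "s \<in> unit_steps"
    by (cases n) (auto simp: step_lists_def)
  have "norm (real_vec (sum_list (s # ss))) \<le> norm (real_vec s) + norm (real_vec (sum_list ss))"
    by (simp add: real_vec_add norm_triangle_ineq)
  then show ?case using Cons.IH[OF m(2)] m by (simp add: unit_steps_def)
qed (simp add: step_lists_def)

lemma real_vec_axis: "real_vec (axis i c) = axis i (real_of_int c)"
  by (simp add: real_vec_def axis_def vec_eq_iff)

lemma axis_unit_step: "axis i 1 \<in> unit_steps" "axis i (- 1) \<in> unit_steps"
  by (simp_all add: unit_steps_def real_vec_axis norm_eq_sqrt_inner inner_axis_axis)

primrec qweight :: "'d::finite env \<Rightarrow> int ^ 'd \<Rightarrow> (int ^ 'd) list \<Rightarrow> real" where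
  "qweight \<omega> x [] = 1"
| "qweight \<omega> x (s # ss) = measure (\<omega> x) {s} * qweight \<omega> (x + s) ss"

lemma qweight_append: "qweight \<omega> x (ss @ ts) = qweight \<omega> x ss * qweight \<omega> (x + sum_list ss) ts"
  by (induction ss arbitrary: x) (auto simp: add.assoc)

lemma qweight_nonneg: "0 \<le> qweight \<omega> x ss"
  by (induction ss arbitrary: x) auto

lemma sum_site_weights:
  fixes \<omega> :: "'d::finite env"
  assumes "\<omega> \<in> space env_space"
  shows "(\<Sum>s\<in>unit_steps. measure (\<omega> x) {s}) = 1"
proof -
  interpret prob_space "\<omega> x" by (rule sets_env_site(3)[OF assms])
  have "(\<Sum>s\<in>unit_steps. measure (\<omega> x) {s}) = measure (\<omega> x) unit_steps"
    by (rule finite_measure_eq_sum_singleton[symmetric])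
      (auto simp: finite_unit_steps sets_env_site(1)[OF assms])
  also have "\<dots> = 1" using prob_space sets_env_site(2)[OF assms] by metis
  finally show ?thesis .
qed

lemma sum_qweight:
  fixes \<omega> :: "'d::finite env"
  assumes "\<omega> \<in> space env_space"
  shows "(\<Sum>ss\<in>step_lists unit_steps n. qweight \<omega> x ss) = 1"
proof (induction n)
  case (Suc n)
  have "(\<Sum>ss\<in>step_lists unit_steps (Suc n). qweight \<omega> x ss) =
      (\<Sum>ss\<in>step_lists unit_steps n. qweight \<omega> x ss * (\<Sum>s\<in>unit_steps. measure (\<omega> (x + sum_list ss)) {s}))"
    by (simp add: sum_step_lists_snoc qweight_append sum_distrib_left)
  then show ?case by (simp add: sum_site_weights[OF assms] Suc.IH)
qed simp

lemma qweight_le_1: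
  fixes \<omega> :: "'d::finite env"
  assumes "\<omega> \<in> space env_space"
  shows "qweight \<omega> x ss \<le> 1"
proof (induction ss arbitrary: x)
  case (Cons s ss)
  interpret prob_space "\<omega> x" by (rule sets_env_site(3)[OF assms])
  show ?case using Cons.IH[of "x + s"] by (auto intro!: mult_le_one qweight_nonneg)
qed simp

lemma sets_cylinder: "{X :: 'd::finite path. \<forall>i\<le>n. X i = x i} \<in> sets path_space"
proof -
  have "{X. \<forall>i\<le>n. X i = x i} = (\<Pi>\<^sub>E i\<in>UNIV. if i \<le> n then {x i} else UNIV)"
    by (auto simp: PiE_def Pi_def split: if_splits)
  also have "\<dots> = prod_emb UNIV (\<lambda>_. count_space UNIV) {..n} (\<Pi>\<^sub>E i\<in>{..n}. {x i})"
    by (subst prod_emb_PiE) (auto simp: PiE_def Pi_def split: if_splits)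
  also have "\<dots> \<in> sets path_space"
    unfolding path_space_def by (rule sets_PiM_I) auto
  finally show ?thesis .
qed

lemma space_path_space: "space path_space = (UNIV :: 'd::finite path set)"
  by (auto simp: path_space_def space_PiM)

lemma sets_position: "{X :: 'd::finite path. X n \<in> B} \<in> sets path_space"
proof -
  have "(\<lambda>X. X n) \<in> path_space \<rightarrow>\<^sub>M (count_space UNIV :: (int ^ 'd) measure)"
    unfolding path_space_def by (rule measurable_component_singleton) simp
  from measurable_sets[OF this, of B] show ?thesis
    by (simp add: space_path_space vimage_def)
qed

lemma qweight_conv_prod:
  "qweight \<omega> x ss = (\<Prod>i<length ss. measure (\<omega> (x + sum_list (take i ss))) {ss ! i})"
proof (induction ss arbitrary: x)
  case (Cons s ss)
  show ?case
    by (simp add: Cons.IH prod.lessThan_Suc_shift add.assoc del: prod.lessThan_Suc)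
qed simp

lemma sum_list_take_Suc:
  fixes ss :: "'v::monoid_add list"
  shows "i < length ss \<Longrightarrow> sum_list (take (Suc i) ss) = sum_list (take i ss) + ss ! i"
  by (simp add: take_Suc_conv_app_nth)

lemma measure_quenched_cylinder:
  fixes \<omega> :: "'d::finite env"
  assumes \<omega>: "\<omega> \<in> space env_space"
  shows "measure (quenched_law \<omega>) {X. \<forall>i\<le>length ss. X i = sum_list (take i ss)} = qweight \<omega> 0 ss"
proof -
  have "emeasure (quenched_law \<omega>) {X. \<forall>i\<le>length ss. X i = sum_list (take i ss)} =
    (\<Prod>i<length ss. emeasure (\<omega> (sum_list (take i ss))) {ss ! i})"
    using quenched_law_cylinder[OF \<omega>, of "length ss" "\<lambda>i. sum_list (take i ss)"]
    by (simp add: sum_list_take_Suc)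
  also have "\<dots> = (\<Prod>i<length ss. ennreal (measure (\<omega> (sum_list (take i ss))) {ss ! i}))"
  proof (intro prod.cong refl)
    fix i
    interpret prob_space "\<omega> (sum_list (take i ss))" by (rule sets_env_site(3)[OF \<omega>])
    show "emeasure (\<omega> (sum_list (take i ss))) {ss ! i} = ennreal (measure (\<omega> (sum_list (take i ss))) {ss ! i})"
      by (rule emeasure_eq_measure)
  qed
  also have "\<dots> = ennreal (qweight \<omega> 0 ss)"
    by (simp add: prod_ennreal qweight_conv_prod)
  finally show ?thesis by (simp add: measure_def qweight_nonneg)
qed

lemma disjoint_cylinders:
  fixes S :: "(int ^ 'd::finite) set"
  shows "disjoint_family_on (\<lambda>ss. {X. \<forall>i\<le>length ss. X i = sum_list (take i ss)}) (step_lists S n)"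
  unfolding disjoint_family_on_def
proof (intro ballI impI)
  fix ss ts :: "(int ^ 'd) list"
  assume *: "ss \<in> step_lists S n" "ts \<in> step_lists S n" "ss \<noteq> ts"
  show "{X. \<forall>i\<le>length ss. X i = sum_list (take i ss)} \<inter> {X. \<forall>i\<le>length ts. X i = sum_list (take i ts)} = {}"
  proof (rule ccontr)
    assume "\<not> ?thesis"
    then obtain X where "X \<in> {X. \<forall>i\<le>length ss. X i = sum_list (take i ss)}"
        "X \<in> {X. \<forall>i\<le>length ts. X i = sum_list (take i ts)}"
      by blast
    then have X: "\<And>i. i \<le> n \<Longrightarrow> X i = sum_list (take i ss)" "\<And>i. i \<le> n \<Longrightarrow> X i = sum_list (take i ts)"
      using * by (simp_all add: step_lists_def)
    have "ss = ts"
    proof (rule nth_equalityI)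
      show "length ss = length ts" using * by (simp add: step_lists_def)
      fix i assume i: "i < length ss"
      have len: "length ss = n" "length ts = n" using * by (auto simp: step_lists_def)
      have "ss ! i = X (Suc i) - X i"
        using X(1)[of i] X(1)[of "Suc i"] i len sum_list_take_Suc[of i ss] by simp
      moreover have "ts ! i = X (Suc i) - X i"
        using X(2)[of i] X(2)[of "Suc i"] i len sum_list_take_Suc[of i ts] by simp
      ultimately show "ss ! i = ts ! i" by simp
    qed
    then show False using * by simp
  qed
qed

text \<open>The cylinders of the nearest neighbour paths are disjoint and their weights add up to \<open>1\<close>, so the lower
bounds for an event and for its complement are both sharp.\<close>

lemma measure_quenched_position:
  fixes \<omega> :: "'d::finite env"
  assumes \<omega>: "\<omega> \<in> space env_space"
  shows "measure (quenched_law \<omega>) {X. X n \<in> B} =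
    (\<Sum>ss | ss \<in> step_lists unit_steps n \<and> sum_list ss \<in> B. qweight \<omega> 0 ss)"
proof -
  let ?Q = "quenched_law \<omega>"
  let ?C = "\<lambda>ss. {X. \<forall>i\<le>length ss. X i = sum_list (take i ss)}"
  let ?G = "\<lambda>B. {ss. ss \<in> step_lists unit_steps n \<and> sum_list ss \<in> B}"
  interpret prob_space ?Q by (rule quenched_law_prob(1)[OF \<omega>])
  have sets: "sets ?Q = sets path_space" by (rule quenched_law_prob(2)[OF \<omega>])
  have fin: "finite (?G B)" for B
    by (rule finite_subset[OF _ finite_step_lists[OF finite_unit_steps, of n]]) auto
  have le: "(\<Sum>ss\<in>?G B. qweight \<omega> 0 ss) \<le> measure ?Q {X. X n \<in> B}" for B
  proof -
    have "(\<Sum>ss\<in>?G B. qweight \<omega> 0 ss) = (\<Sum>ss\<in>?G B. measure ?Q (?C ss))"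
      by (simp add: measure_quenched_cylinder[OF \<omega>])
    also have "\<dots> = measure ?Q (\<Union>ss\<in>?G B. ?C ss)"
      by (rule finite_measure_finite_Union[symmetric])
        (auto simp: sets sets_cylinder fin intro!: disjoint_family_on_mono[OF _ disjoint_cylinders])
    also have "\<dots> \<le> measure ?Q {X. X n \<in> B}"
      by (rule finite_measure_mono) (auto simp: sets sets_position step_lists_def)
    finally show ?thesis .
  qed
  have "measure ?Q {X. X n \<in> B} + measure ?Q {X. X n \<in> - B} = measure ?Q ({X. X n \<in> B} \<union> {X. X n \<in> - B})"
    by (rule finite_measure_Union[symmetric]) (simp_all only: sets sets_position, auto)
  also have "{X. X n \<in> B} \<union> {X. X n \<in> - B} = space ?Q"
    using sets_eq_imp_space_eq[OF sets] by (auto simp: space_path_space)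
  also have "measure ?Q (space ?Q) = (\<Sum>ss\<in>step_lists unit_steps n. qweight \<omega> 0 ss)"
    by (simp add: prob_space sum_qweight[OF \<omega>])
  also have "\<dots> = (\<Sum>ss\<in>?G B. qweight \<omega> 0 ss) + (\<Sum>ss\<in>?G (- B). qweight \<omega> 0 ss)"
    by (subst sum.union_disjoint[OF fin fin, symmetric]) (auto intro!: sum.cong)
  finally show ?thesis using le[of B] le[of "- B"] by linarith
qed

lemma drift_eq:
  fixes \<omega> :: "'d::finite env"
  assumes \<omega>: "\<omega> \<in> space env_space"
  shows "drift \<omega> = (\<Sum>s\<in>unit_steps. measure (\<omega> 0) {s} *\<^sub>R real_vec s)"
proof -
  let ?Q = "quenched_law \<omega>"
  interpret prob_space ?Q by (rule quenched_law_prob(1)[OF \<omega>])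
  have sets: "sets ?Q = sets path_space" by (rule quenched_law_prob(2)[OF \<omega>])
  have step_lists_1: "step_lists S (Suc 0) = (\<lambda>s. [s]) ` S" for S :: "(int ^ 'd) set"
    by (auto simp: step_lists_def length_Suc_conv)
  have m: "measure ?Q {X. X 1 \<in> B} = (\<Sum>s\<in>unit_steps \<inter> B. measure (\<omega> 0) {s})" for B
  proof -
    have "{ss. ss \<in> step_lists unit_steps 1 \<and> sum_list ss \<in> B} = (\<lambda>s. [s]) ` (unit_steps \<inter> B)"
      by (auto simp: step_lists_1)
    then show ?thesis
      unfolding measure_quenched_position[OF \<omega>] by (simp add: sum.reindex inj_on_def)
  qed
  have "measure ?Q {X. X 1 \<in> unit_steps} = 1"
    unfolding m by (simp add: sum_site_weights[OF \<omega>])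
  then have ae: "AE X in ?Q. X 1 \<in> unit_steps"
    using prob_Collect_eq_1[of "\<lambda>X. X 1 \<in> unit_steps"] sets_position[of 1 unit_steps] sets_eq_imp_space_eq[OF sets]
    by (simp add: space_path_space sets)
  have "drift \<omega> = (\<integral>X. (\<Sum>s\<in>unit_steps. indicator {X. X 1 \<in> {s}} X *\<^sub>R real_vec s) \<partial>?Q)"
    unfolding drift_def
  proof (rule integral_cong_AE)
    show "AE X in ?Q. real_vec (X 1) = (\<Sum>s\<in>unit_steps. indicator {X. X 1 \<in> {s}} X *\<^sub>R real_vec s)"
      using ae
    proof eventually_elim
      case (elim X)
      have "(\<Sum>s\<in>unit_steps. indicator {X. X 1 \<in> {s}} X *\<^sub>R real_vec s) =
        (\<Sum>s\<in>unit_steps. if s = X 1 then real_vec s else 0)"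
        by (intro sum.cong refl) (auto simp: indicator_def)
      also have "\<dots> = real_vec (X 1)" by (subst sum.delta[OF finite_unit_steps]) (use elim in simp)
      finally show ?case by (rule sym)
    qed
    show "(\<lambda>X. real_vec (X 1)) \<in> borel_measurable ?Q"
      unfolding measurable_cong_sets[OF sets refl] path_space_def
      by (rule measurable_compose[OF measurable_component_singleton]) auto
    show "(\<lambda>X. \<Sum>s\<in>unit_steps. indicator {X. X 1 \<in> {s}} X *\<^sub>R real_vec s) \<in> borel_measurable ?Q"
      by (intro borel_measurable_sum borel_measurable_scaleR borel_measurable_indicator borel_measurable_const)
        (simp add: sets sets_position del: insert_iff)
  qed
  also have "\<dots> = (\<Sum>s\<in>unit_steps. measure ?Q {X. X 1 \<in> {s}} *\<^sub>R real_vec s)"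
  proof (subst Bochner_Integration.integral_sum)
    have s: "{X. X 1 \<in> {s}} \<in> events" for s by (simp only: sets sets_position)
    show "integrable ?Q (\<lambda>X. indicator {X. X 1 \<in> {s}} X *\<^sub>R real_vec s)" for s
      using s[of s] by (intro integrable_scaleR_left integrable_real_indicator) (auto simp: less_top[symmetric])
    show "(\<Sum>s\<in>unit_steps. \<integral>X. indicator {X. X 1 \<in> {s}} X *\<^sub>R real_vec s \<partial>?Q) =
      (\<Sum>s\<in>unit_steps. measure ?Q {X. X 1 \<in> {s}} *\<^sub>R real_vec s)"
      using s by (intro sum.cong refl) (simp add: less_top[symmetric] del: insert_iff)
  qed
  also have "\<dots> = (\<Sum>s\<in>unit_steps. measure (\<omega> 0) {s} *\<^sub>R real_vec s)"
    unfolding m by (intro sum.cong refl) simp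
  finally show ?thesis .
qed

lemma measurable_site_weight: "(\<lambda>p. measure p {s}) \<in> borel_measurable (site_space :: (int ^ 'd::finite) measure measure)"
proof (cases "s \<in> unit_steps")
  case True
  have "(\<lambda>p. emeasure p {s}) \<in> borel_measurable (site_space :: (int ^ 'd::finite) measure measure)"
    unfolding site_space_def using True
    by (intro measurable_compose[OF measurable_prob_algebraD[OF measurable_ident_sets[OF refl]]
          measurable_emeasure_subprob_algebra]) auto
  then show ?thesis unfolding measure_def by measurable
next
  case False
  have "measure p {s} = 0" if "p \<in> space site_space" for p :: "(int ^ 'd) measure"
    using that False by (intro measure_notin_sets) (auto simp: site_space_def space_prob_algebra)
  then show ?thesis by (subst measurable_cong[where g="\<lambda>_. 0"]) auto
qed

lemma measurable_env_site: "(\<lambda>\<omega>. \<omega> x) \<in> env_space \<rightarrow>\<^sub>M site_space"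
  unfolding env_space_def by (rule measurable_component_singleton) simp

lemma measurable_qweight: "(\<lambda>\<omega>. qweight \<omega> x ss) \<in> borel_measurable env_space"
  by (induction ss arbitrary: x)
    (auto intro!: borel_measurable_times measurable_compose[OF measurable_env_site measurable_site_weight])

text \<open>The steps taken from the site \<open>y\<close>, in order, by the path that starts in \<open>x\<close>.\<close>

primrec exits :: "'v::monoid_add \<Rightarrow> 'v list \<Rightarrow> 'v \<Rightarrow> 'v list" where
  "exits x [] y = []"
| "exits x (s # ss) y = (if x = y then s # exits (x + s) ss y else exits (x + s) ss y)"

primrec sites :: "'v::monoid_add \<Rightarrow> 'v list \<Rightarrow> 'v set" where
  "sites x [] = {}"
| "sites x (s # ss) = insert x (sites (x + s) ss)"

lemma finite_sites: "finite (sites x ss)"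
  by (induction ss arbitrary: x) auto

lemma sites_conv: "sites x ss = (\<lambda>k. x + sum_list (take k ss)) ` {..<length ss}"
proof (induction ss arbitrary: x)
  case (Cons s ss)
  show ?case
    by (simp add: Cons.IH lessThan_Suc_eq_insert_0 image_image add.assoc)
qed simp

lemma exits_notin: "y \<notin> sites x ss \<Longrightarrow> exits x ss y = []"
  by (induction ss arbitrary: x) auto

lemma exits_append: "exits x (ss @ ts) y = exits x ss y @ exits (x + sum_list ss) ts y"
  by (induction ss arbitrary: x) (auto simp: add.assoc)

lemma exits_shift:
  fixes v :: "'v::group_add"
  shows "exits (v + x) ss (v + y) = exits x ss y"
  by (induction ss arbitrary: x) (auto simp: add.assoc)

lemma sites_shift: "sites (v + x) ss = (\<lambda>y. v + y) ` sites x ss"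
  by (induction ss arbitrary: x) (auto simp: add.assoc)

definition site_prod :: "'v measure \<Rightarrow> 'v list \<Rightarrow> real" where
  "site_prod p ss = prod_list (map (\<lambda>s. measure p {s}) ss)"

lemma qweight_site_prod:
  assumes "finite F" "sites x ss \<subseteq> F"
  shows "qweight \<omega> x ss = (\<Prod>y\<in>F. site_prod (\<omega> y) (exits x ss y))"
  using assms(2)
proof (induction ss arbitrary: x)
  case Nil
  then show ?case by (simp add: site_prod_def)
next
  case (Cons s ss)
  have x: "x \<in> F" and IH: "qweight \<omega> (x + s) ss = (\<Prod>y\<in>F. site_prod (\<omega> y) (exits (x + s) ss y))"
    using Cons by auto
  have "(\<Prod>y\<in>F. site_prod (\<omega> y) (exits x (s # ss) y)) =
      (\<Prod>y\<in>F. (if x = y then measure (\<omega> x) {s} else 1) * site_prod (\<omega> y) (exits (x + s) ss y))"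
    by (intro prod.cong refl) (auto simp: site_prod_def)
  also have "\<dots> = measure (\<omega> x) {s} * qweight \<omega> (x + s) ss"
    using x assms(1) by (simp add: prod.distrib IH)
  finally show ?case by simp
qed

lemma measurable_site_prod: "(\<lambda>p. site_prod p ss) \<in> borel_measurable site_space"
  unfolding site_prod_def
  by (induction ss) (auto intro!: borel_measurable_times measurable_site_weight)

lemma site_prod_bounds:
  assumes "prob_space p"
  shows "0 \<le> site_prod p ss" "site_prod p ss \<le> 1"
proof -
  interpret prob_space p by fact
  show "0 \<le> site_prod p ss" unfolding site_prod_def by (induction ss) auto
  show "site_prod p ss \<le> 1" unfolding site_prod_def
    by (induction ss) (auto intro!: mult_le_one prod_list_nonneg)
qed

locale iid_environment = prob_space P for P :: "'d::finite env measure" +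
  assumes sets_P: "sets P = sets env_space" and iid: "iid_env P"
begin

lemma space_P: "space P = space env_space"
  using sets_P by (rule sets_eq_imp_space_eq)

lemma measurable_P_site: "(\<lambda>\<omega>. \<omega> x) \<in> P \<rightarrow>\<^sub>M site_space"
  using measurable_env_site unfolding measurable_cong_sets[OF sets_P refl] .

lemma integrable_bounded:
  assumes "f \<in> borel_measurable env_space" "\<And>\<omega>. \<omega> \<in> space env_space \<Longrightarrow> norm (f \<omega>) \<le> (B::real)"
  shows "integrable P (f :: 'd env \<Rightarrow> real)"
proof (rule integrable_const_bound[where B=B])
  show "AE \<omega> in P. norm (f \<omega>) \<le> B" using assms(2) by (intro AE_I2) (simp add: space_P)
  show "f \<in> borel_measurable P" using assms(1) unfolding measurable_cong_sets[OF sets_P refl] .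
qed

text \<open>All sites have the same law and there are only countably many of them.\<close>

lemma AE_all_sites:
  assumes Q: "{p \<in> space site_space. Q p} \<in> sets site_space" and ae: "AE \<omega> in P. Q (\<omega> 0)"
  shows "AE \<omega> in P. \<forall>x. Q (\<omega> x)"
proof (subst AE_all_countable, intro allI)
  fix x
  have "AE p in distr P site_space (\<lambda>\<omega>. \<omega> 0). Q p"
    using ae by (subst AE_distr_iff[OF measurable_P_site Q])
  then have "AE p in distr P site_space (\<lambda>\<omega>. \<omega> x). Q p"
    using iid unfolding iid_env_def by metis
  then show "AE \<omega> in P. Q (\<omega> x)"
    by (subst (asm) AE_distr_iff[OF measurable_P_site Q])
qed

definition mom :: "(int ^ 'd) list \<Rightarrow> real" where
  "mom ss = (\<integral>\<omega>. site_prod (\<omega> 0) ss \<partial>P)"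

definition aweight :: "(int ^ 'd) list \<Rightarrow> real" where
  "aweight ss = (\<integral>\<omega>. qweight \<omega> 0 ss \<partial>P)"

lemma integral_site_prod: "(\<integral>\<omega>. site_prod (\<omega> x) ss \<partial>P) = mom ss"
proof -
  have "(\<integral>\<omega>. site_prod (\<omega> x) ss \<partial>P) = (\<integral>p. site_prod p ss \<partial>distr P site_space (\<lambda>\<omega>. \<omega> x))"
    by (rule integral_distr[symmetric, OF measurable_P_site measurable_site_prod])
  also have "distr P site_space (\<lambda>\<omega>. \<omega> x) = distr P site_space (\<lambda>\<omega>. \<omega> 0)"
    using iid unfolding iid_env_def by metis
  also have "(\<integral>p. site_prod p ss \<partial>distr P site_space (\<lambda>\<omega>. \<omega> 0)) = mom ss"
    unfolding mom_def by (rule integral_distr[OF measurable_P_site measurable_site_prod])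
  finally show ?thesis .
qed

lemma mom_Nil [simp]: "mom [] = 1"
  by (simp add: mom_def site_prod_def prob_space)

text \<open>Regroup the path weight by sites; the factors of different sites are independent.\<close>

lemma integral_qweight:
  assumes F: "finite F" "sites x ss \<subseteq> F"
  shows "(\<integral>\<omega>. qweight \<omega> x ss \<partial>P) = (\<Prod>y\<in>F. mom (exits x ss y))"
proof -
  have ind: "indep_vars (\<lambda>_. site_space) (\<lambda>x \<omega>. \<omega> x) F"
    using iid unfolding iid_env_def by (blast intro: indep_vars_subset)
  have "indep_vars (\<lambda>_. borel) (\<lambda>y \<omega>. site_prod (\<omega> y) (exits x ss y)) F"
    by (rule indep_vars_compose2[OF ind]) (rule measurable_site_prod)
  moreover have "integrable P (\<lambda>\<omega>. site_prod (\<omega> y) zs)" for y zs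
    by (rule integrable_bounded[where B=1])
      (simp_all add: abs_of_nonneg site_prod_bounds sets_env_site(3)
        measurable_compose[OF measurable_env_site measurable_site_prod])
  ultimately have "(\<integral>\<omega>. (\<Prod>y\<in>F. site_prod (\<omega> y) (exits x ss y)) \<partial>P) =
      (\<Prod>y\<in>F. \<integral>\<omega>. site_prod (\<omega> y) (exits x ss y) \<partial>P)"
    by (intro indep_vars_lebesgue_integral F(1)) auto
  then show ?thesis
    by (simp add: integral_site_prod qweight_site_prod[OF F])
qed

text \<open>By the product formula over sites the weight splits, and the weight of the second part does not depend
on the site from which it starts.\<close>

lemma aweight_append:
  assumes disj: "sites 0 us \<inter> sites (sum_list us) vs = {}"
  shows "aweight (us @ vs) = aweight us * aweight vs"
proof -
  let ?x = "sum_list us"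
  let ?A = "sites 0 us" and ?B = "sites ?x vs"
  have "sites 0 (us @ vs) \<subseteq> ?A \<union> ?B"
  proof -
    have "sites x (us @ vs) = sites x us \<union> sites (x + sum_list us) vs" for x
      by (induction us arbitrary: x) (auto simp: add.assoc)
    then show ?thesis by simp
  qed
  then have "aweight (us @ vs) = (\<Prod>y\<in>?A \<union> ?B. mom (exits 0 (us @ vs) y))"
    unfolding aweight_def by (intro integral_qweight) (auto simp: finite_sites)
  also have "\<dots> = (\<Prod>y\<in>?A. mom (exits 0 (us @ vs) y)) * (\<Prod>y\<in>?B. mom (exits 0 (us @ vs) y))"
    by (rule prod.union_disjoint[OF finite_sites finite_sites disj])
  also have "(\<Prod>y\<in>?A. mom (exits 0 (us @ vs) y)) = (\<Prod>y\<in>?A. mom (exits 0 us y))"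
  proof (intro prod.cong refl)
    fix y assume "y \<in> ?A"
    then have "exits ?x vs y = []" using disj by (intro exits_notin) auto
    then show "mom (exits 0 (us @ vs) y) = mom (exits 0 us y)" by (simp add: exits_append)
  qed
  also have "\<dots> = aweight us"
    unfolding aweight_def by (rule integral_qweight[symmetric]) (auto simp: finite_sites)
  also have "(\<Prod>y\<in>?B. mom (exits 0 (us @ vs) y)) = (\<Prod>y\<in>?B. mom (exits ?x vs y))"
  proof (intro prod.cong refl)
    fix y assume "y \<in> ?B"
    then have "exits 0 us y = []" using disj by (intro exits_notin) auto
    then show "mom (exits 0 (us @ vs) y) = mom (exits ?x vs y)" by (simp add: exits_append)
  qed
  also have "\<dots> = (\<Prod>y\<in>sites 0 vs. mom (exits 0 vs y))"
    using sites_shift[of ?x 0 vs] exits_shift[of ?x 0 vs]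
    by (simp add: prod.reindex inj_on_def)
  also have "\<dots> = aweight vs"
    unfolding aweight_def by (rule integral_qweight[symmetric]) (auto simp: finite_sites)
  finally show ?thesis .
qed

lemma integrable_qweight: "integrable P (\<lambda>\<omega>. qweight \<omega> x ss)"
  by (rule integrable_bounded[where B=1])
    (auto simp: measurable_qweight qweight_nonneg qweight_le_1)

lemma aweight_nonneg: "0 \<le> aweight ss"
  unfolding aweight_def by (simp add: qweight_nonneg)

lemma sum_aweight: "(\<Sum>ss\<in>step_lists unit_steps n. aweight ss) = 1"
proof -
  have "(\<Sum>ss\<in>step_lists unit_steps n. aweight ss) = (\<integral>\<omega>. (\<Sum>ss\<in>step_lists unit_steps n. qweight \<omega> 0 ss) \<partial>P)"
    unfolding aweight_def by (rule Bochner_Integration.integral_sum[symmetric]) (rule integrable_qweight)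
  also have "\<dots> = (\<integral>\<omega>. 1 \<partial>P)"
    by (intro Bochner_Integration.integral_cong refl) (simp add: space_P sum_qweight)
  finally show ?thesis by (simp add: prob_space)
qed

lemma aweight_pos:
  assumes "uniformly_elliptic P" "set ss \<subseteq> unit_steps"
  shows "0 < aweight ss"
proof -
  obtain \<epsilon> where \<epsilon>: "0 < \<epsilon>" "AE \<omega> in P. \<forall>s\<in>unit_steps. \<epsilon> \<le> measure (\<omega> 0) {s}"
    using assms(1) by (auto simp: uniformly_elliptic_def)
  have "{p \<in> space site_space. \<forall>s\<in>unit_steps. \<epsilon> \<le> measure p {s}} =
      space site_space \<inter> (\<Inter>s\<in>unit_steps. {p \<in> space site_space. \<epsilon> \<le> measure p {s}})" by auto
  also have "\<dots> \<in> sets (site_space :: (int ^ 'd) measure measure)"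
    by (intro sets.Int sets.top sets.finite_INT borel_measurable_le measurable_const measurable_site_weight finite_unit_steps)
      (use axis_unit_step(1) in auto)
  finally have "AE \<omega> in P. \<forall>x. \<forall>s\<in>unit_steps. \<epsilon> \<le> measure (\<omega> x) {s}"
    using \<epsilon>(2) by (rule AE_all_sites)
  then have "AE \<omega> in P. \<epsilon> ^ length ss \<le> qweight \<omega> 0 ss"
  proof eventually_elim
    case (elim \<omega>)
    have "set ss \<subseteq> unit_steps \<Longrightarrow> \<epsilon> ^ length ss \<le> qweight \<omega> x ss" for x
      by (induction ss arbitrary: x) (use elim \<epsilon>(1) in \<open>auto intro!: mult_mono\<close>)
    then show ?case using assms(2) by blast
  qed
  then have "(\<integral>\<omega>. \<epsilon> ^ length ss \<partial>P) \<le> aweight ss"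
    unfolding aweight_def by (intro integral_mono_AE integrable_qweight) auto
  moreover have "0 < \<epsilon> ^ length ss" using \<epsilon>(1) by simp
  ultimately show ?thesis by (simp add: prob_space)
qed

lemma annealed_law_prob: "prob_space (annealed_law P)" "sets (annealed_law P) = sets path_space"
proof -
  have "quenched_law \<in> P \<rightarrow>\<^sub>M prob_algebra path_space"
    using measurable_quenched_law unfolding measurable_cong_sets[OF sets_P refl] .
  moreover have "P \<in> space (prob_algebra P)" by (simp add: space_prob_algebra prob_space_axioms)
  ultimately have *: "P \<in> space (prob_algebra P)" "quenched_law \<in> P \<rightarrow>\<^sub>M prob_algebra path_space"
    by auto
  show "prob_space (annealed_law P)" "sets (annealed_law P) = sets path_space"
    unfolding annealed_law_def using prob_space_bind'[OF *] sets_bind'[OF *] by simp_all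
qed

lemma measure_annealed_position:
  "measure (annealed_law P) {X. X n \<in> B} = (\<Sum>ss | ss \<in> step_lists unit_steps n \<and> sum_list ss \<in> B. aweight ss)"
proof -
  let ?G = "{ss. ss \<in> step_lists unit_steps n \<and> sum_list ss \<in> B}"
  have q: "quenched_law \<in> P \<rightarrow>\<^sub>M subprob_algebra path_space"
    using measurable_prob_algebraD[OF measurable_quenched_law] unfolding measurable_cong_sets[OF sets_P refl] .
  have "emeasure (annealed_law P) {X. X n \<in> B} = (\<integral>\<^sup>+\<omega>. emeasure (quenched_law \<omega>) {X. X n \<in> B} \<partial>P)"
    unfolding annealed_law_def by (rule emeasure_bind[OF not_empty q sets_position])
  also have "\<dots> = (\<integral>\<^sup>+\<omega>. ennreal (\<Sum>ss\<in>?G. qweight \<omega> 0 ss) \<partial>P)"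
  proof (rule nn_integral_cong)
    fix \<omega> assume "\<omega> \<in> space P"
    then have \<omega>: "\<omega> \<in> space env_space" by (simp add: space_P)
    interpret Q: prob_space "quenched_law \<omega>" by (rule quenched_law_prob(1)[OF \<omega>])
    show "emeasure (quenched_law \<omega>) {X. X n \<in> B} = ennreal (\<Sum>ss\<in>?G. qweight \<omega> 0 ss)"
      unfolding Q.emeasure_eq_measure measure_quenched_position[OF \<omega>] ..
  qed
  also have "\<dots> = ennreal (\<integral>\<omega>. (\<Sum>ss\<in>?G. qweight \<omega> 0 ss) \<partial>P)"
    by (intro nn_integral_eq_integral Bochner_Integration.integrable_sum integrable_qweight)
      (auto intro!: AE_I2 sum_nonneg qweight_nonneg)
  also have "(\<integral>\<omega>. (\<Sum>ss\<in>?G. qweight \<omega> 0 ss) \<partial>P) = (\<Sum>ss\<in>?G. aweight ss)"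
    unfolding aweight_def by (rule Bochner_Integration.integral_sum) (rule integrable_qweight)
  finally show ?thesis
    by (simp add: measure_def sum_nonneg aweight_nonneg)
qed

lemma measure_scaled_position:
  fixes \<Gamma> :: "(real ^ 'd) set"
  assumes "\<Gamma> \<in> sets borel"
  shows "measure (distr (annealed_law P) borel (\<lambda>X. (1 / real n) *\<^sub>R real_vec (X n))) \<Gamma> =
    (\<Sum>ss | ss \<in> step_lists unit_steps n \<and> (1 / real n) *\<^sub>R real_vec (sum_list ss) \<in> \<Gamma>. aweight ss)"
proof -
  have "(\<lambda>X. (1 / real n) *\<^sub>R real_vec (X n)) \<in> path_space \<rightarrow>\<^sub>M (borel :: (real ^ 'd) measure)"
    unfolding path_space_def by (rule measurable_compose[OF measurable_component_singleton]) auto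
  then have "(\<lambda>X. (1 / real n) *\<^sub>R real_vec (X n)) \<in> annealed_law P \<rightarrow>\<^sub>M (borel :: (real ^ 'd) measure)"
    unfolding measurable_cong_sets[OF annealed_law_prob(2) refl] .
  from measure_distr[OF this assms] show ?thesis
    using measure_annealed_position[of n "{x. (1 / real n) *\<^sub>R real_vec x \<in> \<Gamma>}"]
      sets_eq_imp_space_eq[OF annealed_law_prob(2)]
    by (simp add: space_path_space vimage_def)
qed

end

section \<open>A direction of positive local drift\<close>

lemma AE_in_measure_support:
  fixes \<mu> :: "'a::second_countable_topology measure"
  assumes "sets \<mu> = sets borel"
  shows "AE x in \<mu>. x \<in> measure_support \<mu>"
proof -
  let ?F = "{U. open U \<and> emeasure \<mu> U = 0}"
  obtain F' where F': "F' \<subseteq> ?F" "countable F'" "\<Union>F' = \<Union>?F"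
    using Lindelof[of ?F] by blast
  have "\<Union>F' \<in> null_sets \<mu>"
  proof -
    have "(\<Union>U\<in>F'. U) \<in> null_sets \<mu>"
      using F' assms by (intro null_sets_UN') (auto simp: null_sets_def)
    then show ?thesis by simp
  qed
  then show ?thesis
  proof (rule AE_I'[OF _ subsetI])
    fix x assume "x \<in> {x \<in> space \<mu>. x \<notin> measure_support \<mu>}"
    then obtain U where "open U" "x \<in> U" "\<not> 0 < emeasure \<mu> U" by (auto simp: measure_support_def)
    then show "x \<in> \<Union>F'" unfolding F'(3) by (auto simp: zero_less_iff_neq_zero)
  qed
qed

text \<open>Separate \<open>0\<close> from the closed convex hull of the drifts by a hyperplane, multiply its normal by a large
number and round the coordinates. Each step has coordinates bounded by \<open>1\<close>, so the rounding costs at most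
the dimension.\<close>

lemma non_nestling_direction:
  fixes P :: "'d::finite env measure"
  assumes P: "iid_environment P" and nn: "non_nestling P"
  shows "\<exists>h. height h \<and> (AE \<omega> in P. 1 \<le> (\<Sum>s\<in>unit_steps. measure (\<omega> 0) {s} * real_of_int (h s)))"
proof -
  interpret iid_environment P by (rule P)
  have drift_meas: "drift \<in> borel_measurable P"
    using measurable_drift unfolding measurable_cong_sets[OF sets_P refl] .
  have "convex (drift_hull P)" "closed (drift_hull P)" "0 \<notin> drift_hull P"
    using nn by (auto simp: drift_hull_def non_nestling_def intro!: convex_closure convex_convex_hull)
  from separating_hyperplane_closed_0[OF this] obtain a b where ab: "0 < b" "\<And>x. x \<in> drift_hull P \<Longrightarrow> b < a \<bullet> x"
    by auto
  have sub: "measure_support (distr P borel drift) \<subseteq> drift_hull P"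
    unfolding drift_hull_def using hull_subset closure_subset by (rule subset_trans)
  have "AE x in distr P borel drift. x \<in> measure_support (distr P borel drift)"
    by (rule AE_in_measure_support) simp
  then have "AE x in distr P borel drift. b < a \<bullet> x"
    by eventually_elim (use sub ab(2) in blast)
  then have ae: "AE \<omega> in P. b < a \<bullet> drift \<omega>"
    by (subst (asm) AE_distr_iff[OF drift_meas]) (auto intro!: borel_measurable_less)
  \<comment> \<open>scales the drift \<open>b\<close> up to \<open>1\<close> plus the rounding error\<close>
  define N where "N = (1 + real CARD('d)) / b"
  define l where "l i = \<lfloor>N * a $ i\<rfloor>" for i
  define h where "h x = (\<Sum>i\<in>UNIV. l i * x $ i)" for x :: "int ^ 'd"
  have hs: "N * (a \<bullet> real_vec s) - real CARD('d) \<le> real_of_int (h s)" if s: "s \<in> unit_steps" for s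
  proof -
    have "N * (a \<bullet> real_vec s) - real_of_int (h s) = (\<Sum>i\<in>UNIV. (N * a $ i - real_of_int (l i)) * real_of_int (s $ i))"
      by (simp add: inner_vec_def real_vec_def h_def sum_distrib_left sum_subtractf left_diff_distrib mult.assoc)
    also have "\<dots> \<le> (\<Sum>i\<in>(UNIV::'d set). 1)"
    proof (rule sum_mono)
      fix i
      have "\<bar>(N * a $ i - real_of_int (l i)) * real_of_int (s $ i)\<bar> \<le> 1 * 1"
        unfolding abs_mult
      proof (rule mult_mono)
        show "\<bar>N * a $ i - real_of_int (l i)\<bar> \<le> 1" unfolding l_def by linarith
        show "\<bar>real_of_int (s $ i)\<bar> \<le> 1" using norm_unit_step_coord[OF s, of i] by linarith
      qed auto
      then show "(N * a $ i - real_of_int (l i)) * real_of_int (s $ i) \<le> 1" by linarith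
    qed
    finally show ?thesis by simp
  qed
  have "height h" by unfold_locales (simp add: h_def sum.distrib distrib_left)
  moreover have "AE \<omega> in P. 1 \<le> (\<Sum>s\<in>unit_steps. measure (\<omega> 0) {s} * real_of_int (h s))"
    using ae AE_space
  proof eventually_elim
    case (elim \<omega>)
    then have \<omega>: "\<omega> \<in> space env_space" by (simp add: space_P)
    have N: "0 < N" "N * b = 1 + real CARD('d)" using ab(1) by (auto simp: N_def)
    have "1 \<le> N * (a \<bullet> drift \<omega>) - real CARD('d)"
      using mult_strict_left_mono[OF elim(1) N(1)] N(2) by linarith
    also have "a \<bullet> drift \<omega> = (\<Sum>s\<in>unit_steps. measure (\<omega> 0) {s} * (a \<bullet> real_vec s))"
      unfolding drift_eq[OF \<omega>] by (simp add: inner_sum_right)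
    also have "N * \<dots> - real CARD('d) = N * \<dots> - real CARD('d) * (\<Sum>s\<in>unit_steps. measure (\<omega> 0) {s})"
      by (simp add: sum_site_weights[OF \<omega>])
    also have "\<dots> = (\<Sum>s\<in>unit_steps. measure (\<omega> 0) {s} * (N * (a \<bullet> real_vec s) - real CARD('d)))"
      unfolding sum_distrib_left sum_subtractf[symmetric]
      by (intro sum.cong refl) (simp add: right_diff_distrib mult_ac)
    also have "\<dots> \<le> (\<Sum>s\<in>unit_steps. measure (\<omega> 0) {s} * real_of_int (h s))"
      by (intro sum_mono mult_left_mono hs) auto
    finally show ?case .
  qed
  ultimately show ?thesis by blast
qed

section \<open>Renewal structure of the tilted partition function\<close>

text \<open>Finitely many renewal weights already have mass at least \<open>1\<close>, so the minimum of \<open>Y n * t ^ n\<close> over a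
window of length \<open>K\<close> never decreases.\<close>

lemma renewal_lower_bound:
  fixes g b Y :: "nat \<Rightarrow> real"
  assumes Y: "\<And>n. Y n = b n + (\<Sum>j\<le>n. g j * Y (n - j))"
    and g: "\<And>j. 0 \<le> g j" "g 0 = 0" and b: "\<And>n. 0 \<le> b n" and Ypos: "\<And>n. 0 < Y n"
    and t: "0 < t" and K: "1 \<le> (\<Sum>j\<le>K. g j * t ^ j)"
  shows "\<exists>c>0. \<forall>n. c \<le> Y n * t ^ n"
proof -
  define c where "c = Min ((\<lambda>n. Y n * t ^ n) ` {..K})"
  have c0: "0 < c" unfolding c_def using Ypos t by (subst Min_gr_iff) auto
  have cK: "c \<le> Y n * t ^ n" if "n \<le> K" for n
    unfolding c_def using that by (intro Min_le) auto
  have "c \<le> Y n * t ^ n" for n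
  proof (induction n rule: less_induct)
    case (less n)
    show ?case
    proof (cases "n \<le> K")
      case False
      have "c * 1 \<le> c * (\<Sum>j\<le>K. g j * t ^ j)" using K c0 by (intro mult_left_mono) auto
      also have "\<dots> = (\<Sum>j\<le>K. g j * t ^ j * c)" by (simp add: sum_distrib_left mult_ac)
      also have "\<dots> \<le> (\<Sum>j\<le>K. g j * t ^ j * (Y (n - j) * t ^ (n - j)))"
      proof (rule sum_mono)
        fix j assume "j \<in> {..K}"
        show "g j * t ^ j * c \<le> g j * t ^ j * (Y (n - j) * t ^ (n - j))"
        proof (cases "j = 0")
          case False
          then have "n - j < n" using \<open>\<not> n \<le> K\<close> by simp
          then show ?thesis using less.IH[of "n - j"] g(1)[of j] t by (intro mult_left_mono) auto
        qed (simp add: g(2))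
      qed
      also have "\<dots> \<le> (\<Sum>j\<le>n. g j * t ^ j * (Y (n - j) * t ^ (n - j)))"
        using False g(1) Ypos t by (intro sum_mono2) (auto simp: less_imp_le)
      also have "\<dots> = (\<Sum>j\<le>n. g j * Y (n - j)) * t ^ n"
        unfolding sum_distrib_right
      proof (intro sum.cong refl)
        fix j assume "j \<in> {..n}"
        then have "t ^ n = t ^ j * t ^ (n - j)" by (simp add: power_add[symmetric])
        then show "g j * t ^ j * (Y (n - j) * t ^ (n - j)) = g j * Y (n - j) * t ^ n" by simp
      qed
      also have "\<dots> \<le> Y n * t ^ n"
        using t b[of n] by (intro mult_right_mono) (auto simp: Y[of n])
      finally show ?thesis by simp
    qed (rule cK)
  qed
  then show ?thesis using c0 by blast
qed

text \<open>Here \<open>C\<close> is the fixed point of \<open>C = B + \<gamma> * C\<close>, where \<open>\<gamma> < 1\<close> is the mass of the renewal weights.\<close>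

lemma renewal_upper_bound:
  fixes g b Y :: "nat \<Rightarrow> real"
  assumes Y: "\<And>n. Y n = b n + (\<Sum>j\<le>n. g j * Y (n - j))"
    and g: "\<And>j. 0 \<le> g j" "g 0 = 0" and t: "0 < t" and B: "\<And>n. b n * t ^ n \<le> B" "0 \<le> B"
    and sg: "summable (\<lambda>j. g j * t ^ j)" and lt: "(\<Sum>j. g j * t ^ j) < 1"
  shows "\<exists>C\<ge>0. \<forall>n. Y n * t ^ n \<le> C"
proof -
  let ?\<gamma> = "\<Sum>j. g j * t ^ j"
  define C where "C = B / (1 - ?\<gamma>)"
  have \<gamma>0: "0 \<le> ?\<gamma>" using g t by (intro suminf_nonneg sg) auto
  have C0: "0 \<le> C" using B lt by (simp add: C_def)
  have CB: "B + ?\<gamma> * C = C" using lt by (simp add: C_def field_simps)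
  have "Y n * t ^ n \<le> C" for n
  proof (induction n rule: less_induct)
    case (less n)
    have "Y n * t ^ n = b n * t ^ n + (\<Sum>j\<le>n. g j * t ^ j * (Y (n - j) * t ^ (n - j)))"
    proof -
      have "(\<Sum>j\<le>n. g j * Y (n - j)) * t ^ n = (\<Sum>j\<le>n. g j * t ^ j * (Y (n - j) * t ^ (n - j)))"
        unfolding sum_distrib_right
      proof (intro sum.cong refl)
        fix j assume "j \<in> {..n}"
        then have "t ^ n = t ^ j * t ^ (n - j)" by (simp add: power_add[symmetric])
        then show "g j * Y (n - j) * t ^ n = g j * t ^ j * (Y (n - j) * t ^ (n - j))" by simp
      qed
      then show ?thesis by (subst Y) (simp add: distrib_right)
    qed
    also have "\<dots> \<le> B + (\<Sum>j\<le>n. g j * t ^ j * C)"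
    proof (intro add_mono B sum_mono)
      fix j assume "j \<in> {..n}"
      show "g j * t ^ j * (Y (n - j) * t ^ (n - j)) \<le> g j * t ^ j * C"
      proof (cases "j = 0")
        case False
        then have "n - j < n" using \<open>j \<in> {..n}\<close> by simp
        then show ?thesis using less.IH[of "n - j"] g(1)[of j] t by (intro mult_left_mono) auto
      qed (simp add: g(2))
    qed
    also have "(\<Sum>j\<le>n. g j * t ^ j * C) \<le> ?\<gamma> * C"
      unfolding sum_distrib_right[symmetric] using g(1) t C0
      by (intro mult_right_mono sum_le_suminf sg) auto
    finally show ?case using CB by simp
  qed
  then show ?thesis using C0 by blast
qed

locale ballistic_environment = iid_environment P + height h
  for P :: "'d::finite env measure" and h :: "int ^ 'd \<Rightarrow> int" +
  assumes elliptic: "uniformly_elliptic P"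
    and local_drift: "AE \<omega> in P. 1 \<le> (\<Sum>s\<in>unit_steps. measure (\<omega> 0) {s} * real_of_int (h s))"
begin

text \<open>All sites left before a break point are strictly lower than it, and those left after it are not.\<close>

lemma aweight_break:
  assumes "breaking us" "forward vs"
  shows "aweight (us @ vs) = aweight us * aweight vs"
proof (rule aweight_append, rule ccontr)
  assume "sites 0 us \<inter> sites (sum_list us) vs \<noteq> {}"
  then obtain j k where *: "j < length us" "k < length vs"
    "sum_list (take j us) = sum_list us + sum_list (take k vs)"
    by (auto simp: sites_conv)
  have "h (sum_list (take j us)) < h (sum_list us)" by (rule breaking_height_less[OF assms(1) *(1)])
  moreover have "0 \<le> h (sum_list (take k vs))" using assms(2) *(2) by (simp add: forward_def)
  ultimately show False by (simp add: *(3) h_add)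
qed

lemma sum_aweight_snoc: "(\<Sum>s\<in>unit_steps. aweight (ss @ [s])) = aweight ss"
proof -
  have "(\<Sum>s\<in>unit_steps. aweight (ss @ [s])) = (\<integral>\<omega>. (\<Sum>s\<in>unit_steps. qweight \<omega> 0 (ss @ [s])) \<partial>P)"
    unfolding aweight_def by (rule Bochner_Integration.integral_sum[symmetric]) (rule integrable_qweight)
  also have "\<dots> = aweight ss"
    unfolding aweight_def
  proof (intro Bochner_Integration.integral_cong refl)
    fix \<omega> assume "\<omega> \<in> space P"
    then have "(\<Sum>s\<in>unit_steps. measure (\<omega> (sum_list ss)) {s}) = 1"
      by (intro sum_site_weights) (simp add: space_P)
    then show "(\<Sum>s\<in>unit_steps. qweight \<omega> 0 (ss @ [s])) = qweight \<omega> 0 ss"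
      by (simp add: qweight_append sum_distrib_left[symmetric])
  qed
  finally show ?thesis .
qed

text \<open>In almost every environment the mean of the Lyapunov function contracts at each step, whatever the current
site is; and the function is at least \<open>1\<close> in the states without break point.\<close>

lemma exponential_tail:
  obtains r where "0 < r" "r < 1"
    "\<And>n. (\<Sum>ss | ss \<in> step_lists unit_steps n \<and> snd (scan ss) = None. aweight ss) \<le> r ^ n"
proof -
  let ?U = "unit_steps :: (int ^ 'd) set"
  \<comment> \<open>any bound of at least \<open>1\<close> on the height increments will do\<close>
  define K where "K = 1 + (\<Sum>s\<in>?U. \<bar>real_of_int (h s)\<bar>)"
  have K: "1 \<le> K" "\<And>s. s \<in> ?U \<Longrightarrow> \<bar>real_of_int (h s)\<bar> \<le> K"
  proof -
    show "1 \<le> K" unfolding K_def by (simp add: sum_nonneg)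
    fix s assume "s \<in> ?U"
    then have "\<bar>real_of_int (h s)\<bar> \<le> (\<Sum>s\<in>?U. \<bar>real_of_int (h s)\<bar>)"
      by (intro member_le_sum finite_unit_steps) auto
    then show "\<bar>real_of_int (h s)\<bar> \<le> K" by (simp add: K_def)
  qed
  define \<theta> where "\<theta> = 1 / (32 * K^2)"
  define a where "a = \<theta> / (2 * K)"
  define r where "r = 1 - a / 2"
  have "0 < a" using K(1) by (simp add: a_def \<theta>_def)
  have "1 \<le> K^2 * K" using mult_mono[of 1 "K^2" 1 K] one_le_power[OF K(1), of 2] K(1) by simp
  then have "a \<le> 1" unfolding a_def \<theta>_def using K(1) by (simp add: field_simps)
  have r: "0 < r" "r < 1" using \<open>0 < a\<close> \<open>a \<le> 1\<close> by (auto simp: r_def)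
  have "{p \<in> space site_space. 1 \<le> (\<Sum>s\<in>?U. measure p {s} * real_of_int (h s))} \<in> sets site_space"
    by (intro borel_measurable_le borel_measurable_sum borel_measurable_times measurable_site_weight borel_measurable_const)
  then have drift: "AE \<omega> in P. \<forall>x. 1 \<le> (\<Sum>s\<in>?U. measure (\<omega> x) {s} * real_of_int (h s))"
    using local_drift by (rule AE_all_sites)
  have "(\<Sum>ss | ss \<in> step_lists ?U n \<and> snd (scan ss) = None. aweight ss) \<le> r ^ n" for n
  proof -
    let ?S = "{ss. ss \<in> step_lists ?U n \<and> snd (scan ss) = None}"
    have "AE \<omega> in P. (\<Sum>ss\<in>?S. qweight \<omega> 0 ss) \<le> r ^ n"
      using drift AE_space
    proof eventually_elim
      case (elim \<omega>)
      then have \<omega>: "\<omega> \<in> space env_space" by (simp add: space_P)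
      have V: "(\<Sum>ss\<in>step_lists ?U n. qweight \<omega> 0 ss * lyapunov a \<theta> (scan ss)) \<le> r ^ n" for n
      proof (induction n)
        case 0
        show ?case by (simp add: lyapunov_def)
      next
        case (Suc n)
        have "(\<Sum>ss\<in>step_lists ?U (Suc n). qweight \<omega> 0 ss * lyapunov a \<theta> (scan ss)) =
          (\<Sum>ss\<in>step_lists ?U n. qweight \<omega> 0 ss *
            (\<Sum>s\<in>?U. measure (\<omega> (sum_list ss)) {s} * lyapunov a \<theta> (scan_step (h s) (scan ss))))"
          by (simp add: sum_step_lists_snoc qweight_append sum_distrib_left mult.assoc)
        also have "\<dots> \<le> (\<Sum>ss\<in>step_lists ?U n. qweight \<omega> 0 ss * (r * lyapunov a \<theta> (scan ss)))"
        proof (intro sum_mono mult_left_mono qweight_nonneg)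
          fix ss
          show "(\<Sum>s\<in>?U. measure (\<omega> (sum_list ss)) {s} * lyapunov a \<theta> (scan_step (h s) (scan ss))) \<le>
            r * lyapunov a \<theta> (scan ss)"
            unfolding r_def
          proof (rule lyapunov_contraction[OF finite_unit_steps])
            show "1 \<le> (\<Sum>s\<in>?U. measure (\<omega> (sum_list ss)) {s} * real_of_int (h s))" using elim(1) by blast
            show "(\<Sum>s\<in>?U. measure (\<omega> (sum_list ss)) {s}) = 1" by (rule sum_site_weights[OF \<omega>])
            show "0 \<le> fst (scan ss)" "\<And>y. snd (scan ss) = Some y \<Longrightarrow> 0 \<le> y"
              using scan_invariant[of ss] by auto
          qed (use K in \<open>auto simp: \<theta>_def a_def\<close>)
        qed
        also have "\<dots> = r * (\<Sum>ss\<in>step_lists ?U n. qweight \<omega> 0 ss * lyapunov a \<theta> (scan ss))"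
          by (simp add: sum_distrib_left mult_ac)
        also have "\<dots> \<le> r * r ^ n" using Suc.IH r by (intro mult_left_mono) auto
        finally show ?case by simp
      qed
      have "(\<Sum>ss\<in>?S. qweight \<omega> 0 ss) \<le> (\<Sum>ss\<in>?S. qweight \<omega> 0 ss * lyapunov a \<theta> (scan ss))"
      proof (rule sum_mono)
        fix ss assume "ss \<in> ?S"
        then have "1 \<le> lyapunov a \<theta> (scan ss)"
          using scan_invariant[of ss] \<open>0 < a\<close> by (simp add: lyapunov_def)
        from mult_left_mono[OF this qweight_nonneg[of \<omega> 0 ss]]
        show "qweight \<omega> 0 ss \<le> qweight \<omega> 0 ss * lyapunov a \<theta> (scan ss)" by simp
      qed
      also have "\<dots> \<le> (\<Sum>ss\<in>step_lists ?U n. qweight \<omega> 0 ss * lyapunov a \<theta> (scan ss))"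
        by (intro sum_mono2 finite_step_lists finite_unit_steps)
          (auto intro!: mult_nonneg_nonneg qweight_nonneg simp: lyapunov_def split: option.split)
      finally show ?case using V[of n] by linarith
    qed
    then have "(\<integral>\<omega>. (\<Sum>ss\<in>?S. qweight \<omega> 0 ss) \<partial>P) \<le> (\<integral>\<omega>. r ^ n \<partial>P)"
      by (intro integral_mono_AE Bochner_Integration.integrable_sum integrable_qweight) auto
    then show ?thesis
      unfolding aweight_def by (simp add: Bochner_Integration.integral_sum integrable_qweight prob_space)
  qed
  with r show ?thesis by (rule that)
qed

definition tilt :: "real ^ 'd \<Rightarrow> (int ^ 'd) list \<Rightarrow> real" where
  "tilt \<beta> ss = exp (\<beta> \<bullet> real_vec (sum_list ss))"

definition pathsum :: "real ^ 'd \<Rightarrow> ((int ^ 'd) list \<Rightarrow> bool) \<Rightarrow> nat \<Rightarrow> real" where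
  "pathsum \<beta> Q n = (\<Sum>ss | ss \<in> step_lists unit_steps n \<and> Q ss. aweight ss * tilt \<beta> ss)"

definition piece :: "(int ^ 'd) list \<Rightarrow> bool" where
  "piece ss \<longleftrightarrow> breaking ss \<and> forward ss"

lemma tilt_append: "tilt \<beta> (us @ vs) = tilt \<beta> us * tilt \<beta> vs"
  by (simp add: tilt_def real_vec_add inner_add_right exp_add)

lemma tilt_pos: "0 < tilt \<beta> ss"
  by (simp add: tilt_def)

lemma tilt_le:
  assumes "ss \<in> step_lists unit_steps n"
  shows "tilt \<beta> ss \<le> exp (norm \<beta>) ^ n"
proof -
  have "\<beta> \<bullet> real_vec (sum_list ss) \<le> norm \<beta> * norm (real_vec (sum_list ss))"
    by (rule norm_cauchy_schwarz)
  also have "\<dots> \<le> norm \<beta> * real n"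
    using norm_real_vec_sum_list[OF assms] by (intro mult_left_mono) auto
  finally show ?thesis by (simp add: tilt_def exp_of_nat_mult[symmetric] mult.commute)
qed

lemma finite_paths: "finite {ss. ss \<in> step_lists unit_steps n \<and> Q (ss :: (int ^ 'd) list)}"
  by (rule finite_subset[OF _ finite_step_lists[OF finite_unit_steps, of n]]) auto

lemma pathsum_nonneg: "0 \<le> pathsum \<beta> Q n"
  unfolding pathsum_def by (intro sum_nonneg mult_nonneg_nonneg aweight_nonneg less_imp_le[OF tilt_pos])

lemma pathsum_mono: "(\<And>ss. Q ss \<Longrightarrow> R ss) \<Longrightarrow> pathsum \<beta> Q n \<le> pathsum \<beta> R n"
  unfolding pathsum_def
  by (intro sum_mono2 finite_paths) (auto intro!: mult_nonneg_nonneg aweight_nonneg less_imp_le[OF tilt_pos])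

text \<open>The weights, annealed and tilted, are multiplicative along the decomposition at the first break point.\<close>

lemma pathsum_renewal:
  assumes Q: "\<And>us vs. breaking us \<Longrightarrow> forward vs \<Longrightarrow> Q (us @ vs) \<longleftrightarrow> Q us"
  shows "pathsum \<beta> Q n = pathsum \<beta> (\<lambda>ss. snd (scan ss) = None \<and> Q ss) n +
    (\<Sum>j\<le>n. pathsum \<beta> (\<lambda>us. breaking us \<and> Q us) j * pathsum \<beta> forward (n - j))"
proof -
  let ?F = "\<lambda>ss. aweight ss * tilt \<beta> ss"
  have "pathsum \<beta> Q n = (\<Sum>ss | ss \<in> step_lists unit_steps n \<and> snd (scan ss) = None \<and> Q ss. ?F ss) +
    (\<Sum>ss | ss \<in> step_lists unit_steps n \<and> snd (scan ss) \<noteq> None \<and> Q ss. ?F ss)"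
    unfolding pathsum_def
    by (subst sum.union_disjoint[OF finite_paths finite_paths, symmetric]) (auto intro!: sum.cong)
  also have "(\<Sum>ss | ss \<in> step_lists unit_steps n \<and> snd (scan ss) \<noteq> None \<and> Q ss. ?F ss) =
    (\<Sum>j\<le>n. \<Sum>us | us \<in> step_lists unit_steps j \<and> breaking us \<and> Q us.
       \<Sum>vs | vs \<in> step_lists unit_steps (n - j) \<and> forward vs. ?F (us @ vs))"
    by (rule sum_first_break[OF finite_unit_steps Q])
  also have "\<dots> = (\<Sum>j\<le>n. pathsum \<beta> (\<lambda>us. breaking us \<and> Q us) j * pathsum \<beta> forward (n - j))"
    unfolding pathsum_def sum_product
    by (intro sum.cong refl) (auto simp: aweight_break tilt_append)
  finally show ?thesis by (simp add: pathsum_def)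
qed

lemma partition_renewal:
  "pathsum \<beta> (\<lambda>_. True) n = pathsum \<beta> (\<lambda>ss. snd (scan ss) = None) n +
    (\<Sum>j\<le>n. pathsum \<beta> breaking j * pathsum \<beta> forward (n - j))"
  using pathsum_renewal[of "\<lambda>_. True"] by simp

lemma forward_renewal:
  "pathsum \<beta> forward n = pathsum \<beta> (\<lambda>ss. snd (scan ss) = None \<and> forward ss) n +
    (\<Sum>j\<le>n. pathsum \<beta> piece j * pathsum \<beta> forward (n - j))"
  using pathsum_renewal[of forward] forward_append forward_appendD
  unfolding piece_def[abs_def] by blast

lemma pathsum_0_breaking: "pathsum \<beta> breaking 0 = 0" "pathsum \<beta> piece 0 = 0"
  by (simp_all add: pathsum_def breaking_def piece_def) (auto intro!: sum.neutral)

text \<open>A breaking path has no break point one step before its end.\<close>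

lemma sum_breaking_le:
  assumes r: "(\<Sum>ss | ss \<in> step_lists unit_steps n \<and> snd (scan ss) = None. aweight ss) \<le> R"
  shows "(\<Sum>ss | ss \<in> step_lists unit_steps (Suc n) \<and> breaking ss. aweight ss) \<le> R"
proof -
  let ?U = "unit_steps :: (int ^ 'd) set"
  have "(\<Sum>ss | ss \<in> step_lists ?U (Suc n) \<and> breaking ss. aweight ss) =
     (\<Sum>ss\<in>step_lists ?U (Suc n). if breaking ss then aweight ss else 0)"
    using finite_step_lists[OF finite_unit_steps]
    by (subst sum.inter_filter[symmetric]) auto
  also have "\<dots> = (\<Sum>ss\<in>step_lists ?U n. \<Sum>s\<in>?U. if breaking (ss @ [s]) then aweight (ss @ [s]) else 0)"
    by (rule sum_step_lists_snoc)
  also have "\<dots> \<le> (\<Sum>ss\<in>step_lists ?U n. if snd (scan ss) = None then aweight ss else 0)"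
  proof (rule sum_mono)
    fix ss :: "(int ^ 'd) list"
    have "(\<Sum>s\<in>?U. if breaking (ss @ [s]) then aweight (ss @ [s]) else 0) \<le>
      (\<Sum>s\<in>?U. if snd (scan ss) = None then aweight (ss @ [s]) else 0)"
      by (intro sum_mono) (auto simp: breaking_def aweight_nonneg)
    also have "\<dots> = (if snd (scan ss) = None then aweight ss else 0)"
      by (cases "snd (scan ss) = None") (auto simp: sum_aweight_snoc)
    finally show "(\<Sum>s\<in>?U. if breaking (ss @ [s]) then aweight (ss @ [s]) else 0) \<le>
      (if snd (scan ss) = None then aweight ss else 0)" .
  qed
  also have "\<dots> = (\<Sum>ss | ss \<in> step_lists ?U n \<and> snd (scan ss) = None. aweight ss)"
    using finite_step_lists[OF finite_unit_steps]
    by (subst sum.inter_filter[symmetric]) auto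
  finally show ?thesis using r by linarith
qed

lemma pathsum_le:
  assumes "(\<Sum>ss | ss \<in> step_lists unit_steps n \<and> Q ss. aweight ss) \<le> R"
  shows "pathsum \<beta> Q n \<le> R * exp (norm \<beta>) ^ n"
proof -
  have "pathsum \<beta> Q n \<le> (\<Sum>ss | ss \<in> step_lists unit_steps n \<and> Q ss. aweight ss * exp (norm \<beta>) ^ n)"
    unfolding pathsum_def using tilt_le by (intro sum_mono mult_left_mono aweight_nonneg) auto
  also have "\<dots> \<le> R * exp (norm \<beta>) ^ n"
    unfolding sum_distrib_right[symmetric] using assms by (intro mult_right_mono) auto
  finally show ?thesis .
qed

lemma exists_forward_step: "\<exists>s\<in>unit_steps. 1 \<le> h s"
proof (rule ccontr)
  assume "\<not> ?thesis"
  then have neg: "\<And>s. s \<in> unit_steps \<Longrightarrow> h s \<le> 0" by fastforce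
  have "AE \<omega> in P. False"
    using local_drift
  proof eventually_elim
    case (elim \<omega>)
    have "(\<Sum>s\<in>unit_steps. measure (\<omega> 0) {s} * real_of_int (h s)) \<le> 0"
      using neg by (intro sum_nonpos mult_nonneg_nonpos) auto
    then show ?case using elim by simp
  qed
  then show False by simp
qed

lemma pathsum_forward_pos: "0 < pathsum \<beta> forward n"
proof -
  obtain s where s: "s \<in> unit_steps" "1 \<le> h s" using exists_forward_step by blast
  have hr: "0 \<le> h (sum_list (replicate k s))" for k
    using s(2) by (induction k) (auto simp: h_add)
  have fr: "forward (replicate n s)"
    unfolding forward_def using hr by (simp add: min_def)
  have "0 < aweight (replicate n s) * tilt \<beta> (replicate n s)"
    using s by (intro mult_pos_pos tilt_pos aweight_pos[OF elliptic]) (auto simp: set_replicate_conv_if)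
  also have "\<dots> \<le> pathsum \<beta> forward n"
    unfolding pathsum_def
    by (rule member_le_sum)
      (use s fr in \<open>auto simp: step_lists_def finite_paths[unfolded step_lists_def, simplified] set_replicate_conv_if
         intro!: mult_nonneg_nonneg aweight_nonneg less_imp_le[OF tilt_pos]\<close>)
  finally show ?thesis .
qed

definition rate :: real where
  "rate = (SOME r. 0 < r \<and> r < 1 \<and>
     (\<forall>n. (\<Sum>ss | ss \<in> step_lists unit_steps n \<and> snd (scan ss) = None. aweight ss) \<le> r ^ n))"

lemma rate: "0 < rate" "rate < 1"
    "(\<Sum>ss | ss \<in> step_lists unit_steps n \<and> snd (scan ss) = None. aweight ss) \<le> rate ^ n"
proof -
  obtain r where r: "0 < r" "r < 1"
    "\<And>n. (\<Sum>ss | ss \<in> step_lists unit_steps n \<and> snd (scan ss) = None. aweight ss) \<le> r ^ n"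
    using exponential_tail by blast
  have *: "0 < rate \<and> rate < 1 \<and>
     (\<forall>n. (\<Sum>ss | ss \<in> step_lists unit_steps n \<and> snd (scan ss) = None. aweight ss) \<le> rate ^ n)"
    unfolding rate_def by (rule someI[of _ r]) (intro conjI allI r)
  show "0 < rate" by (rule conjunct1[OF *])
  show "rate < 1" by (rule conjunct1[OF conjunct2[OF *]])
  show "(\<Sum>ss | ss \<in> step_lists unit_steps n \<and> snd (scan ss) = None. aweight ss) \<le> rate ^ n"
    by (rule spec[OF conjunct2[OF conjunct2[OF *]]])
qed

lemma sum_breaking_le_rate:
  "(\<Sum>ss | ss \<in> step_lists unit_steps n \<and> breaking ss. aweight ss) \<le> 1 / rate * rate ^ n"
proof (cases n)
  case 0
  have "{ss. ss \<in> step_lists unit_steps 0 \<and> breaking ss} = {}" by (auto simp: breaking_def)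
  then show ?thesis using rate(1) by (simp only: 0) simp
next
  case (Suc m)
  show ?thesis using sum_breaking_le[OF rate(3)[of m]] rate(1) by (simp add: Suc)
qed

lemma sum_piece_le_rate:
  "(\<Sum>ss | ss \<in> step_lists unit_steps n \<and> piece ss. aweight ss) \<le> 1 / rate * rate ^ n"
  by (rule order_trans[OF _ sum_breaking_le_rate], rule sum_mono2[OF finite_paths])
    (auto simp: piece_def aweight_nonneg)

lemma pathsum_le_rate:
  "pathsum \<beta> breaking n \<le> 1 / rate * (rate * exp (norm \<beta>)) ^ n"
  "pathsum \<beta> piece n \<le> 1 / rate * (rate * exp (norm \<beta>)) ^ n"
  "pathsum \<beta> (\<lambda>ss. snd (scan ss) = None) n \<le> (rate * exp (norm \<beta>)) ^ n"
  "pathsum \<beta> (\<lambda>ss. snd (scan ss) = None \<and> forward ss) n \<le> (rate * exp (norm \<beta>)) ^ n"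
proof -
  show "pathsum \<beta> breaking n \<le> 1 / rate * (rate * exp (norm \<beta>)) ^ n"
    using pathsum_le[OF sum_breaking_le_rate[of n], of \<beta>] by (simp add: power_mult_distrib)
  show "pathsum \<beta> piece n \<le> 1 / rate * (rate * exp (norm \<beta>)) ^ n"
    using pathsum_le[OF sum_piece_le_rate[of n], of \<beta>] by (simp add: power_mult_distrib)
  show e: "pathsum \<beta> (\<lambda>ss. snd (scan ss) = None) n \<le> (rate * exp (norm \<beta>)) ^ n"
    using pathsum_le[OF rate(3)[of n], of \<beta>] by (simp add: power_mult_distrib)
  show "pathsum \<beta> (\<lambda>ss. snd (scan ss) = None \<and> forward ss) n \<le> (rate * exp (norm \<beta>)) ^ n"
    by (rule order_trans[OF pathsum_mono e]) simp
qed

text \<open>The generating function of the pieces; a piece has weight \<open>\<beta>\<close> per unit of displacement and \<open>\<mu>\<close> per step.\<close>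

definition piece_gf :: "real ^ 'd \<Rightarrow> real \<Rightarrow> real" where
  "piece_gf \<beta> \<mu> = (\<Sum>n. pathsum \<beta> piece n * exp \<mu> ^ n)"

lemma summable_times_power:
  assumes lt: "rate * exp (norm \<beta> + \<mu>) < 1" and f: "\<And>n. 0 \<le> f n" "\<And>n. f n \<le> C * (rate * exp (norm \<beta>)) ^ n"
  shows "summable (\<lambda>n. f n * exp \<mu> ^ n)"
proof (rule summable_comparison_test')
  show "summable (\<lambda>n. C * (rate * exp (norm \<beta> + \<mu>)) ^ n)"
    using lt rate(1) by (intro summable_mult summable_geometric) simp
  fix n :: nat
  have "f n * exp \<mu> ^ n \<le> C * (rate * exp (norm \<beta>)) ^ n * exp \<mu> ^ n"
    by (intro mult_right_mono f) simp
  then show "norm (f n * exp \<mu> ^ n) \<le> C * (rate * exp (norm \<beta> + \<mu>)) ^ n"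
    using f(1)[of n] by (simp add: exp_add power_mult_distrib mult_ac)
qed

lemma summable_piece:
  "rate * exp (norm \<beta> + \<mu>) < 1 \<Longrightarrow> summable (\<lambda>n. pathsum \<beta> piece n * exp \<mu> ^ n)"
  by (rule summable_times_power[OF _ pathsum_nonneg pathsum_le_rate(2)])

text \<open>Subcritical pieces: the renewal bound applies to forward paths, and the part before the first break
point contributes a convergent factor.\<close>

lemma partition_upper:
  assumes lt: "rate * exp (norm \<beta> + \<mu>) < 1" and G: "piece_gf \<beta> \<mu> < 1"
  shows "\<exists>C>0. \<forall>n. pathsum \<beta> (\<lambda>_. True) n * exp \<mu> ^ n \<le> C"
proof -
  let ?t = "exp \<mu>"
  have pow: "(rate * exp (norm \<beta>)) ^ n * ?t ^ n \<le> 1" for n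
    unfolding power_mult_distrib[symmetric] using lt rate(1)
    by (intro power_le_one) (auto simp: exp_add mult_ac)
  have b: "pathsum \<beta> (\<lambda>ss. snd (scan ss) = None \<and> forward ss) n * ?t ^ n \<le> 1"
    and e: "pathsum \<beta> (\<lambda>ss. snd (scan ss) = None) n * ?t ^ n \<le> 1" for n
    using order_trans[OF mult_right_mono[OF pathsum_le_rate(4)[of \<beta> n], of "?t ^ n"] pow[of n]]
      order_trans[OF mult_right_mono[OF pathsum_le_rate(3)[of \<beta> n], of "?t ^ n"] pow[of n]] by simp_all
  have "\<exists>C\<ge>0. \<forall>n. pathsum \<beta> forward n * ?t ^ n \<le> C"
    by (rule renewal_upper_bound[OF forward_renewal pathsum_nonneg pathsum_0_breaking(2) _ b _ summable_piece[OF lt]])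
      (use G in \<open>auto simp: piece_gf_def\<close>)
  then obtain C where C: "0 \<le> C" "\<And>n. pathsum \<beta> forward n * ?t ^ n \<le> C" by blast
  have sa: "summable (\<lambda>n. pathsum \<beta> breaking n * ?t ^ n)"
    by (rule summable_times_power[OF lt pathsum_nonneg pathsum_le_rate(1)])
  let ?A = "\<Sum>n. pathsum \<beta> breaking n * ?t ^ n"
  have bound: "pathsum \<beta> (\<lambda>_. True) n * ?t ^ n \<le> 1 + ?A * C" for n
  proof -
    have "(\<Sum>j\<le>n. pathsum \<beta> breaking j * pathsum \<beta> forward (n - j)) * ?t ^ n =
      (\<Sum>j\<le>n. pathsum \<beta> breaking j * ?t ^ j * (pathsum \<beta> forward (n - j) * ?t ^ (n - j)))"
      unfolding sum_distrib_right
    proof (intro sum.cong refl)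
      fix j assume "j \<in> {..n}"
      then have "?t ^ n = ?t ^ j * ?t ^ (n - j)" by (simp add: power_add[symmetric])
      then show "pathsum \<beta> breaking j * pathsum \<beta> forward (n - j) * ?t ^ n =
        pathsum \<beta> breaking j * ?t ^ j * (pathsum \<beta> forward (n - j) * ?t ^ (n - j))" by simp
    qed
    also have "\<dots> \<le> (\<Sum>j\<le>n. pathsum \<beta> breaking j * ?t ^ j * C)"
      by (intro sum_mono mult_left_mono C mult_nonneg_nonneg pathsum_nonneg) simp
    also have "\<dots> \<le> ?A * C"
      unfolding sum_distrib_right[symmetric]
      by (intro mult_right_mono sum_le_suminf sa C) (auto intro!: mult_nonneg_nonneg pathsum_nonneg)
    finally show ?thesis
      unfolding partition_renewal[of \<beta> n] distrib_right using e[of n] by linarith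
  qed
  have pos: "0 < 1 + ?A * C"
  proof -
    have "0 \<le> ?A" by (intro suminf_nonneg sa mult_nonneg_nonneg pathsum_nonneg) simp
    then show ?thesis using C(1) by (simp add: add_pos_nonneg)
  qed
  show ?thesis by (rule exI[of _ "1 + ?A * C"], rule conjI[OF pos], rule allI, rule bound)
qed

text \<open>Supercritical pieces: finitely many lengths already carry mass more than \<open>1\<close>. Forward paths suffice.\<close>

lemma partition_lower:
  assumes lt: "rate * exp (norm \<beta> + \<mu>) < 1" and G: "1 < piece_gf \<beta> \<mu>"
  shows "\<exists>c>0. \<forall>n. c \<le> pathsum \<beta> (\<lambda>_. True) n * exp \<mu> ^ n"
proof -
  have "(\<lambda>K. \<Sum>j\<le>K. pathsum \<beta> piece j * exp \<mu> ^ j) \<longlonglongrightarrow> piece_gf \<beta> \<mu>"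
    unfolding piece_gf_def by (rule summable_LIMSEQ'[OF summable_piece[OF lt]])
  then obtain K where "1 < (\<Sum>j\<le>K. pathsum \<beta> piece j * exp \<mu> ^ j)"
    using eventually_happens'[OF sequentially_bot order_tendstoD(1)[OF _ G]] by metis
  then have "\<exists>c>0. \<forall>n. c \<le> pathsum \<beta> forward n * exp \<mu> ^ n"
    using renewal_lower_bound[where K=K and t="exp \<mu>", OF forward_renewal pathsum_nonneg pathsum_0_breaking(2)
          pathsum_nonneg pathsum_forward_pos] by simp
  then obtain c where c: "0 < c" "\<And>n. c \<le> pathsum \<beta> forward n * exp \<mu> ^ n" by blast
  have "c \<le> pathsum \<beta> (\<lambda>_. True) n * exp \<mu> ^ n" for n
  proof (rule order_trans[OF c(2)])
    have "pathsum \<beta> forward n \<le> pathsum \<beta> (\<lambda>_. True) n" by (rule pathsum_mono) simp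
    then show "pathsum \<beta> forward n * exp \<mu> ^ n \<le> pathsum \<beta> (\<lambda>_. True) n * exp \<mu> ^ n"
      by (rule mult_right_mono) simp
  qed
  with c(1) show ?thesis by blast
qed

lemma pathsum_zero: "pathsum 0 (\<lambda>_. True) n = 1"
  using sum_aweight[of n] by (simp add: pathsum_def tilt_def)

end

section \<open>Exponential bounds and the rate function\<close>

lemma ereal_ln_rate_le:
  assumes "0 < n" "0 < C" "m \<le> C * exp (- \<kappa>) ^ n"
  shows "ereal (1 / real n) * ereal_ln m \<le> ereal (ln C / real n - \<kappa>)"
proof (cases "m \<le> 0")
  case True
  then show ?thesis using assms(1) by (simp add: ereal_ln_def)
next
  case False
  then have "ln m \<le> ln (C * exp (- \<kappa>) ^ n)"
    using assms by (subst ln_le_cancel_iff) auto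
  also have "\<dots> = ln C - \<kappa> * real n"
    using assms by (simp add: ln_mult_pos ln_realpow)
  finally have "ln m / real n \<le> (ln C - \<kappa> * real n) / real n"
    by (rule divide_right_mono) simp
  then show ?thesis using False assms(1) by (simp add: ereal_ln_def diff_divide_distrib)
qed

lemma liminf_ereal_ln_le:
  assumes "0 < C" "\<And>n. m n \<le> C * exp (- \<kappa>) ^ n"
  shows "liminf (\<lambda>n. ereal (1 / real n) * ereal_ln (m n)) \<le> ereal (- \<kappa>)"
proof -
  have "(\<lambda>n. ln C / real n - \<kappa>) \<longlonglongrightarrow> 0 - \<kappa>"
    by (intro tendsto_diff tendsto_const lim_const_over_n)
  then have lim: "(\<lambda>n. ereal (ln C / real n - \<kappa>)) \<longlonglongrightarrow> ereal (- \<kappa>)"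
    by simp
  have "liminf (\<lambda>n. ereal (1 / real n) * ereal_ln (m n)) \<le> liminf (\<lambda>n. ereal (ln C / real n - \<kappa>))"
    by (intro Liminf_mono eventually_sequentiallyI[of 1] ereal_ln_rate_le assms) auto
  also have "\<dots> = ereal (- \<kappa>)" by (rule lim_imp_Liminf[OF _ lim]) simp
  finally show ?thesis .
qed

lemma eventually_le_exp:
  assumes "limsup (\<lambda>n. ereal (1 / real n) * ereal_ln (m n)) < ereal (- \<kappa>)"
  shows "\<forall>\<^sub>F n in sequentially. m n \<le> exp (- \<kappa>) ^ n"
  using Limsup_lessD[OF assms] eventually_gt_at_top[of 0]
proof eventually_elim
  case (elim n)
  show ?case
  proof (cases "m n \<le> 0")
    case True
    then show ?thesis by (rule order_trans) simp
  next
    case False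
    then have "ln (m n) / real n < - \<kappa>" using elim(1) by (simp add: ereal_ln_def)
    then have "ln (m n) \<le> real n * - \<kappa>" using elim(2) by (simp add: field_simps)
    then have "m n \<le> exp (real n * - \<kappa>)" using False by (metis exp_le_cancel_iff exp_ln not_le)
    then show ?thesis by (simp only: exp_of_nat_mult)
  qed
qed

text \<open>Sublevel sets are compact, hence closed.\<close>

lemma good_rate_lower_semicontinuous:
  fixes H :: "'a::metric_space \<Rightarrow> ereal"
  assumes "good_rate_function H" "ereal k < H x" "0 < \<delta>0"
  shows "\<exists>\<delta>. 0 < \<delta> \<and> \<delta> \<le> \<delta>0 \<and> ereal k \<le> (INF v\<in>cball x \<delta>. H v)"
proof -
  have "closed {v. H v \<le> ereal k}"
    using assms(1) by (auto simp: good_rate_function_def intro: compact_imp_closed)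
  then have "open (- {v. H v \<le> ereal k})" by (rule open_Compl)
  moreover have "x \<in> - {v. H v \<le> ereal k}" using assms(2) by auto
  ultimately obtain \<delta> where \<delta>: "0 < \<delta>" "cball x \<delta> \<subseteq> - {v. H v \<le> ereal k}"
    using open_contains_cball by metis
  have "cball x (min \<delta> \<delta>0) \<subseteq> - {v. H v \<le> ereal k}" using \<delta>(2) by auto
  then have "ereal k \<le> (INF v\<in>cball x (min \<delta> \<delta>0). H v)"
    by (intro INF_greatest) (auto simp: subset_iff not_le intro: less_imp_le)
  then show ?thesis using \<delta>(1) assms(3) by (intro exI[of _ "min \<delta> \<delta>0"]) auto
qed

lemma large_deviation_principleD:
  assumes "large_deviation_principle \<mu> H" "\<Gamma> \<in> sets borel"
  shows "- (INF v\<in>interior \<Gamma>. H v) \<le> liminf (\<lambda>n. ereal (1 / real n) * ereal_ln (measure (\<mu> n) \<Gamma>))"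
    and "limsup (\<lambda>n. ereal (1 / real n) * ereal_ln (measure (\<mu> n) \<Gamma>)) \<le> - (INF v\<in>closure \<Gamma>. H v)"
  using assms unfolding large_deviation_principle_def by blast+

lemma scaled_radius_le:
  fixes a e :: real
  assumes "0 \<le> a" "0 < e"
  shows "a * (e / (a + 1)) \<le> e" "(a + 1) * (e / (a + 1)) = e"
  using assms by (auto simp: pos_divide_le_eq add_nonneg_pos distrib_left mult.commute nonzero_divide_eq_eq)

lemma sum_UNION_le:
  fixes f :: "'a \<Rightarrow> real"
  assumes "finite T" "\<And>x. x \<in> T \<Longrightarrow> finite (S x)" "\<And>a. 0 \<le> f a"
  shows "(\<Sum>a\<in>(\<Union>x\<in>T. S x). f a) \<le> (\<Sum>x\<in>T. \<Sum>a\<in>S x. f a)"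
  using assms(1,2)
proof (induction T)
  case (insert x T)
  have "(\<Sum>a\<in>(\<Union>x\<in>insert x T. S x). f a) = (\<Sum>a\<in>S x \<union> (\<Union>x\<in>T. S x). f a)" by simp
  also have "\<dots> \<le> (\<Sum>a\<in>S x. f a) + (\<Sum>a\<in>(\<Union>x\<in>T. S x). f a)"
    using insert by (subst sum_Un) (auto intro!: sum_nonneg assms(3))
  also have "\<dots> \<le> (\<Sum>x\<in>insert x T. \<Sum>a\<in>S x. f a)"
    using insert by simp
  finally show ?case .
qed simp

context ballistic_environment
begin

abbreviation scaled_law :: "nat \<Rightarrow> (real ^ 'd) measure" where
  "scaled_law n \<equiv> distr (annealed_law P) borel (\<lambda>X. (1 / real n) *\<^sub>R real_vec (X n))"

lemma tilted_mass_bounds: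
  assumes \<Gamma>: "\<Gamma> \<in> sets borel" and sub: "\<Gamma> \<subseteq> cball x \<delta>" and n: "0 < n" and d: "0 \<le> \<delta>"
  shows "(\<Sum>ss | ss \<in> step_lists unit_steps n \<and> (1 / real n) *\<^sub>R real_vec (sum_list ss) \<in> \<Gamma>. aweight ss * tilt \<beta> ss)
           \<le> exp (\<beta> \<bullet> x + norm \<beta> * \<delta>) ^ n * measure (scaled_law n) \<Gamma>" (is ?upper)
    and "exp (\<beta> \<bullet> x - norm \<beta> * \<delta>) ^ n * measure (scaled_law n) \<Gamma> \<le> pathsum \<beta> (\<lambda>_. True) n" (is ?lower)
proof -
  let ?S = "{ss. ss \<in> step_lists unit_steps n \<and> (1 / real n) *\<^sub>R real_vec (sum_list ss) \<in> \<Gamma>}"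
  have t: "exp (\<beta> \<bullet> x - norm \<beta> * \<delta>) ^ n \<le> tilt \<beta> ss" "tilt \<beta> ss \<le> exp (\<beta> \<bullet> x + norm \<beta> * \<delta>) ^ n"
    if ss: "ss \<in> ?S" for ss
  proof -
    let ?y = "(1 / real n) *\<^sub>R real_vec (sum_list ss)"
    have "\<bar>\<beta> \<bullet> (?y - x)\<bar> \<le> norm \<beta> * norm (?y - x)" by (rule Cauchy_Schwarz_ineq2)
    also have "\<dots> \<le> norm \<beta> * \<delta>"
      using ss sub by (intro mult_left_mono) (auto simp: dist_norm norm_minus_commute)
    finally have le: "\<bar>\<beta> \<bullet> ?y - \<beta> \<bullet> x\<bar> \<le> norm \<beta> * \<delta>" by (simp add: inner_diff_right)
    have tl: "tilt \<beta> ss = exp (real n * (\<beta> \<bullet> ?y))"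
      using n by (simp add: tilt_def)
    show "exp (\<beta> \<bullet> x - norm \<beta> * \<delta>) ^ n \<le> tilt \<beta> ss" "tilt \<beta> ss \<le> exp (\<beta> \<bullet> x + norm \<beta> * \<delta>) ^ n"
      unfolding tl exp_of_nat_mult[symmetric] exp_le_cancel_iff
      using le by (auto intro!: mult_left_mono simp del: inner_scaleR_right)
  qed
  have m: "measure (scaled_law n) \<Gamma> = (\<Sum>ss\<in>?S. aweight ss)"
    by (rule measure_scaled_position[OF \<Gamma>])
  show ?upper
    unfolding m sum_distrib_left
  proof (rule sum_mono)
    fix ss assume "ss \<in> ?S"
    from mult_left_mono[OF t(2)[OF this] aweight_nonneg[of ss]]
    show "aweight ss * tilt \<beta> ss \<le> exp (\<beta> \<bullet> x + norm \<beta> * \<delta>) ^ n * aweight ss"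
      by (subst (2) mult.commute)
  qed
  have "exp (\<beta> \<bullet> x - norm \<beta> * \<delta>) ^ n * measure (scaled_law n) \<Gamma> \<le> (\<Sum>ss\<in>?S. aweight ss * tilt \<beta> ss)"
    unfolding m sum_distrib_left
  proof (rule sum_mono)
    fix ss assume "ss \<in> ?S"
    from mult_left_mono[OF t(1)[OF this] aweight_nonneg[of ss]]
    show "exp (\<beta> \<bullet> x - norm \<beta> * \<delta>) ^ n * aweight ss \<le> aweight ss * tilt \<beta> ss"
      by (subst mult.commute)
  qed
  also have "\<dots> \<le> pathsum \<beta> (\<lambda>_. True) n"
    unfolding pathsum_def
    by (intro sum_mono2 finite_paths) (auto intro!: mult_nonneg_nonneg aweight_nonneg less_imp_le[OF tilt_pos])
  finally show ?lower .
qed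

text \<open>Exponential Chebyshev inequality on small balls around \<open>x\<close>, combined with the lower bound of the large
deviation principle.\<close>

lemma rate_function_lower_bound:
  assumes H: "annealed_rate_function P H"
    and C: "0 < C" "\<And>n. pathsum \<beta> (\<lambda>_. True) n * exp \<mu> ^ n \<le> C"
  shows "ereal (\<beta> \<bullet> x + \<mu>) \<le> H x"
proof -
  have "ereal (\<beta> \<bullet> x + \<mu> - norm \<beta> * \<delta>) \<le> H x" if \<delta>: "0 < \<delta>" for \<delta>
  proof -
    let ?\<kappa> = "\<beta> \<bullet> x + \<mu> - norm \<beta> * \<delta>"
    \<comment> \<open>the maximum with \<open>1\<close> covers \<open>n = 0\<close>, where the scaled position is \<open>0\<close> by convention\<close>
    have m: "measure (scaled_law n) (ball x \<delta>) \<le> max C 1 * exp (- ?\<kappa>) ^ n" for n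
    proof (cases "n = 0")
      case True
      interpret A: prob_space "annealed_law P" by (rule annealed_law_prob(1))
      have "(\<lambda>X. (1 / real n) *\<^sub>R real_vec (X n)) \<in> annealed_law P \<rightarrow>\<^sub>M (borel :: (real ^ 'd) measure)"
        by (simp add: True)
      then interpret S: prob_space "scaled_law n" by (rule A.prob_space_distr)
      show ?thesis using S.prob_le_1[of "ball x \<delta>"] unfolding True by simp
    next
      case False
      have "exp (\<beta> \<bullet> x - norm \<beta> * \<delta>) ^ n * measure (scaled_law n) (ball x \<delta>) * exp \<mu> ^ n \<le> C"
        by (rule order_trans[OF mult_right_mono C(2)], rule tilted_mass_bounds(2))
          (use False \<delta> in auto)
      moreover have "exp ?\<kappa> ^ n = exp (\<beta> \<bullet> x - norm \<beta> * \<delta>) ^ n * exp \<mu> ^ n"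
        by (simp add: power_mult_distrib[symmetric] exp_add[symmetric] algebra_simps)
      ultimately have "exp ?\<kappa> ^ n * measure (scaled_law n) (ball x \<delta>) \<le> C"
        by (simp add: mult_ac)
      then have "measure (scaled_law n) (ball x \<delta>) \<le> C / exp ?\<kappa> ^ n"
        by (simp add: pos_le_divide_eq mult.commute)
      also have "\<dots> = C * exp (- ?\<kappa>) ^ n"
        by (simp only: exp_minus power_inverse divide_inverse)
      also have "\<dots> \<le> max C 1 * exp (- ?\<kappa>) ^ n" by (intro mult_right_mono) auto
      finally show ?thesis .
    qed
    have "- (INF v\<in>interior (ball x \<delta>). H v) \<le>
       liminf (\<lambda>n. ereal (1 / real n) * ereal_ln (measure (scaled_law n) (ball x \<delta>)))"
      using H by (intro large_deviation_principleD(1)) (auto simp: annealed_rate_function_def)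
    also have "\<dots> \<le> ereal (- ?\<kappa>)"
      by (rule liminf_ereal_ln_le[OF _ m]) simp
    finally have "ereal ?\<kappa> \<le> (INF v\<in>interior (ball x \<delta>). H v)"
      by (metis ereal_minus_le_minus uminus_ereal.simps(1) minus_minus)
    also have "\<dots> \<le> H x" using \<delta> by (intro INF_lower) simp
    finally show ?thesis .
  qed
  note le = this
  show ?thesis
  proof (cases "H x")
    case (real r)
    have "\<beta> \<bullet> x + \<mu> \<le> r + e" if e: "0 < e" for e
    proof -
      have "\<beta> \<bullet> x + \<mu> - norm \<beta> * (e / (norm \<beta> + 1)) \<le> r"
        using le[of "e / (norm \<beta> + 1)"] e by (simp add: real add_nonneg_pos)
      moreover have "norm \<beta> * (e / (norm \<beta> + 1)) \<le> e"
        by (rule scaled_radius_le(1)) (use e in auto)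
      ultimately show ?thesis by linarith
    qed
    then show ?thesis by (simp add: real field_le_epsilon)
  next
    case MInf
    then show ?thesis using le[of 1] by simp
  qed simp
qed

text \<open>If \<open>H\<close> were strictly above \<open>y \<mapsto> \<beta> \<bullet> y + \<mu>\<close> everywhere, then on a small ball around each point the upper bound
of the large deviation principle would make the tilted mass smaller than \<open>exp (- \<mu> * n)\<close> by an exponential
factor. Finitely many such balls cover the unit ball, which contains \<open>X\<^sub>n / n\<close>, and this contradicts
the lower bound on the partition function.\<close>

lemma rate_function_touches:
  assumes H: "annealed_rate_function P H"
    and low: "\<And>\<epsilon>. 0 < \<epsilon> \<Longrightarrow> \<epsilon> < \<epsilon>0 \<Longrightarrow> \<exists>c>0. \<forall>n. c \<le> pathsum \<beta> (\<lambda>_. True) n * exp (\<mu> + \<epsilon>) ^ n"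
    and e0: "0 < \<epsilon>0"
  shows "\<exists>x. H x \<le> ereal (\<beta> \<bullet> x + \<mu>)"
proof (rule ccontr)
  assume "\<not> ?thesis"
  then have gt: "ereal (\<beta> \<bullet> x + \<mu>) < H x" for x by (simp add: not_le)
  have good: "good_rate_function H" using H by (simp add: annealed_rate_function_def)
  have "\<exists>\<delta> \<eta>. 0 < \<delta> \<and> 0 < \<eta> \<and> norm \<beta> * \<delta> \<le> \<eta> \<and>
      ereal (\<beta> \<bullet> x + \<mu> + 4 * \<eta>) \<le> (INF v\<in>cball x \<delta>. H v)" for x
  proof -
    obtain k where k: "\<beta> \<bullet> x + \<mu> < k" "ereal k < H x"
      using ereal_dense2[OF gt[of x]] by auto
    \<comment> \<open>one share of the gap for the tilt on the ball, one for the upper bound; two are left over\<close>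
    define \<eta> where "\<eta> = (k - (\<beta> \<bullet> x + \<mu>)) / 4"
    have \<eta>: "0 < \<eta>" "k = \<beta> \<bullet> x + \<mu> + 4 * \<eta>" using k(1) by (auto simp: \<eta>_def field_simps)
    have "0 < \<eta> / (norm \<beta> + 1)" using \<eta>(1) by (simp add: add_nonneg_pos)
    from good_rate_lower_semicontinuous[OF good k(2) this] obtain \<delta> where
      \<delta>: "0 < \<delta>" "\<delta> \<le> \<eta> / (norm \<beta> + 1)" "ereal k \<le> (INF v\<in>cball x \<delta>. H v)" by blast
    have "norm \<beta> * \<delta> \<le> (norm \<beta> + 1) * (\<eta> / (norm \<beta> + 1))"
      using \<delta>(1,2) \<eta>(1) by (intro mult_mono) auto
    also have "\<dots> = \<eta>" by (rule scaled_radius_le(2)) (use \<eta>(1) in auto)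
    finally show ?thesis using \<delta> \<eta> by blast
  qed
  then obtain \<delta> \<eta> where *: "\<And>x. 0 < \<delta> x" "\<And>x. 0 < \<eta> x" "\<And>x. norm \<beta> * \<delta> x \<le> \<eta> x"
      "\<And>x. ereal (\<beta> \<bullet> x + \<mu> + 4 * \<eta> x) \<le> (INF v\<in>cball x (\<delta> x). H v)" by metis
  have cov: "\<exists>T. finite T \<and> cball (0 :: real ^ 'd) 1 \<subseteq> (\<Union>x\<in>T. ball x (\<delta> x))"
  proof -
    obtain T where "T \<subseteq> cball 0 1" "finite T" "cball (0 :: real ^ 'd) 1 \<subseteq> (\<Union>x\<in>T. ball x (\<delta> x))"
      by (rule compactE_image[OF compact_cball[of "0 :: real ^ 'd" 1], of "cball 0 1" "\<lambda>x. ball x (\<delta> x)"])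
        (use *(1) in \<open>auto intro!: bexI centre_in_ball[THEN iffD2]\<close>)
    then show ?thesis by blast
  qed
  then obtain T where T: "finite T" "cball (0 :: real ^ 'd) 1 \<subseteq> (\<Union>x\<in>T. ball x (\<delta> x))" by blast
  define \<epsilon> where "\<epsilon> = Min (insert (\<epsilon>0 / 2) (\<eta> ` T))"
  have \<epsilon>: "0 < \<epsilon>" "\<epsilon> < \<epsilon>0" "\<And>x. x \<in> T \<Longrightarrow> \<epsilon> \<le> \<eta> x"
  proof -
    show "0 < \<epsilon>" unfolding \<epsilon>_def using T(1) *(2) e0 by (subst Min_gr_iff) auto
    have "\<epsilon> \<le> \<epsilon>0 / 2" unfolding \<epsilon>_def using T(1) by (intro Min_le) auto
    then show "\<epsilon> < \<epsilon>0" using e0 by linarith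
    show "\<epsilon> \<le> \<eta> x" if "x \<in> T" for x unfolding \<epsilon>_def using T(1) that by (intro Min_le) auto
  qed
  obtain c where c: "0 < c" "\<And>n. c \<le> pathsum \<beta> (\<lambda>_. True) n * exp (\<mu> + \<epsilon>) ^ n"
    using low[OF \<epsilon>(1,2)] by blast
  have ev: "\<forall>\<^sub>F n in sequentially. \<forall>x\<in>T. measure (scaled_law n) (cball x (\<delta> x)) \<le> exp (- (\<beta> \<bullet> x + \<mu> + 3 * \<eta> x)) ^ n"
  proof (rule eventually_ball_finite[OF T(1)], intro ballI)
    fix x
    have "limsup (\<lambda>n. ereal (1 / real n) * ereal_ln (measure (scaled_law n) (cball x (\<delta> x)))) \<le>
       - (INF v\<in>closure (cball x (\<delta> x)). H v)"
      using H by (intro large_deviation_principleD(2)) (auto simp: annealed_rate_function_def)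
    also have "\<dots> \<le> - ereal (\<beta> \<bullet> x + \<mu> + 4 * \<eta> x)"
      using *(4)[of x] by (simp only: ereal_minus_le_minus closure_closed[OF closed_cball])
    also have "\<dots> < ereal (- (\<beta> \<bullet> x + \<mu> + 3 * \<eta> x))" using *(2)[of x] by simp
    finally show "\<forall>\<^sub>F n in sequentially. measure (scaled_law n) (cball x (\<delta> x)) \<le> exp (- (\<beta> \<bullet> x + \<mu> + 3 * \<eta> x)) ^ n"
      by (rule eventually_le_exp)
  qed
  have Z: "\<forall>\<^sub>F n in sequentially. pathsum \<beta> (\<lambda>_. True) n \<le> real (card T) * exp (- (\<mu> + 2 * \<epsilon>)) ^ n"
    using ev eventually_gt_at_top[of 0]
  proof eventually_elim
    case (elim n)
    let ?S = "\<lambda>x. {ss. ss \<in> step_lists unit_steps n \<and> (1 / real n) *\<^sub>R real_vec (sum_list ss) \<in> cball x (\<delta> x)}"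
    have sub: "step_lists unit_steps n \<subseteq> (\<Union>x\<in>T. ?S x)"
    proof
      fix ss :: "(int ^ 'd) list" assume ss: "ss \<in> step_lists unit_steps n"
      have "norm ((1 / real n) *\<^sub>R real_vec (sum_list ss)) \<le> 1"
        using norm_real_vec_sum_list[OF ss] elim(2) by (simp add: field_simps)
      then have "(1 / real n) *\<^sub>R real_vec (sum_list ss) \<in> (\<Union>x\<in>T. ball x (\<delta> x))"
        using T(2) by (auto simp: dist_norm subset_iff)
      then show "ss \<in> (\<Union>x\<in>T. ?S x)" using ss by (auto intro: less_imp_le)
    qed
    have "pathsum \<beta> (\<lambda>_. True) n = (\<Sum>ss\<in>step_lists unit_steps n. aweight ss * tilt \<beta> ss)"
      by (simp add: pathsum_def)
    also have "\<dots> \<le> (\<Sum>ss\<in>(\<Union>x\<in>T. ?S x). aweight ss * tilt \<beta> ss)"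
      by (intro sum_mono2 finite_UN_I T(1) finite_paths sub)
        (auto intro!: mult_nonneg_nonneg aweight_nonneg less_imp_le[OF tilt_pos])
    also have "\<dots> \<le> (\<Sum>x\<in>T. \<Sum>ss\<in>?S x. aweight ss * tilt \<beta> ss)"
      by (rule sum_UNION_le[OF T(1)])
        (auto intro!: mult_nonneg_nonneg aweight_nonneg less_imp_le[OF tilt_pos] finite_paths)
    also have "\<dots> \<le> (\<Sum>x\<in>T. exp (- (\<mu> + 2 * \<epsilon>)) ^ n)"
    proof (rule sum_mono)
      fix x assume x: "x \<in> T"
      have "(\<Sum>ss\<in>?S x. aweight ss * tilt \<beta> ss) \<le>
        exp (\<beta> \<bullet> x + norm \<beta> * \<delta> x) ^ n * measure (scaled_law n) (cball x (\<delta> x))"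
        by (rule tilted_mass_bounds(1)) (use elim(2) *(1)[of x] in auto)
      also have "\<dots> \<le> exp (\<beta> \<bullet> x + \<eta> x) ^ n * exp (- (\<beta> \<bullet> x + \<mu> + 3 * \<eta> x)) ^ n"
        using elim(1) x *(3)[of x] by (intro mult_mono power_mono) auto
      also have "\<dots> = exp (- (\<mu> + 2 * \<eta> x)) ^ n"
        unfolding power_mult_distrib[symmetric] exp_add[symmetric] by (simp add: algebra_simps)
      also have "\<dots> \<le> exp (- (\<mu> + 2 * \<epsilon>)) ^ n"
        using \<epsilon>(3)[OF x] by (intro power_mono) auto
      finally show "(\<Sum>ss\<in>?S x. aweight ss * tilt \<beta> ss) \<le> exp (- (\<mu> + 2 * \<epsilon>)) ^ n" .
    qed
    finally show ?case by simp
  qed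
  have "(\<lambda>n. real (card T) * exp (- \<epsilon>) ^ n) \<longlonglongrightarrow> real (card T) * 0"
    using \<epsilon>(1) by (intro tendsto_mult tendsto_const LIMSEQ_power_zero) auto
  then have "\<forall>\<^sub>F n in sequentially. real (card T) * exp (- \<epsilon>) ^ n < c"
    using c(1) by (intro order_tendstoD(2)) auto
  from eventually_conj[OF this Z] obtain n where n: "real (card T) * exp (- \<epsilon>) ^ n < c"
      "pathsum \<beta> (\<lambda>_. True) n \<le> real (card T) * exp (- (\<mu> + 2 * \<epsilon>)) ^ n"
    unfolding eventually_sequentially by blast
  have "c \<le> real (card T) * exp (- (\<mu> + 2 * \<epsilon>)) ^ n * exp (\<mu> + \<epsilon>) ^ n"
    by (rule order_trans[OF c(2) mult_right_mono[OF n(2)]]) simp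
  also have "\<dots> = real (card T) * exp (- \<epsilon>) ^ n"
    by (simp add: mult.assoc power_mult_distrib[symmetric] exp_add[symmetric])
  finally show False using n(1) by simp
qed

text \<open>By the law of large numbers the mass of every ball around \<open>v\<close> tends to \<open>1\<close>; if \<open>H v\<close> were positive, the
mass of a small one would tend to \<open>0\<close>.\<close>

lemma rate_function_at_velocity:
  assumes H: "annealed_rate_function P H" and v: "limiting_velocity P v"
  shows "H v \<le> 0"
proof (rule ccontr)
  assume "\<not> H v \<le> 0"
  then obtain k where k: "0 < k" "ereal k < H v"
    using ereal_dense2[of 0 "H v"] by (auto simp: not_le)
  have good: "good_rate_function H" using H by (simp add: annealed_rate_function_def)
  obtain \<delta> where \<delta>: "0 < \<delta>" "ereal k \<le> (INF x\<in>cball v \<delta>. H x)"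
    using good_rate_lower_semicontinuous[OF good k(2), of 1] by auto
  have "limsup (\<lambda>n. ereal (1 / real n) * ereal_ln (measure (scaled_law n) (cball v \<delta>))) \<le>
       - (INF x\<in>closure (cball v \<delta>). H x)"
    using H by (intro large_deviation_principleD(2)) (auto simp: annealed_rate_function_def)
  also have "\<dots> \<le> - ereal k"
    using \<delta>(2) by (simp only: ereal_minus_le_minus closure_closed[OF closed_cball])
  also have "\<dots> < ereal (- (k / 2))" using k by simp
  finally have ev: "\<forall>\<^sub>F n in sequentially. measure (scaled_law n) (cball v \<delta>) \<le> exp (- (k / 2)) ^ n"
    by (rule eventually_le_exp)
  interpret A: prob_space "annealed_law P" by (rule annealed_law_prob(1))
  have meas: "(\<lambda>X. (1 / real n) *\<^sub>R real_vec (X n)) \<in> annealed_law P \<rightarrow>\<^sub>M (borel :: (real ^ 'd) measure)" for n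
    unfolding measurable_cong_sets[OF annealed_law_prob(2) refl] path_space_def
    by (rule measurable_compose[OF measurable_component_singleton]) auto
  have "(\<lambda>n. \<integral>X. indicator (cball v \<delta>) ((1 / real n) *\<^sub>R real_vec (X n)) \<partial>annealed_law P) \<longlonglongrightarrow>
      (\<integral>X. (1::real) \<partial>annealed_law P)"
  proof (rule integral_dominated_convergence[where w="\<lambda>_. 1"])
    show "AE X in annealed_law P. (\<lambda>n. indicator (cball v \<delta>) ((1 / real n) *\<^sub>R real_vec (X n))) \<longlonglongrightarrow> (1::real)"
      using v[unfolded limiting_velocity_def, THEN conjunct2]
    proof eventually_elim
      case (elim X)
      then have "\<forall>\<^sub>F n in sequentially. (1 / real n) *\<^sub>R real_vec (X n) \<in> ball v \<delta>"
        using \<delta>(1) by (intro topological_tendstoD) auto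
      then have "\<forall>\<^sub>F n in sequentially. indicator (cball v \<delta>) ((1 / real n) *\<^sub>R real_vec (X n)) = (1::real)"
        by eventually_elim auto
      then show ?case by (rule tendsto_eventually)
    qed
    show "(\<lambda>X. indicator (cball v \<delta>) ((1 / real n) *\<^sub>R real_vec (X n))) \<in> borel_measurable (annealed_law P)" for n
      by (rule measurable_compose[OF meas]) (intro borel_measurable_indicator, simp)
    show "AE X in annealed_law P. norm (indicator (cball v \<delta>) ((1 / real n) *\<^sub>R real_vec (X n)) :: real) \<le> 1" for n
      by (intro AE_I2) (simp add: indicator_def)
  qed simp_all
  also have "(\<lambda>n. \<integral>X. indicator (cball v \<delta>) ((1 / real n) *\<^sub>R real_vec (X n)) \<partial>annealed_law P) =
      (\<lambda>n. measure (scaled_law n) (cball v \<delta>))"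
  proof
    fix n
    have "(indicator (cball v \<delta>) :: real ^ 'd \<Rightarrow> real) \<in> borel_measurable borel"
      by (intro borel_measurable_indicator) simp
    from integral_distr[OF meas this, of n]
    show "(\<integral>X. indicator (cball v \<delta>) ((1 / real n) *\<^sub>R real_vec (X n)) \<partial>annealed_law P) = measure (scaled_law n) (cball v \<delta>)"
      by simp
  qed
  finally have "(\<lambda>n. measure (scaled_law n) (cball v \<delta>)) \<longlonglongrightarrow> 1" by (simp add: A.prob_space)
  moreover have "(\<lambda>n. exp (- (k / 2)) ^ n) \<longlonglongrightarrow> 0"
    using k(1) by (intro LIMSEQ_power_zero) auto
  ultimately have "(1::real) \<le> 0"
    using ev by (intro tendsto_le[OF sequentially_bot])
  then show False by simp
qed

end

section \<open>The generating function of the pieces\<close>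

context ballistic_environment
begin

text \<open>The exponent \<open>\<beta> \<bullet> X + \<mu> * n\<close> of a path of length \<open>n\<close> with displacement \<open>X\<close>, for complex \<open>\<beta>\<close> and \<open>\<mu>\<close>.\<close>

definition exponent :: "(int ^ 'd) list \<Rightarrow> (complex ^ 'd) \<times> complex \<Rightarrow> complex" where
  "exponent ss z = (\<Sum>i\<in>UNIV. fst z $ i * of_int (sum_list ss $ i)) + snd z * of_nat (length ss)"

definition pieces :: "nat \<Rightarrow> (int ^ 'd) list set" where
  "pieces n = {ss. ss \<in> step_lists unit_steps n \<and> piece ss}"

definition slope :: real where "slope = real CARD('d) + 1"

text \<open>On the ball with this radius the exponentials grow by less than \<open>1 / sqrt rate\<close> per step.\<close>

definition radius :: real where "radius = - ln rate / (2 * slope)"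

lemma slope_ge_2: "2 \<le> slope"
proof -
  have "1 \<le> CARD('d)" by (simp add: Suc_leI)
  then show ?thesis by (simp add: slope_def)
qed

lemma radius_pos: "0 < radius"
  using rate(1,2) slope_ge_2 by (simp add: radius_def divide_less_0_iff)

lemma rate_radius: "rate * exp (slope * radius) < 1"
proof -
  have "slope * radius = - ln rate / 2" using slope_ge_2 by (simp add: radius_def)
  also have "\<dots> < - ln rate" using rate by simp
  finally have "rate * exp (slope * radius) < rate * exp (- ln rate)" using rate by simp
  also have "\<dots> = 1" using rate by (simp add: exp_minus)
  finally show ?thesis .
qed

lemma exponent_bound:
  assumes "ss \<in> pieces n"
  shows "cmod (exponent ss z) \<le> slope * real n * norm z"
proof -
  have ss: "ss \<in> step_lists unit_steps n" using assms by (simp add: pieces_def)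
  then have len: "length ss = n" by (simp add: step_lists_def)
  have x: "\<bar>real_of_int (sum_list ss $ i)\<bar> \<le> real n" for i
    using order_trans[OF component_le_norm_cart[of "real_vec (sum_list ss)" i] norm_real_vec_sum_list[OF ss]]
    by (simp add: real_vec_def)
  have "cmod (exponent ss z) \<le> (\<Sum>i\<in>(UNIV::'d set). norm z * real n) + norm z * real n"
    unfolding exponent_def
  proof (intro order_trans[OF norm_triangle_ineq] add_mono order_trans[OF norm_sum] sum_mono)
    fix i
    have "cmod (fst z $ i) \<le> norm z"
      using order_trans[OF Finite_Cartesian_Product.norm_nth_le norm_fst_le[of "fst z" "snd z"]] by simp
    then show "cmod (fst z $ i * of_int (sum_list ss $ i)) \<le> norm z * real n"
      unfolding norm_mult norm_of_int using x by (intro mult_mono) auto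
    show "cmod (snd z * of_nat (length ss)) \<le> norm z * real n"
      unfolding norm_mult norm_of_nat len using norm_snd_le[of "snd z" "fst z"] by (intro mult_right_mono) simp_all
  qed
  then show ?thesis by (simp add: slope_def algebra_simps)
qed

lemma exponent_linear: "bounded_linear (exponent ss)"
  unfolding exponent_def
  by (intro bounded_linear_add bounded_linear_sum bounded_linear_mult_const
      bounded_linear_compose[OF bounded_linear_vec_nth bounded_linear_fst] bounded_linear_snd)

lemma singleton_piece:
  assumes "s \<in> unit_steps" "1 \<le> h s"
  shows "[s] \<in> pieces 1"
proof -
  have "0 \<le> h (sum_list (take k [s]))" for k using assms(2) by (cases k) auto
  then show ?thesis
    using assms by (auto simp: pieces_def piece_def step_lists_def breaking_def forward_def)
qed

lemma delayed_piece:
  assumes "s \<in> unit_steps" "1 \<le> h s" "e \<in> unit_steps" "h e = 0"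
  shows "[e, s] \<in> pieces 2"
proof -
  have "scan ([] @ [e]) = scan_step (h e) (scan [])" by (rule scan_snoc)
  then have sc: "scan [e] = (0, None)" using assms(4) by simp
  have "0 \<le> h (sum_list (take k [e, s]))" for k
    using assms by (cases k; cases "k - 1") (auto simp: h_add)
  then show ?thesis
    using assms sc by (auto simp: pieces_def piece_def step_lists_def breaking_def forward_def)
qed

lemma unit_steps_uminus: "s \<in> unit_steps \<Longrightarrow> - s \<in> unit_steps" for s :: "int ^ 'd"
proof -
  have "real_vec (- s) = - real_vec s" by (simp add: real_vec_def vec_eq_iff)
  then show "s \<in> unit_steps \<Longrightarrow> - s \<in> unit_steps" by (simp add: unit_steps_def)
qed

lemma h_uminus: "h (- x) = - h x"
  using h_add[of x "- x"] by simp

lemma h_double: "h (2 * x) = 2 * h x"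
  unfolding mult_2 by (rule h_add)

lemma backtracking_piece:
  assumes "s \<in> unit_steps" "1 \<le> h s"
  shows "[s, - s, s, s] \<in> pieces 4"
proof -
  have 1: "scan [s] = (0, Some 0)"
    using scan_snoc[of "[]" s] assms(2) by simp
  have 2: "scan [s, - s] = (h s, None)"
    using scan_snoc[of "[s]" "- s"] assms(2) by (simp add: 1 h_uminus)
  have 3: "scan [s, - s, s] = (0, None)"
    using scan_snoc[of "[s, - s]" s] assms(2) by (simp add: 2)
  have br: "breaking [s, - s, s, s]" using assms(2) by (simp add: breaking_def 3)
  have f: "forward [s, - s, s, s]"
    unfolding forward_def
  proof (intro allI impI)
    fix k assume "k \<le> length [s, - s, s, s]"
    then have "k \<in> {0, 1, 2, 3, 4}" by auto
    then show "0 \<le> h (sum_list (take k [s, - s, s, s]))"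
      using assms(2) by (auto simp: h_add h_uminus h_double take_Suc_Cons eval_nat_numeral)
  qed
  show ?thesis
    using assms br f unit_steps_uminus[of s] by (simp add: pieces_def piece_def step_lists_def)
qed

text \<open>The pieces \<open>[s]\<close> and \<open>[s, - s, s, s]\<close>, for an ascending step \<open>s\<close>, have displacements \<open>s\<close> and \<open>2 * s\<close> but lengths
\<open>1\<close> and \<open>4\<close>, which separates the length from the displacement. Each coordinate direction \<open>e\<close> is then reached
by one of the pieces \<open>[e]\<close>, \<open>[- e]\<close> and \<open>[e, s]\<close>.\<close>

lemma exponent_nondegenerate:
  assumes z: "\<And>n ss. ss \<in> pieces n \<Longrightarrow> 0 < aweight ss \<Longrightarrow> exponent ss z = 0"
  shows "z = 0"
proof -
  have E: "exponent ss z = 0" if "ss \<in> pieces n" for ss n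
    using that by (intro z[OF that] aweight_pos[OF elliptic]) (auto simp: pieces_def step_lists_def)
  define p where "p x = (\<Sum>i\<in>UNIV. fst z $ i * of_int (x $ i))" for x :: "int ^ 'd"
  have p_add: "p (x + y) = p x + p y" for x y by (simp add: p_def sum.distrib distrib_left)
  have p_double: "p (2 * x) = p x + p x" for x unfolding mult_2 by (rule p_add)
  have p_uminus: "p (- x) = - p x" for x by (simp add: p_def sum_negf)
  have ex: "exponent ss z = p (sum_list ss) + snd z * of_nat (length ss)" for ss
    by (simp add: exponent_def p_def)
  obtain s where s: "s \<in> unit_steps" "1 \<le> h s" using exists_forward_step by blast
  have 1: "p s + snd z = 0" using E[OF singleton_piece[OF s]] by (simp add: ex)
  have "p s + p s + snd z * 4 = 0"
    using E[OF backtracking_piece[OF s]] by (simp add: ex p_add p_uminus p_double)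
  then have q: "snd z = 0" using 1 by algebra
  then have ps: "p s = 0" using 1 by simp
  have "fst z $ i = 0" for i
  proof -
    let ?e = "axis i 1 :: int ^ 'd"
    have pe: "p ?e = fst z $ i"
      by (simp add: p_def axis_def if_distrib cong: if_cong)
    have e: "?e \<in> unit_steps" by (rule axis_unit_step)
    consider "1 \<le> h ?e" | "1 \<le> h (- ?e)" | "h ?e = 0" using h_uminus[of ?e] by linarith
    then have "p ?e = 0"
    proof cases
      case 1
      then show ?thesis using E[OF singleton_piece[OF e]] q by (simp add: ex)
    next
      case 2
      then show ?thesis using E[OF singleton_piece[OF unit_steps_uminus[OF e]]] q by (simp add: ex p_uminus)
    next
      case 3
      then show ?thesis using E[OF delayed_piece[OF s e]] q ps by (simp add: ex p_add)
    qed
    then show ?thesis using pe by simp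
  qed
  then show ?thesis using q by (simp add: prod_eq_iff vec_eq_iff)
qed

lemma exponential_series_pieces: "exponential_series pieces exponent slope radius"
proof (rule exponential_series.intro)
  fix n :: nat and ss :: "(int ^ 'd) list" and z :: "(complex ^ 'd) \<times> complex"
  show "finite (pieces n)" unfolding pieces_def by (rule finite_paths)
  show "bounded_linear (exponent ss)" by (rule exponent_linear)
  show "cmod (exponent ss z) \<le> slope * real n * norm z" if "ss \<in> pieces n" using that by (rule exponent_bound)
  show "0 \<le> slope" using slope_ge_2 by simp
  show "0 < radius" by (rule radius_pos)
qed

sublocale S: nondegenerate_series pieces exponent slope radius aweight
proof -
  interpret E: exponential_series pieces exponent slope radius by (rule exponential_series_pieces)
  have "E.decays (\<lambda>ss. of_real (aweight ss))"
    unfolding E.decays_def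
  proof (intro exI conjI allI)
    show "0 \<le> 1 / rate" "0 \<le> rate * exp (slope * radius)" "rate * exp (slope * radius) < 1"
      using rate rate_radius by auto
    fix n
    have "(\<Sum>ss\<in>pieces n. cmod (of_real (aweight ss))) \<le> 1 / rate * rate ^ n"
      using sum_piece_le_rate[of n] by (simp add: pieces_def aweight_nonneg)
    from mult_right_mono[OF this, of "exp (slope * radius) ^ n"]
    show "(\<Sum>ss\<in>pieces n. cmod (of_real (aweight ss))) * exp (slope * radius) ^ n \<le> 1 / rate * (rate * exp (slope * radius)) ^ n"
      by (simp add: power_mult_distrib mult.assoc)
  qed
  note decays = this
  show "nondegenerate_series pieces exponent slope radius aweight"
  proof (rule nondegenerate_series.intro[OF exponential_series_pieces], rule nondegenerate_series_axioms.intro)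
    fix ss :: "(int ^ 'd) list" and c and z :: "(complex ^ 'd) \<times> complex"
    show "exponent ss (cscale c z) = c * exponent ss z"
      by (simp add: exponent_def cscale_def sum_distrib_left distrib_left mult.assoc)
    show "exponent ss (conjg z) = cnj (exponent ss z)"
      by (simp add: exponent_def conjg_def)
    show "0 \<le> aweight ss" by (rule aweight_nonneg)
    show "E.decays (\<lambda>ss. of_real (aweight ss))" by (rule decays)
    show "z = 0" if "\<And>n ss. ss \<in> pieces n \<Longrightarrow> 0 < aweight ss \<Longrightarrow> exponent ss z = 0"
      using that by (rule exponent_nondegenerate)
  qed
qed

definition real_point :: "real ^ 'd \<Rightarrow> real \<Rightarrow> (complex ^ 'd) \<times> complex" where
  "real_point \<beta> \<mu> = (complexify \<beta>, of_real \<mu>)"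

lemma norm_real_point: "norm (real_point \<beta> \<mu>) = sqrt ((norm \<beta>)^2 + \<mu>^2)"
  by (simp add: real_point_def norm_Pair norm_complexify)

lemma norm_real_point_ge: "norm \<beta> \<le> norm (real_point \<beta> \<mu>)" "\<bar>\<mu>\<bar> \<le> norm (real_point \<beta> \<mu>)"
  unfolding norm_real_point by (rule real_le_rsqrt, simp)+

lemma conjg_real_point [simp]: "conjg (real_point \<beta> \<mu>) = real_point \<beta> \<mu>"
  by (simp add: real_point_def conjg_def complexify_def vec_eq_iff)

lemma real_point_line:
  "real_point (\<beta> + t *\<^sub>R p) (\<mu> + t * q) = real_point \<beta> \<mu> + t *\<^sub>R real_point p q"
  by (auto simp: real_point_def complexify_def prod_eq_iff vec_eq_iff complex_eq_iff)

lemma rate_real_point: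
  assumes "norm (real_point \<beta> \<mu>) < radius"
  shows "rate * exp (norm \<beta> + \<mu>) < 1"
proof -
  have "norm \<beta> + \<mu> \<le> 2 * radius"
    using norm_real_point_ge(1)[where \<beta>=\<beta> and \<mu>=\<mu>] norm_real_point_ge(2)[where \<beta>=\<beta> and \<mu>=\<mu>] assms
    by linarith
  also have "\<dots> \<le> slope * radius" using slope_ge_2 radius_pos by (intro mult_right_mono) auto
  finally have "rate * exp (norm \<beta> + \<mu>) \<le> rate * exp (slope * radius)" using rate(1) by simp
  then show ?thesis using rate_radius by linarith
qed

lemma exponent_real_point:
  assumes "ss \<in> pieces n"
  shows "of_real (aweight ss) * exp (exponent ss (real_point \<beta> \<mu>)) = of_real (aweight ss * tilt \<beta> ss * exp \<mu> ^ n)"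
proof -
  have "length ss = n" using assms by (simp add: pieces_def step_lists_def)
  then have "exponent ss (real_point \<beta> \<mu>) = of_real (\<beta> \<bullet> real_vec (sum_list ss) + real n * \<mu>)"
    by (simp add: exponent_def real_point_def complexify_def inner_vec_def real_vec_def mult.commute)
  then show ?thesis by (simp add: tilt_def exp_add exp_of_nat_mult exp_of_real[symmetric] mult.assoc)
qed

lemma pathsum_piece_pieces: "pathsum \<beta> piece n = (\<Sum>ss\<in>pieces n. aweight ss * tilt \<beta> ss)"
  by (simp add: pathsum_def pieces_def)

lemma S_M_real:
  assumes "norm (real_point \<beta> \<mu>) < radius"
  shows "S.M (real_point \<beta> \<mu>) = of_real (piece_gf \<beta> \<mu>)"
proof -
  have "(\<lambda>n. pathsum \<beta> piece n * exp \<mu> ^ n) sums piece_gf \<beta> \<mu>"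
    unfolding piece_gf_def by (intro summable_sums summable_piece rate_real_point assms)
  then have "(\<lambda>n. complex_of_real (pathsum \<beta> piece n * exp \<mu> ^ n)) sums of_real (piece_gf \<beta> \<mu>)"
    unfolding sums_of_real_iff .
  moreover have "(\<Sum>ss\<in>pieces n. of_real (aweight ss) * exp (exponent ss (real_point \<beta> \<mu>))) =
      complex_of_real (pathsum \<beta> piece n * exp \<mu> ^ n)" for n
    unfolding pathsum_piece_pieces sum_distrib_right of_real_sum
    by (intro sum.cong refl exponent_real_point)
  ultimately show ?thesis
    unfolding S.M_def S.moment_def by (simp only: sums_unique[symmetric])
qed

lemma pathsum_piece_1_pos: "0 < pathsum \<beta> piece 1"
proof -
  obtain s where s: "s \<in> unit_steps" "1 \<le> h s" using exists_forward_step by blast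
  have sp: "[s] \<in> pieces 1" by (rule singleton_piece[OF s])
  have "0 < aweight [s] * tilt \<beta> [s]"
    using s(1) by (intro mult_pos_pos tilt_pos aweight_pos[OF elliptic]) simp
  also have "\<dots> \<le> (\<Sum>ss\<in>pieces 1. aweight ss * tilt \<beta> ss)"
    by (rule member_le_sum[OF sp])
      (auto simp: pieces_def finite_paths intro!: mult_nonneg_nonneg aweight_nonneg less_imp_le[OF tilt_pos])
  finally show ?thesis unfolding pathsum_piece_pieces .
qed

lemma S_D_last_pos:
  assumes z: "norm (real_point \<beta> \<mu>) < radius"
  shows "0 < Re (S.D last_dir (real_point \<beta> \<mu>))"
proof -
  let ?f = "\<lambda>n. real n * (pathsum \<beta> piece n * exp \<mu> ^ n)"
  have eq: "(\<Sum>ss\<in>pieces n. of_real (aweight ss) * exponent ss last_dir * exp (exponent ss (real_point \<beta> \<mu>))) =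
      complex_of_real (?f n)" for n
    unfolding pathsum_piece_pieces sum_distrib_right sum_distrib_left of_real_sum
  proof (intro sum.cong refl)
    fix ss assume ss: "ss \<in> pieces n"
    then have "exponent ss last_dir = of_nat n"
      by (simp add: exponent_def last_dir_def pieces_def step_lists_def)
    then show "of_real (aweight ss) * exponent ss last_dir * exp (exponent ss (real_point \<beta> \<mu>)) =
        of_real (real n * (aweight ss * tilt \<beta> ss * exp \<mu> ^ n))"
      using exponent_real_point[OF ss, of \<beta> \<mu>] by (simp add: mult_ac)
  qed
  have "(\<lambda>n. complex_of_real (?f n)) sums S.D last_dir (real_point \<beta> \<mu>)"
    unfolding S.D_def S.moment_def eq[symmetric]
    by (intro summable_sums S.moment_summable S.D_decays z)
  from sums_Re[OF this] have s: "?f sums Re (S.D last_dir (real_point \<beta> \<mu>))" by simp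
  have "0 < suminf ?f"
  proof (rule suminf_pos2[where i=1])
    show "summable ?f" using s by (rule sums_summable)
    show "0 \<le> ?f n" for n by (intro mult_nonneg_nonneg pathsum_nonneg) auto
    show "0 < ?f 1" using pathsum_piece_1_pos[of \<beta>] by simp
  qed
  then show ?thesis using sums_unique[OF s] by simp
qed

lemma S_D_real:
  assumes "norm (real_point \<beta> \<mu>) < radius" "conjg e = e"
  shows "S.D e (real_point \<beta> \<mu>) = of_real (Re (S.D e (real_point \<beta> \<mu>)))"
proof -
  have "cnj (S.D e (real_point \<beta> \<mu>)) = S.D e (real_point \<beta> \<mu>)"
    using S.D_conjg[OF assms(1), of e] assms(2) by simp
  then show ?thesis by (metis Reals_cnj_iff of_real_Re)
qed

text \<open>Every piece has at least one step.\<close>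

lemma piece_gf_shift:
  assumes \<epsilon>: "0 \<le> \<epsilon>" and lt: "rate * exp (norm \<beta> + (\<mu> + \<epsilon>)) < 1"
  shows "exp \<epsilon> * piece_gf \<beta> \<mu> \<le> piece_gf \<beta> (\<mu> + \<epsilon>)"
proof -
  have "rate * exp (norm \<beta> + \<mu>) \<le> rate * exp (norm \<beta> + (\<mu> + \<epsilon>))" using \<epsilon> rate(1) by simp
  then have sm: "summable (\<lambda>n. pathsum \<beta> piece n * exp \<mu> ^ n)"
    using lt by (intro summable_piece) linarith
  have "exp \<epsilon> * piece_gf \<beta> \<mu> = (\<Sum>n. exp \<epsilon> * (pathsum \<beta> piece n * exp \<mu> ^ n))"
    unfolding piece_gf_def using sm by (rule suminf_mult[symmetric])
  also have "\<dots> \<le> piece_gf \<beta> (\<mu> + \<epsilon>)"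
    unfolding piece_gf_def
  proof (rule suminf_le[OF _ summable_mult[OF sm] summable_piece[OF lt]])
    fix n
    show "exp \<epsilon> * (pathsum \<beta> piece n * exp \<mu> ^ n) \<le> pathsum \<beta> piece n * exp (\<mu> + \<epsilon>) ^ n"
    proof (cases n)
      case 0
      then show ?thesis by (simp add: pathsum_0_breaking)
    next
      case (Suc m)
      have "exp \<epsilon> ^ 1 \<le> exp \<epsilon> ^ n" using \<epsilon> Suc by (intro power_increasing) auto
      then have "exp \<epsilon> * (pathsum \<beta> piece n * exp \<mu> ^ n) \<le> exp \<epsilon> ^ n * (pathsum \<beta> piece n * exp \<mu> ^ n)"
        by (intro mult_right_mono mult_nonneg_nonneg pathsum_nonneg) auto
      then show ?thesis by (simp add: exp_add power_mult_distrib mult_ac)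
    qed
  qed
  finally show ?thesis .
qed

text \<open>Just below \<open>\<mu>\<close> the pieces are subcritical.\<close>

lemma rate_function_above_tangent:
  assumes H: "annealed_rate_function P H"
    and z: "norm (real_point \<beta> \<mu>) < radius" and G: "piece_gf \<beta> \<mu> = 1"
  shows "ereal (\<beta> \<bullet> x + \<mu>) \<le> H x"
proof -
  have "ereal (\<beta> \<bullet> x + \<mu> - \<epsilon>) \<le> H x" if \<epsilon>: "0 < \<epsilon>" for \<epsilon>
  proof -
    have lt: "rate * exp (norm \<beta> + (\<mu> - \<epsilon>)) < 1"
    proof -
      have "rate * exp (norm \<beta> + (\<mu> - \<epsilon>)) \<le> rate * exp (norm \<beta> + \<mu>)" using \<epsilon> rate(1) by simp
      then show ?thesis using rate_real_point[OF z] by linarith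
    qed
    have "exp \<epsilon> * piece_gf \<beta> (\<mu> - \<epsilon>) \<le> 1"
      using piece_gf_shift[of \<epsilon> \<beta> "\<mu> - \<epsilon>"] \<epsilon> rate_real_point[OF z] G by simp
    moreover have "1 < exp \<epsilon>" using \<epsilon> by simp
    ultimately have "piece_gf \<beta> (\<mu> - \<epsilon>) < 1"
      by (smt (verit) mult_less_cancel_right1)
    from partition_upper[OF lt this] obtain C where
      "0 < C" "\<And>n. pathsum \<beta> (\<lambda>_. True) n * exp (\<mu> - \<epsilon>) ^ n \<le> C" by blast
    from rate_function_lower_bound[OF H this, of x] show ?thesis by (simp add: add_diff_eq)
  qed
  note le = this
  show ?thesis
  proof (cases "H x")
    case (real r)
    have "\<beta> \<bullet> x + \<mu> \<le> r + e" if "0 < e" for e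
      using le[OF that] by (simp add: real)
    then show ?thesis by (simp add: real field_le_epsilon)
  next
    case MInf
    then show ?thesis using le[of 1] by simp
  qed simp
qed

text \<open>Just above \<open>\<mu>\<close> the pieces are supercritical.\<close>

lemma rate_function_touches_tangent:
  assumes H: "annealed_rate_function P H"
    and z: "norm (real_point \<beta> \<mu>) < radius" and G: "piece_gf \<beta> \<mu> = 1"
  shows "\<exists>x. H x \<le> ereal (\<beta> \<bullet> x + \<mu>)"
proof (rule rate_function_touches[OF H])
  \<comment> \<open>keeps the series of the pieces convergent at \<open>\<mu> + \<epsilon>\<close>\<close>
  define \<epsilon>0 where "\<epsilon>0 = - ln (rate * exp (norm \<beta> + \<mu>))"
  have pos: "0 < rate * exp (norm \<beta> + \<mu>)" using rate(1) by simp
  show "0 < \<epsilon>0" using rate_real_point[OF z] pos by (simp add: \<epsilon>0_def del: ln_mult_pos)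
  fix \<epsilon> assume \<epsilon>: "0 < \<epsilon>" "\<epsilon> < \<epsilon>0"
  have "rate * exp (norm \<beta> + (\<mu> + \<epsilon>)) = (rate * exp (norm \<beta> + \<mu>)) * exp \<epsilon>"
    by (simp add: exp_add mult_ac)
  also have "\<dots> < (rate * exp (norm \<beta> + \<mu>)) * exp \<epsilon>0"
    using \<epsilon> pos by (intro mult_strict_left_mono) auto
  also have "\<dots> = 1"
    unfolding \<epsilon>0_def exp_minus exp_ln[OF pos] using rate(1) by (intro right_inverse) simp
  finally have lt: "rate * exp (norm \<beta> + (\<mu> + \<epsilon>)) < 1" .
  have "1 < exp \<epsilon>" using \<epsilon> by simp
  also have "\<dots> \<le> piece_gf \<beta> (\<mu> + \<epsilon>)"
    using piece_gf_shift[OF less_imp_le[OF \<epsilon>(1)] lt] G by simp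
  finally show "\<exists>c>0. \<forall>n. c \<le> pathsum \<beta> (\<lambda>_. True) n * exp (\<mu> + \<epsilon>) ^ n"
    by (rule partition_lower[OF lt])
qed

lemma piece_gf_line_derivative:
  assumes z: "norm (real_point \<beta> \<mu>) < radius"
  shows "((\<lambda>t. Re (S.M (real_point (\<beta> + t *\<^sub>R p) (\<mu> + t * q)))) has_real_derivative
     Re (S.D (real_point p q) (real_point \<beta> \<mu>))) (at 0)"
proof -
  let ?z = "real_point \<beta> \<mu>" and ?e = "real_point p q"
  have "((\<lambda>t. ?z + t *\<^sub>R ?e) has_derivative (\<lambda>t. t *\<^sub>R ?e)) (at 0)"
    by (auto intro!: derivative_eq_intros)
  from has_derivative_compose[OF this, of S.M "\<lambda>h. S.D h ?z"] S.M_has_derivative[OF z]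
  have "((\<lambda>t. S.M (?z + t *\<^sub>R ?e)) has_derivative (\<lambda>t. S.D (t *\<^sub>R ?e) ?z)) (at 0)" by simp
  from has_derivative_Re[OF this]
  have "((\<lambda>t. Re (S.M (?z + t *\<^sub>R ?e))) has_derivative (\<lambda>t. Re (S.D (t *\<^sub>R ?e) ?z))) (at 0)" .
  also have "(\<lambda>t. Re (S.D (t *\<^sub>R ?e) ?z)) = (*) (Re (S.D ?e ?z))"
  proof
    fix t
    have "t *\<^sub>R ?e = cscale (of_real t) ?e"
      by (auto simp: real_point_def cscale_def complexify_def prod_eq_iff vec_eq_iff complex_eq_iff)
    then have "S.D (t *\<^sub>R ?e) ?z = of_real t * S.D ?e ?z" by (simp only: S.D_cscale[OF z])
    then show "Re (S.D (t *\<^sub>R ?e) ?z) = Re (S.D ?e ?z) * t" by simp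
  qed
  finally show ?thesis unfolding has_field_derivative_def real_point_line .
qed

text \<open>A short move in the direction \<open>(p, q)\<close> makes the pieces subcritical, so it yields another affine minorant
of \<open>H\<close>, which cannot exceed \<open>H\<close> at \<open>x\<close>.\<close>

lemma touching_point_direction:
  assumes H: "annealed_rate_function P H"
    and z: "norm (real_point \<beta> \<mu>) < radius" and G: "piece_gf \<beta> \<mu> = 1"
    and x: "H x \<le> ereal (\<beta> \<bullet> x + \<mu>)"
    and neg: "Re (S.D (real_point p q) (real_point \<beta> \<mu>)) < 0"
  shows "p \<bullet> x + q \<le> 0"
proof -
  let ?zt = "\<lambda>t. real_point (\<beta> + t *\<^sub>R p) (\<mu> + t * q)"
  obtain d where d: "0 < d" "\<And>t. 0 < t \<Longrightarrow> t < d \<Longrightarrow> Re (S.M (?zt t)) < Re (S.M (?zt 0))"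
    using DERIV_neg_dec_right[OF piece_gf_line_derivative[OF z] neg] by auto
  have "((\<lambda>t. norm (?zt t)) \<longlongrightarrow> norm (?zt 0)) (at_right 0)"
    unfolding real_point_line by (intro tendsto_intros)
  then have "\<forall>\<^sub>F t in at_right 0. norm (?zt t) < radius"
    using z by (intro order_tendstoD(2)) auto
  moreover have "\<forall>\<^sub>F t in at_right 0. t < d" by (rule eventually_at_right_real[OF d(1), THEN eventually_mono]) auto
  moreover have "\<forall>\<^sub>F t in at_right (0::real). 0 < t" by (rule eventually_at_right_less)
  ultimately have "\<forall>\<^sub>F t in at_right 0. norm (?zt t) < radius \<and> t < d \<and> 0 < t"
    by eventually_elim simp
  then obtain t where t: "norm (?zt t) < radius" "t < d" "0 < t"
    using eventually_happens'[OF trivial_limit_at_right_real] by blast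
  have "Re (S.M (?zt t)) < 1"
    using d(2)[OF t(3,2)] S_M_real[OF z] G by simp
  then have "piece_gf (\<beta> + t *\<^sub>R p) (\<mu> + t * q) < 1" using S_M_real[OF t(1)] by simp
  from partition_upper[OF rate_real_point[OF t(1)] this] obtain C where
    "0 < C" "\<And>n. pathsum (\<beta> + t *\<^sub>R p) (\<lambda>_. True) n * exp (\<mu> + t * q) ^ n \<le> C" by blast
  from order_trans[OF rate_function_lower_bound[OF H this, of x] x]
  have "t * (p \<bullet> x + q) \<le> 0" by (simp add: inner_add_left distrib_left)
  then show ?thesis using t(3) by (simp add: mult_le_0_iff)
qed

text \<open>By the preceding lemma the half space in which the derivative is negative is contained in the one bounded by
the hyperplane orthogonal to \<open>(x, 1)\<close>. So \<open>(x, 1)\<close> is a positive multiple of the gradient.\<close>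

lemma touching_point_gradient:
  assumes H: "annealed_rate_function P H"
    and z: "norm (real_point \<beta> \<mu>) < radius" and G: "piece_gf \<beta> \<mu> = 1"
    and x: "H x \<le> ereal (\<beta> \<bullet> x + \<mu>)"
  shows "S.D (unit_dir i) (real_point \<beta> \<mu>) / S.D last_dir (real_point \<beta> \<mu>) = of_real (x $ i)"
proof -
  let ?z = "real_point \<beta> \<mu>"
  define N where "N = Re (S.D last_dir ?z)"
  define a where "a = Re (S.D (unit_dir i) ?z)"
  have N: "0 < N" unfolding N_def by (rule S_D_last_pos[OF z])
  have dir: "Re (S.D (real_point (axis i \<sigma>) q) ?z) = \<sigma> * a + q * N" for \<sigma> q
  proof -
    have "real_point (axis i \<sigma>) q = cscale (of_real \<sigma>) (unit_dir i) + cscale (of_real q) last_dir"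
      by (simp add: real_point_def complexify_def cscale_def unit_dir_def last_dir_def prod_eq_iff vec_eq_iff axis_def)
    moreover have "S.D (e + f) ?z = S.D e ?z + S.D f ?z" for e f
      by (rule linear_add[OF bounded_linear.linear[OF has_derivative_bounded_linear[OF S.M_has_derivative[OF z]]]])
    ultimately show ?thesis by (simp add: S.D_cscale[OF z] a_def N_def)
  qed
  have key: "\<sigma> * x $ i + q \<le> 0" if "\<sigma> * a + q * N < 0" for \<sigma> q
    using touching_point_direction[OF H z G x, of "axis i \<sigma>" q] that
    by (simp add: dir inner_commute[of "axis i \<sigma>"] inner_axis mult.commute)
  have "\<sigma> * x $ i \<le> \<sigma> * (a / N)" if "\<sigma> = 1 \<or> \<sigma> = - 1" for \<sigma> :: real
  proof (rule field_le_epsilon)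
    fix e :: real assume "0 < e"
    \<comment> \<open>the direction along the level set in the plane of the \<open>i\<close>th axis, pushed slightly to the inside\<close>
    then have "\<sigma> * a + (- \<sigma> * (a / N) - e) * N < 0" using N by (simp add: field_simps)
    from key[OF this] show "\<sigma> * x $ i \<le> \<sigma> * (a / N) + e" by simp
  qed
  from this[of 1] this[of "- 1"] have "x $ i = a / N" by simp
  moreover have "S.D (unit_dir i) ?z = of_real a" "S.D last_dir ?z = of_real N"
    unfolding a_def N_def by (rule S_D_real[OF z], simp)+
  ultimately show ?thesis by simp
qed

text \<open>For \<open>\<beta> = 0\<close> the partition function is constantly \<open>1\<close>. It would decay exponentially if the pieces were subcritical
at \<open>0\<close>, hence also slightly to the right of it, and it would grow exponentially if they were supercritical.\<close>

lemma piece_gf_0: "piece_gf 0 0 = 1"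
proof -
  let ?f = "\<lambda>\<mu>. Re (S.M (real_point 0 \<mu>))"
  have z0: "norm (real_point 0 0) < radius" using radius_pos by (simp add: norm_real_point)
  have "isCont ?f 0"
    using DERIV_isCont[OF piece_gf_line_derivative[OF z0, of 0 1]] by simp
  then have lim: "(?f \<longlongrightarrow> piece_gf 0 0) (at 0)"
    using S_M_real[OF z0] by (simp add: isCont_def)
  have small: "\<forall>\<^sub>F \<mu> in at 0. norm (real_point 0 \<mu>) < radius"
  proof -
    have "((\<lambda>\<mu>. norm (real_point 0 \<mu>)) \<longlongrightarrow> \<bar>0\<bar>) (at 0)"
      unfolding norm_real_point by (simp add: tendsto_rabs_zero)
    then show ?thesis using radius_pos by (intro order_tendstoD(2)) auto
  qed
  show ?thesis
  proof (rule ccontr)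
    assume "piece_gf 0 0 \<noteq> 1"
    then consider "piece_gf 0 0 < 1" | "1 < piece_gf 0 0" by linarith
    then show False
    proof cases
      case 1
      have "\<forall>\<^sub>F \<mu> in at_right 0. ?f \<mu> < 1 \<and> norm (real_point 0 \<mu>) < radius \<and> 0 < \<mu>"
        using order_tendstoD(2)[OF lim 1, unfolded eventually_at_split, THEN conjunct2]
          small[unfolded eventually_at_split, THEN conjunct2] eventually_at_right_less[of 0]
        by eventually_elim simp
      then obtain \<mu> where \<mu>: "?f \<mu> < 1" "norm (real_point 0 \<mu>) < radius" "0 < \<mu>"
        using eventually_happens'[OF trivial_limit_at_right_real] by blast
      have "piece_gf 0 \<mu> < 1" using \<mu>(1) S_M_real[OF \<mu>(2)] by simp
      from partition_upper[OF rate_real_point[OF \<mu>(2)] this]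
      obtain C where C: "\<And>n. exp \<mu> ^ n \<le> C" unfolding pathsum_zero by auto
      obtain n where "C < exp \<mu> ^ n" using real_arch_pow[of "exp \<mu>" C] \<mu>(3) by auto
      then show False using C[of n] by simp
    next
      case 2
      have neg: "\<forall>\<^sub>F \<mu> in at_left (0::real). \<mu> < 0" by (simp add: eventually_at_filter)
      have "\<forall>\<^sub>F \<mu> in at_left 0. 1 < ?f \<mu> \<and> norm (real_point 0 \<mu>) < radius \<and> \<mu> < 0"
        using order_tendstoD(1)[OF lim 2, unfolded eventually_at_split, THEN conjunct1]
          small[unfolded eventually_at_split, THEN conjunct1] neg
        by eventually_elim simp
      then obtain \<mu> where \<mu>: "1 < ?f \<mu>" "norm (real_point 0 \<mu>) < radius" "\<mu> < 0"
        using eventually_happens'[OF trivial_limit_at_left_real] by blast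
      have "1 < piece_gf 0 \<mu>" using \<mu>(1) S_M_real[OF \<mu>(2)] by simp
      from partition_lower[OF rate_real_point[OF \<mu>(2)] this]
      obtain c where c: "0 < c" "\<And>n. c \<le> exp \<mu> ^ n" unfolding pathsum_zero by auto
      obtain n where "exp \<mu> ^ n < c" using real_arch_pow_inv[OF c(1), of "exp \<mu>"] \<mu>(3) by auto
      then show False using c(2)[of n] by simp
    qed
  qed
qed

lemma touching_point_unique:
  assumes H: "annealed_rate_function P H"
    and z: "norm (real_point \<beta> \<mu>) < radius" and G: "piece_gf \<beta> \<mu> = 1"
    and \<Phi>: "S.\<Phi> (real_point \<beta> \<mu>) = (complexify x, 1)"
  shows "H x = ereal (\<beta> \<bullet> x + \<mu>)" and "y \<noteq> x \<Longrightarrow> ereal (\<beta> \<bullet> y + \<mu>) < H y"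
proof -
  have grad: "y = x" if "H y \<le> ereal (\<beta> \<bullet> y + \<mu>)" for y
  proof -
    have "complex_of_real (y $ i) = of_real (x $ i)" for i
      using touching_point_gradient[OF H z G that, of i] \<Phi>
      by (simp add: S.\<Phi>_def complexify_def vec_eq_iff)
    then show ?thesis by (simp add: vec_eq_iff)
  qed
  obtain x' where x': "H x' \<le> ereal (\<beta> \<bullet> x' + \<mu>)" using rate_function_touches_tangent[OF H z G] by blast
  with grad[OF x'] show "H x = ereal (\<beta> \<bullet> x + \<mu>)"
    using rate_function_above_tangent[OF H z G, of x] by (intro antisym) auto
  show "ereal (\<beta> \<bullet> y + \<mu>) < H y" if "y \<noteq> x"
    using rate_function_above_tangent[OF H z G, of y] grad[of y] that by (auto simp: less_le not_le)
qed

lemma gradient_at_velocity: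
  assumes H: "annealed_rate_function P H" and v: "limiting_velocity P v"
  shows "S.\<Phi> 0 = (complexify v, 1)"
proof -
  have z: "norm (real_point 0 0) < radius" using radius_pos by (simp add: norm_real_point)
  have 0: "real_point 0 0 = 0" by (simp add: real_point_def complexify_def zero_prod_def vec_eq_iff)
  have "H v \<le> ereal (0 \<bullet> v + 0)"
    using rate_function_at_velocity[OF H v] by (simp add: zero_ereal_def)
  from touching_point_gradient[OF H z piece_gf_0 this] S_M_real[OF z] piece_gf_0
  show ?thesis by (simp add: S.\<Phi>_def 0 complexify_def)
qed

text \<open>The holomorphic function is \<open>f(w) = \<beta>(w) \<bullet> w + \<mu>(w)\<close>, where \<open>(\<beta>(w), \<mu>(w))\<close> is the preimage of \<open>(w, 1)\<close> under
\<open>\<Phi>\<close>. For a real argument the preimage equals its complex conjugate, by injectivity, so it is a real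
point of the level set and the description of the points of contact applies.\<close>

theorem local_parametrization:
  assumes H: "annealed_rate_function P H" and v: "limiting_velocity P v"
  shows "\<exists>R>0. \<exists>f f'. (\<forall>w\<in>ball (complexify v) R. (f has_derivative f' w) (at w) \<and> (\<forall>c k. f' w (c *s k) = c * f' w k)) \<and>
     (\<forall>x\<in>ball v R. H x = ereal (Re (f (complexify x))) \<and>
        (\<exists>\<beta>. \<forall>y. y \<noteq> x \<longrightarrow> H x + ereal (\<beta> \<bullet> (y - x)) < H y))"
proof -
  have z0: "norm (real_point 0 0) < radius" using radius_pos by (simp add: norm_real_point)
  have r0: "real_point 0 0 = 0" by (simp add: real_point_def complexify_def zero_prod_def vec_eq_iff)
  have "S.D last_dir 0 \<noteq> 0" using S_D_last_pos[OF z0] by (auto simp: r0)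
  from S.holomorphic_local_inverse[OF this] obtain U V g g' where
    UV: "open U" "0 \<in> U" "U \<subseteq> ball 0 radius \<inter> {z. S.D last_dir z \<noteq> 0}" "open V" "S.\<Phi> 0 \<in> V"
      "\<forall>z\<in>U. g (S.\<Phi> z) = z" "\<forall>y\<in>V. g y \<in> U \<and> S.\<Phi> (g y) = y"
      "\<forall>y\<in>V. (g has_derivative g' y) (at y) \<and> (\<forall>c h. g' y (cscale c h) = cscale c (g' y h))"
    by (elim exE conjE) (rule that)
  have \<Phi>0: "S.\<Phi> 0 = (complexify v, 1)" by (rule gradient_at_velocity[OF H v])
  let ?y0 = "(complexify v, 1 :: complex)"
  obtain \<rho> where \<rho>: "0 < \<rho>" "ball 0 \<rho> \<subseteq> U" using openE[OF UV(1,2)] by blast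
  obtain R0 where R0: "0 < R0" "ball ?y0 R0 \<subseteq> V" using openE[OF UV(4) UV(5)[unfolded \<Phi>0]] by blast
  have g0: "g ?y0 = 0" using bspec[OF UV(6) UV(2)] unfolding \<Phi>0 .
  have "isCont g ?y0"
    using UV(5,8) unfolding \<Phi>0 by (auto intro: has_derivative_continuous)
  then obtain R1 where R1: "0 < R1" "\<And>y. dist y ?y0 < R1 \<Longrightarrow> dist (g y) (g ?y0) < \<rho>"
    using \<rho>(1) unfolding continuous_at_eps_delta by blast
  define R where "R = min R0 R1"
  have R: "0 < R" using R0(1) R1(1) by (simp add: R_def)
  have dist_pair: "dist (w, 1) ?y0 = dist w (complexify v)" for w :: "complex ^ 'd"
    by (simp add: dist_Pair_Pair)
  have inV: "(w, 1) \<in> V" "norm (g (w, 1)) < \<rho>" if "w \<in> ball (complexify v) R" for w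
  proof -
    have d: "dist (w, 1) ?y0 < R" unfolding dist_pair using that by (simp add: dist_commute)
    then show "(w, 1) \<in> V" using R0(2) by (auto simp: R_def dist_commute)
    have "dist (w, 1) ?y0 < R1" using d by (simp add: R_def)
    from R1(2)[OF this] show "norm (g (w, 1)) < \<rho>" unfolding g0 by simp
  qed
  define f where "f w = (\<Sum>i\<in>UNIV. fst (g (w, 1)) $ i * w $ i) + snd (g (w, 1))" for w
  define f' where "f' w k = (\<Sum>i\<in>UNIV. fst (g (w, 1)) $ i * k $ i + fst (g' (w, 1) (k, 0)) $ i * w $ i)
      + snd (g' (w, 1) (k, 0))" for w k
  have der: "(f has_derivative f' w) (at w)" if w: "w \<in> ball (complexify v) R" for w
  proof -
    have "((\<lambda>w. (w, 1)) has_derivative (\<lambda>k. (k, 0))) (at w)"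
      by (intro has_derivative_Pair has_derivative_ident has_derivative_const)
    from has_derivative_compose[OF this UV(8)[rule_format, OF inV(1)[OF w], THEN conjunct1]]
    have gd: "((\<lambda>w. g (w, 1)) has_derivative (\<lambda>k. g' (w, 1) (k, 0))) (at w)" .
    have nth: "((\<lambda>x. F x $ i) has_derivative (\<lambda>k. F' k $ i)) (at w)" if "(F has_derivative F') (at w)"
      for F F' :: "complex ^ 'd \<Rightarrow> complex ^ 'd" and i
      by (rule bounded_linear.has_derivative[OF bounded_linear_vec_nth that])
    show ?thesis
      unfolding f_def[abs_def] f'_def[abs_def]
      by (intro has_derivative_add has_derivative_sum has_derivative_mult nth has_derivative_fst
          has_derivative_snd gd has_derivative_ident)
  qed
  have clin: "f' w (c *s k) = c * f' w k" if w: "w \<in> ball (complexify v) R" for w c k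
  proof -
    have "g' (w, 1) (c *s k, 0) = cscale c (g' (w, 1) (k, 0))"
      using UV(8)[rule_format, OF inV(1)[OF w], THEN conjunct2, rule_format, of c "(k, 0)"]
      by (simp add: cscale_def)
    then show ?thesis
      by (simp add: f'_def cscale_def sum_distrib_left distrib_left mult_ac)
  qed
  have main: "H x = ereal (Re (f (complexify x))) \<and> (\<exists>\<beta>. \<forall>y. y \<noteq> x \<longrightarrow> H x + ereal (\<beta> \<bullet> (y - x)) < H y)"
    if x: "x \<in> ball v R" for x
  proof -
    have w: "complexify x \<in> ball (complexify v) R" using x by (simp add: dist_complexify)
    define z where "z = g (complexify x, 1)"
    have z: "norm z < \<rho>" "z \<in> U" "S.\<Phi> z = (complexify x, 1)"
      using inV[OF w] UV(7) by (auto simp: z_def)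
    have zr: "norm z < radius" using z(2) UV(3) by auto
    have "conjg z \<in> U" using z(1) \<rho>(2) by (auto simp: norm_conjg)
    moreover have "S.\<Phi> (conjg z) = (complexify x, 1)"
      unfolding S.\<Phi>_conjg[OF zr] z(3) by (simp add: conjg_def complexify_def vec_eq_iff)
    ultimately have "conjg z = z" using bspec[OF UV(6), of "conjg z"] unfolding z_def by simp
    define \<beta> where "\<beta> = (\<chi> i. Re (fst z $ i))"
    define \<mu> where "\<mu> = Re (snd z)"
    have zre: "z = real_point \<beta> \<mu>"
    proof -
      have "fst (conjg z) $ i = cnj (fst z $ i)" for i by (simp add: conjg_def)
      then have "cnj (fst z $ i) = fst z $ i" for i unfolding \<open>conjg z = z\<close> by (rule sym)
      then have "fst z $ i = of_real (Re (fst z $ i))" for i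
        by (rule of_real_Re[OF Reals_cnj_iff[THEN iffD2], symmetric])
      moreover have "snd (conjg z) = cnj (snd z)" by (simp add: conjg_def)
      then have "cnj (snd z) = snd z" unfolding \<open>conjg z = z\<close> by (rule sym)
      then have "snd z = of_real (Re (snd z))"
        by (rule of_real_Re[OF Reals_cnj_iff[THEN iffD2], symmetric])
      ultimately show ?thesis
        unfolding real_point_def complexify_def \<beta>_def \<mu>_def prod_eq_iff vec_eq_iff fst_conv snd_conv vec_lambda_beta
        by blast
    qed
    have n: "norm (real_point \<beta> \<mu>) < radius" using zr zre by simp
    have \<Phi>: "S.\<Phi> (real_point \<beta> \<mu>) = (complexify x, 1)" using z(3) zre by simp
    have "S.M (real_point \<beta> \<mu>) = 1" using \<Phi> by (simp add: S.\<Phi>_def)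
    then have G: "piece_gf \<beta> \<mu> = 1" using S_M_real[OF n] by simp
    have Hx: "H x = ereal (\<beta> \<bullet> x + \<mu>)" by (rule touching_point_unique(1)[OF H n G \<Phi>])
    have "f (complexify x) = of_real (\<beta> \<bullet> x + \<mu>)"
      unfolding f_def z_def[symmetric] zre by (simp add: real_point_def complexify_def inner_vec_def)
    then have 1: "H x = ereal (Re (f (complexify x)))" by (simp add: Hx)
    have "H x + ereal (\<beta> \<bullet> (y - x)) < H y" if "y \<noteq> x" for y
    proof -
      have "H x + ereal (\<beta> \<bullet> (y - x)) = ereal (\<beta> \<bullet> y + \<mu>)"
        by (simp add: Hx inner_diff_right)
      also have "\<dots> < H y" using touching_point_unique(2)[OF H n G \<Phi> that] .
      finally show ?thesis .
    qed
    then show ?thesis using 1 by blast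
  qed
  have derivative: "\<forall>w\<in>ball (complexify v) R. (f has_derivative f' w) (at w) \<and> (\<forall>c k. f' w (c *s k) = c * f' w k)"
    using der clin by blast
  have representation: "\<forall>x\<in>ball v R. H x = ereal (Re (f (complexify x))) \<and>
        (\<exists>\<beta>. \<forall>y. y \<noteq> x \<longrightarrow> H x + ereal (\<beta> \<bullet> (y - x)) < H y)"
    by (rule ballI) (rule main)
  show ?thesis by (intro exI conjI) (rule R, rule derivative, rule representation)
qed

end

section \<open>Analyticity and strict convexity near the velocity\<close>

theorem theorem1p2:
  fixes P :: "'d::finite env measure"
    and H :: "real ^ 'd \<Rightarrow> ereal"
    and v :: "real ^ 'd"
  assumes "prob_space P" and "sets P = sets env_space"
    and "uniformly_elliptic P"
    and "iid_env P"
    and "non_nestling P"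
    and "annealed_rate_function P H"
    and "limiting_velocity P v"
  shows "\<exists>A. open A \<and> v \<in> A \<and>
           (\<forall>x\<in>A. H x < \<infinity>) \<and>
           real_analytic_on A (\<lambda>x. real_of_ereal (H x)) \<and>
           strictly_convex_on A (\<lambda>x. real_of_ereal (H x))"
proof -
  have iid: "iid_environment P"
    using assms(1,2,4) by (intro iid_environment.intro iid_environment_axioms.intro)
  obtain h where h: "height h" "AE \<omega> in P. 1 \<le> (\<Sum>s\<in>unit_steps. measure (\<omega> 0) {s} * real_of_int (h s))"
    using non_nestling_direction[OF iid assms(5)] by blast
  interpret ballistic_environment P h
    using iid h assms(3) by (intro ballistic_environment.intro ballistic_environment_axioms.intro)
  obtain R f f' where R: "0 < R"
    and f: "\<forall>w\<in>ball (complexify v) R. (f has_derivative f' w) (at w) \<and> (\<forall>c k. f' w (c *s k) = c * f' w k)"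
    and Hf: "\<forall>x\<in>ball v R. H x = ereal (Re (f (complexify x))) \<and>
        (\<exists>\<beta>. \<forall>y. y \<noteq> x \<longrightarrow> H x + ereal (\<beta> \<bullet> (y - x)) < H y)"
    using local_parametrization[OF assms(6,7)] by blast
  have "real_analytic_on (ball v R) (\<lambda>x. Re (f (complexify x)))"
  proof (rule holomorphic_imp_real_analytic[OF open_ball[of "complexify v" R]])
    show "(f has_derivative f' w) (at w)" if "w \<in> ball (complexify v) R" for w
      using f that by blast
    show "f' w (c *s k) = c * f' w k" if "w \<in> ball (complexify v) R" for w c k
      using f that by blast
    show "complexify x \<in> ball (complexify v) R" if "x \<in> ball v R" for x
      using that by (simp add: dist_complexify)
  qed
  then have "real_analytic_on (ball v R) (\<lambda>x. real_of_ereal (H x))"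
  proof (rule real_analytic_on_cong[OF _ open_ball])
    fix x assume "x \<in> ball v R"
    then have "H x = ereal (Re (f (complexify x)))" using Hf by blast
    then show "Re (f (complexify x)) = real_of_ereal (H x)" by simp
  qed
  moreover have "strictly_convex_on (ball v R) (\<lambda>x. real_of_ereal (H x))"
  proof (rule strictly_convex_on_of_tangents[OF convex_ball])
    fix x assume x: "x \<in> ball v R"
    then obtain \<beta> where \<beta>: "\<forall>y. y \<noteq> x \<longrightarrow> H x + ereal (\<beta> \<bullet> (y - x)) < H y" using Hf by blast
    have "real_of_ereal (H x) + \<beta> \<bullet> (y - x) < real_of_ereal (H y)" if y: "y \<in> ball v R" "y \<noteq> x" for y
    proof -
      have "H x = ereal (Re (f (complexify x)))" "H y = ereal (Re (f (complexify y)))"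
        using Hf x y(1) by blast+
      moreover have "H x + ereal (\<beta> \<bullet> (y - x)) < H y" using \<beta> y(2) by blast
      ultimately show ?thesis by simp
    qed
    then show "\<exists>\<beta>. \<forall>y\<in>ball v R. y \<noteq> x \<longrightarrow> real_of_ereal (H x) + \<beta> \<bullet> (y - x) < real_of_ereal (H y)"
      by blast
  qed
  moreover have "\<forall>x\<in>ball v R. H x < \<infinity>"
  proof
    fix x assume "x \<in> ball v R"
    then have "H x = ereal (Re (f (complexify x)))" using Hf by blast
    then show "H x < \<infinity>" by simp
  qed
  ultimately show ?thesis
    using R by (intro exI[of _ "ball v R"]) simp
qed

end
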